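(* Let $\omega:\mathbb{Z}_{+}\to[1,+\infty)$ be such that $\lim_{n\to\infty}\omega(n)^{1/n}=1$; for every integer $k\geq0$, the sequence $n\mapsto\log\bigl(\omega(n)(n+1)^{-k}\bigr)$ is concave for large $n$; $\omega$ is log-convex; and $$\sum_{n\geq0}\frac{\log\omega(n)}{n^{3/2}+1}=\infty.$$ Then every nontrivial (i.e. nonzero) closed invariant subspace of $S_\omega$ has finite co-dimension.
   Context: $\mathbb{Z}_+=\{0,1,2,\ldots\}$. $S_\omega:\ell^2(\mathbb{Z}_+)\to\ell^2(\mathbb{Z}_+)$ is the weighted unilateral shift $S_\omega e_n=\frac{\omega(n+1)}{\omega(n)}e_{n+1}$, where $\{e_n\}_{n\geq0}$ is the standard orthonormal basis of $\ell^2(\mathbb{Z}_+)$. A function $\omega$ on $\mathbb{Z}_+$ is called log-convex here if it extends to a function on $\mathbb{R}_+$ such that $t\mapsto\log\omega(\exp t)$ is convex for large $t$. *)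

theory Defs
  imports "HOL-Analysis.Analysis"
begin

lemma ell2_add_summable:
  fixes f g :: "nat \<Rightarrow> complex"
  assumes "summable (\<lambda>n. (cmod (f n))\<^sup>2)" "summable (\<lambda>n. (cmod (g n))\<^sup>2)"
  shows "summable (\<lambda>n. (cmod (f n + g n))\<^sup>2)"
proof (rule summable_comparison_test)
  show "summable (\<lambda>n. 2 * (cmod (f n))\<^sup>2 + 2 * (cmod (g n))\<^sup>2)"
    by (intro summable_add summable_mult assms)
  have "(cmod (f n + g n))\<^sup>2 \<le> 2 * (cmod (f n))\<^sup>2 + 2 * (cmod (g n))\<^sup>2" for n
  proof -
    have "(cmod (f n + g n))\<^sup>2 \<le> (cmod (f n) + cmod (g n))\<^sup>2"
      by (intro power_mono norm_triangle_ineq) auto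
    moreover have "0 \<le> (cmod (f n) - cmod (g n))\<^sup>2" by simp
    ultimately show ?thesis by (simp add: power2_eq_square algebra_simps)
  qed
  then show "\<exists>N. \<forall>n\<ge>N. norm ((cmod (f n + g n))\<^sup>2) \<le> 2 * (cmod (f n))\<^sup>2 + 2 * (cmod (g n))\<^sup>2"
    by auto
qed

typedef ell2 = "{f :: nat \<Rightarrow> complex. summable (\<lambda>n. (cmod (f n))\<^sup>2)}"
  morphisms coord Abs_ell2
  by (rule exI[of _ "\<lambda>_. 0"]) simp

setup_lifting type_definition_ell2

lemma ell2_eqI: "(\<And>n. coord x n = coord y n) \<Longrightarrow> x = y"
  by (metis coord_inject ext)

lemma summable_coord: "summable (\<lambda>n. (cmod (coord x n))\<^sup>2)"
  using coord[of x] by simp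

lift_definition cscale :: "complex \<Rightarrow> ell2 \<Rightarrow> ell2" is "\<lambda>c f n. c * f n"
  by (simp add: norm_mult power_mult_distrib summable_mult)

instantiation ell2 :: real_normed_vector
begin

lift_definition zero_ell2 :: ell2 is "\<lambda>_. 0" by simp

lift_definition plus_ell2 :: "ell2 \<Rightarrow> ell2 \<Rightarrow> ell2" is "\<lambda>f g n. f n + g n"
  by (rule ell2_add_summable)

lift_definition uminus_ell2 :: "ell2 \<Rightarrow> ell2" is "\<lambda>f n. - f n" by simp

definition minus_ell2 :: "ell2 \<Rightarrow> ell2 \<Rightarrow> ell2" where "x - y = x + - y" for x y :: ell2

definition scaleR_ell2 :: "real \<Rightarrow> ell2 \<Rightarrow> ell2" where "scaleR_ell2 r x = cscale (of_real r) x"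

definition norm_ell2 :: "ell2 \<Rightarrow> real" where
  "norm_ell2 x = sqrt (\<Sum>n. (cmod (coord x n))\<^sup>2)"

definition sgn_ell2 :: "ell2 \<Rightarrow> ell2" where "sgn_ell2 x = inverse (norm x) *\<^sub>R x" for x :: ell2

definition dist_ell2 :: "ell2 \<Rightarrow> ell2 \<Rightarrow> real" where "dist_ell2 x y = norm (x - y)" for x y :: ell2

definition uniformity_ell2 :: "(ell2 \<times> ell2) filter" where
  "uniformity_ell2 = (INF e\<in>{0<..}. principal {(x, y). dist x y < e})"

definition open_ell2 :: "ell2 set \<Rightarrow> bool" where
  "open_ell2 U \<longleftrightarrow> (\<forall>x\<in>U. eventually (\<lambda>(x', y). x' = x \<longrightarrow> y \<in> U) uniformity)"

instance
proof
  fix x y z :: ell2 and a b :: real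
  show "x + y + z = x + (y + z)" "x + y = y + x" "0 + x = x" "- x + x = 0"
    by (transfer; simp add: algebra_simps)+
  show "x - y = x + - y" by (rule minus_ell2_def)
  show "a *\<^sub>R (x + y) = a *\<^sub>R x + a *\<^sub>R y" "(a + b) *\<^sub>R x = a *\<^sub>R x + b *\<^sub>R x"
    "a *\<^sub>R b *\<^sub>R x = (a * b) *\<^sub>R x" "1 *\<^sub>R x = x"
    unfolding scaleR_ell2_def by (transfer; simp add: algebra_simps)+
  show "sgn x = inverse (norm x) *\<^sub>R x" by (rule sgn_ell2_def)
  show "dist x y = norm (x - y)" by (rule dist_ell2_def)
  show "uniformity = (INF e\<in>{0<..}. principal {(x::ell2, y). dist x y < e})"
    by (rule uniformity_ell2_def)
  show "open U \<longleftrightarrow> (\<forall>x\<in>U. eventually (\<lambda>(x', y). x' = x \<longrightarrow> y \<in> U) uniformity)" for U :: "ell2 set"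
    by (rule open_ell2_def)
  show "norm x = 0 \<longleftrightarrow> x = 0"
  proof
    assume "norm x = 0"
    then have "\<forall>n. coord x n = 0"
      using suminf_eq_zero_iff[OF summable_coord[of x]] by (simp add: norm_ell2_def)
    then show "x = 0" by (intro ell2_eqI) (simp add: zero_ell2.rep_eq)
  qed (simp add: norm_ell2_def zero_ell2.rep_eq)
  show "norm (a *\<^sub>R x) = \<bar>a\<bar> * norm x"
    by (simp add: norm_ell2_def scaleR_ell2_def cscale.rep_eq norm_mult power_mult_distrib
        suminf_mult[OF summable_coord] real_sqrt_mult)
  show "norm (x + y) \<le> norm x + norm y"
  proof -
    have part: "L2_set (\<lambda>n. cmod (coord z n)) {..<N} \<le> norm z" for z N
      unfolding norm_ell2_def L2_set_def
      by (intro real_sqrt_le_mono sum_le_suminf summable_coord) auto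
    have "(\<Sum>n<N. (cmod (coord (x + y) n))\<^sup>2) \<le> (norm x + norm y)\<^sup>2" for N
    proof -
      have "L2_set (\<lambda>n. cmod (coord (x + y) n)) {..<N}
          \<le> L2_set (\<lambda>n. cmod (coord x n) + cmod (coord y n)) {..<N}"
        by (intro L2_set_mono) (auto simp: plus_ell2.rep_eq norm_triangle_ineq)
      also have "\<dots> \<le> L2_set (\<lambda>n. cmod (coord x n)) {..<N} + L2_set (\<lambda>n. cmod (coord y n)) {..<N}"
        by (rule L2_set_triangle_ineq)
      also have "\<dots> \<le> norm x + norm y" by (intro add_mono part)
      finally show ?thesis unfolding L2_set_def by (rule sqrt_le_D)
    qed
    then have "(\<Sum>n. (cmod (coord (x + y) n))\<^sup>2) \<le> (norm x + norm y)\<^sup>2"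
      by (intro suminf_le_const summable_coord)
    moreover have "0 \<le> norm z" for z :: ell2
      unfolding norm_ell2_def by (intro real_sqrt_ge_zero suminf_nonneg summable_coord) auto
    ultimately show ?thesis
      unfolding norm_ell2_def[of "x + y"] by (intro real_le_lsqrt) auto
  qed
qed

end

text \<open>The class structure above only provides real scalars.  Complex subspaces and
  complex spans are \<open>ell2.subspace\<close> and \<open>ell2.span\<close>.\<close>

global_interpretation ell2: vector_space cscale
  by unfold_locales (transfer; simp add: algebra_simps)+

lift_definition basis_vec :: "nat \<Rightarrow> ell2" is "\<lambda>n k. if k = n then 1 else 0"
proof -
  fix n :: nat
  show "summable (\<lambda>k. (cmod (if k = n then 1 else 0))\<^sup>2)"
    by (rule summable_finite[of "{n}"]) auto
qed

definition shift_coord :: "(nat \<Rightarrow> real) \<Rightarrow> (nat \<Rightarrow> complex) \<Rightarrow> nat \<Rightarrow> complex" where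
  "shift_coord \<omega> f k = (case k of 0 \<Rightarrow> 0 | Suc n \<Rightarrow> complex_of_real (\<omega> (Suc n) / \<omega> n) * f n)"

text \<open>If the weights \<open>\<omega> (n + 1) / \<omega> n\<close> are unbounded, the sequence below need not be
  square-summable and \<open>Abs_ell2\<close> is unspecified there.  The lemmas that follow show that
  bounded weights give a bounded operator with the defining action on the basis, and that the
  weights are bounded whenever \<open>log \<omega>\<close> is concave for large arguments.\<close>

definition weighted_shift :: "(nat \<Rightarrow> real) \<Rightarrow> ell2 \<Rightarrow> ell2" where
  "weighted_shift \<omega> x = Abs_ell2 (shift_coord \<omega> (coord x))"

definition eventually_concave_seq :: "(nat \<Rightarrow> real) \<Rightarrow> bool" where
  "eventually_concave_seq a \<longleftrightarrow> (\<exists>N. \<forall>n\<ge>N. a n + a (n + 2) \<le> 2 * a (n + 1))"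

text \<open>The values of an extension at positive non-integers are only required to be positive,
  so that their logarithm makes sense.\<close>

definition log_convex :: "(nat \<Rightarrow> real) \<Rightarrow> bool" where
  "log_convex \<omega> \<longleftrightarrow> (\<exists>w :: real \<Rightarrow> real. (\<forall>n. w (real n) = \<omega> n) \<and> (\<forall>x\<ge>0. w x > 0) \<and>
     (\<exists>T. convex_on {T..} (\<lambda>t. ln (w (exp t)))))"

text \<open>The quotient by \<open>M\<close> is spanned by the classes of finitely many vectors.\<close>

definition finite_codim :: "ell2 set \<Rightarrow> bool" where
  "finite_codim M \<longleftrightarrow> (\<exists>B. finite B \<and> ell2.span (M \<union> B) = UNIV)"

lemma shift_coord_summable:
  assumes "\<And>n. \<bar>\<omega> (Suc n) / \<omega> n\<bar> \<le> C"
  shows "summable (\<lambda>n. (cmod (shift_coord \<omega> (coord x) n))\<^sup>2)"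
    and "(\<Sum>n. (cmod (shift_coord \<omega> (coord x) n))\<^sup>2) \<le> C\<^sup>2 * (norm x)\<^sup>2"
proof -
  let ?g = "\<lambda>n. (cmod (shift_coord \<omega> (coord x) n))\<^sup>2"
  have le: "?g (Suc n) \<le> C\<^sup>2 * (cmod (coord x n))\<^sup>2" for n
  proof -
    have "?g (Suc n) = \<bar>\<omega> (Suc n) / \<omega> n\<bar>\<^sup>2 * (cmod (coord x n))\<^sup>2"
      unfolding shift_coord_def nat.case norm_mult norm_of_real power_mult_distrib ..
    also have "\<dots> \<le> C\<^sup>2 * (cmod (coord x n))\<^sup>2"
      by (intro mult_right_mono power_mono assms) auto
    finally show ?thesis .
  qed
  have sC: "summable (\<lambda>n. C\<^sup>2 * (cmod (coord x n))\<^sup>2)" by (intro summable_mult summable_coord)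
  have sS: "summable (\<lambda>n. ?g (Suc n))"
    by (rule summable_comparison_test[OF _ sC]) (use le in auto)
  then show s: "summable ?g" using summable_Suc_iff[of ?g] by blast
  have "(\<Sum>n. ?g n) = (\<Sum>n. ?g (Suc n))"
    using suminf_split_head[OF s] by (simp add: shift_coord_def)
  also have "\<dots> \<le> (\<Sum>n. C\<^sup>2 * (cmod (coord x n))\<^sup>2)" by (intro suminf_le le sS sC)
  also have "\<dots> = C\<^sup>2 * (norm x)\<^sup>2"
    by (simp add: norm_ell2_def suminf_mult summable_coord suminf_nonneg)
  finally show "(\<Sum>n. ?g n) \<le> C\<^sup>2 * (norm x)\<^sup>2" .
qed

lemma coord_weighted_shift:
  assumes "\<And>n. \<bar>\<omega> (Suc n) / \<omega> n\<bar> \<le> C"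
  shows "coord (weighted_shift \<omega> x) = shift_coord \<omega> (coord x)"
  unfolding weighted_shift_def using shift_coord_summable(1)[of \<omega> C, OF assms] by (simp add: Abs_ell2_inverse)

lemma weighted_shift_basis:
  assumes "\<And>n. \<bar>\<omega> (Suc n) / \<omega> n\<bar> \<le> C"
  shows "weighted_shift \<omega> (basis_vec n) = cscale (of_real (\<omega> (n + 1) / \<omega> n)) (basis_vec (n + 1))"
  by (rule ell2_eqI)
    (auto simp: coord_weighted_shift[of \<omega> C, OF assms] shift_coord_def basis_vec.rep_eq cscale.rep_eq
      split: nat.split)

lemma weighted_shift_cscale:
  assumes "\<And>n. \<bar>\<omega> (Suc n) / \<omega> n\<bar> \<le> C"
  shows "weighted_shift \<omega> (cscale c x) = cscale c (weighted_shift \<omega> x)"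
  by (rule ell2_eqI)
    (auto simp: coord_weighted_shift[of \<omega> C, OF assms] shift_coord_def cscale.rep_eq split: nat.split)

lemma bounded_linear_weighted_shift:
  assumes "\<And>n. \<bar>\<omega> (Suc n) / \<omega> n\<bar> \<le> C"
  shows "bounded_linear (weighted_shift \<omega>)"
proof (rule bounded_linear_intro)
  show "weighted_shift \<omega> (x + y) = weighted_shift \<omega> x + weighted_shift \<omega> y" for x y
    by (rule ell2_eqI) (auto simp: coord_weighted_shift[of \<omega> C, OF assms] shift_coord_def plus_ell2.rep_eq
        algebra_simps add_divide_distrib split: nat.split)
  show "weighted_shift \<omega> (r *\<^sub>R x) = r *\<^sub>R weighted_shift \<omega> x" for r x
    unfolding scaleR_ell2_def by (rule weighted_shift_cscale[of \<omega> C, OF assms])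
  have "0 \<le> C" using assms[of 0] by linarith
  then show "norm (weighted_shift \<omega> x) \<le> norm x * C" for x
    using shift_coord_summable(2)[of \<omega> C x, OF assms]
    unfolding norm_ell2_def[of "weighted_shift \<omega> x"] coord_weighted_shift[of \<omega> C, OF assms]
    by (intro real_le_lsqrt) (auto simp: power_mult_distrib mult.commute)
qed

lemma bounded_weights:
  assumes pos: "\<And>n. \<omega> n > 0" and conc: "eventually_concave_seq (\<lambda>n. ln (\<omega> n))"
  shows "\<exists>C. \<forall>n. \<bar>\<omega> (Suc n) / \<omega> n\<bar> \<le> C"
proof -
  define d where "d n = ln (\<omega> (Suc n)) - ln (\<omega> n)" for n
  obtain N where N: "\<And>n. n \<ge> N \<Longrightarrow> ln (\<omega> n) + ln (\<omega> (n + 2)) \<le> 2 * ln (\<omega> (n + 1))"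
    using conc unfolding eventually_concave_seq_def by blast
  have dec: "d n \<le> d N" if "n \<ge> N" for n
    using that
  proof (induction n rule: dec_induct)
    case (step n)
    have "d (Suc n) \<le> d n" using N[OF step.hyps(1)] by (simp add: d_def)
    with step.IH show ?case by linarith
  qed simp
  have "d n \<le> Max (d ` {..N})" for n
  proof (cases "n \<le> N")
    case False
    have "d n \<le> d N" using False by (intro dec) simp
    also have "\<dots> \<le> Max (d ` {..N})" by (intro Max_ge) auto
    finally show ?thesis .
  qed (auto intro!: Max_ge)
  moreover have "\<bar>\<omega> (Suc n) / \<omega> n\<bar> = exp (d n)" for n
    using pos[of n] pos[of "Suc n"] by (simp add: d_def exp_diff)
  ultimately have "\<forall>n. \<bar>\<omega> (Suc n) / \<omega> n\<bar> \<le> exp (Max (d ` {..N}))" by simp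
  then show ?thesis ..
qed

end

theory Submission
  imports Defs "HOL-Complex_Analysis.Complex_Analysis" "HOL-Real_Asymp.Real_Asymp"
begin

text \<open>
  Writing \<open>x\<^sub>n = f\<^sub>n \<omega>(n)\<close> turns the shift into multiplication by \<open>z\<close> on the power series \<open>f\<close> with
  \<open>\<Sum> \<bar>f\<^sub>n\<bar>\<^sup>2 \<omega>(n)\<^sup>2 < \<infinity>\<close>, a Banach algebra of functions smooth up to the unit circle.

  If \<open>f\<close> vanishes to infinite order at \<open>\<lambda>\<close> with \<open>0 < \<bar>\<lambda>\<bar> \<le> 1\<close>, all moments of \<open>a\<^sub>n = f\<^sub>n \<lambda>\<^sup>n\<close> vanish, so
  \<open>\<Sum> a\<^sub>n / (w\<^sup>2 + n)\<close> decays like \<open>1 / \<omega>(\<bar>w\<bar>\<^sup>2)\<close>, up to powers of \<open>\<bar>w\<bar>\<close>, in a half-plane; the divergence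
  hypothesis is precisely that the logarithmic integral diverges, and \<open>f = 0\<close>. Hence a nonzero \<open>f\<close> has
  finitely many zeros in the closed disc, and \<open>f = p g\<close> with a polynomial \<open>p\<close> and a zero-free \<open>g\<close>.

  The division costs smoothness at the zeros on the circle, so \<open>1 / g\<close> lies only in a larger algebra,
  but \<open>p / g\<close> lies in the original one by a tame version of Newman's proof of Wiener's lemma. Thus the
  invariant subspace contains \<open>f (p / g) = p\<^sup>2\<close> together with all its shifts.
\<close>

section \<open>Rapidly growing weights\<close>

text \<open>The exponent 3/2 comes from the variable \<open>w\<^sup>2\<close>: under
  \<open>n = y\<^sup>2\<close> the integral of \<open>log \<omega>(y\<^sup>2) / y\<^sup>2\<close>
  over the boundary line becomes, up to a factor, the sum of
  \<open>log \<omega>(n) / n powr (3/2)\<close>. Log-convexity enters in the choice of the number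
  \<open>k\<close> of moments to subtract: one \<open>k\<close> has to make
  \<open>(m / n) ^ k\<close> smaller than \<open>\<omega> m / \<omega> n\<close>, up to powers, for
  all \<open>m\<close> at once, and the slope of a convex function of \<open>log n\<close> provides
  it. The obstacle throughout is the loss of powers of \<open>n\<close>, at each derivative and at
  each division by a zero on the circle. Concavity after removal of any power
  \<open>(n + 1) ^ k\<close> says that \<omega> keeps its regularity under such losses, and rapid
  growth makes them harmless in the uniqueness argument. They are not harmless for
  \<open>1 / g\<close>. There the decisive point is an estimate of products whose terms contain at
  most one strong norm, all other factors being weak norms: iterating it on powers gives the weak
  growth rate times a linear factor, and a geometric series survives that.\<close>

locale rapid_weight =
  fixes \<omega> :: "nat \<Rightarrow> real"
  assumes ge1: "1 \<le> \<omega> n"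
    and root_lim: "(\<lambda>n. \<omega> n powr (1 / real n)) \<longlonglongrightarrow> 1"
    and concave: "eventually_concave_seq (\<lambda>n. ln (\<omega> n * (real n + 1) powr (- real k)))"
begin

lemma pos [simp]: "0 < \<omega> n"
  using ge1[of n] by linarith

lemma nonneg [simp]: "0 \<le> \<omega> n"
  using ge1[of n] by linarith

lemma nonzero [simp]: "\<omega> n \<noteq> 0"
  using pos[of n] by linarith

definition lw :: "nat \<Rightarrow> nat \<Rightarrow> real" where
  "lw k n = ln (\<omega> n) - real k * ln (real n + 1)"

lemma exp_lw: "exp (lw k n) = \<omega> n / (real n + 1) ^ k"
proof -
  have "exp (real k * ln (real n + 1)) = (real n + 1) ^ k"
    by (subst exp_of_nat_mult) simp
  then show ?thesis
    by (simp add: lw_def exp_diff)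
qed

lemma lw_concave: "\<exists>N. \<forall>n\<ge>N. lw k (n + 2) - lw k (n + 1) \<le> lw k (n + 1) - lw k n"
proof -
  have eq: "ln (\<omega> n * (real n + 1) powr (- real k)) = lw k n" for n
    by (simp add: lw_def ln_mult ln_powr)
  obtain N where "\<And>n. n \<ge> N \<Longrightarrow> lw k n + lw k (n + 2) \<le> 2 * lw k (n + 1)"
    using concave[of k] unfolding eventually_concave_seq_def eq by blast
  then show ?thesis
    by (intro exI[of _ N]) (auto simp: algebra_simps)
qed

lemma lw_slope_antimono:
  assumes "\<forall>n\<ge>N. lw k (n + 2) - lw k (n + 1) \<le> lw k (n + 1) - lw k n" "N \<le> m" "m \<le> n"
  shows "lw k (n + 1) - lw k n \<le> lw k (m + 1) - lw k m"
  using assms(3)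
proof (induction n rule: dec_induct)
  case (step n)
  then show ?case using assms(1)[rule_format, of n] assms(2) by simp
qed simp

text \<open>A negative slope would persist by concavity and contradict \<open>1 \<le> \<omega> n\<close>.\<close>

lemma lw_mono:
  assumes conc: "\<forall>n\<ge>N. lw k (n + 2) - lw k (n + 1) \<le> lw k (n + 1) - lw k n" and "N \<le> n"
  shows "lw k n \<le> lw k (n + 1)"
proof (rule ccontr)
  assume neg: "\<not> lw k n \<le> lw k (n + 1)"
  define e where "e = lw k n - lw k (n + 1)"
  have e: "e > 0" using neg by (simp add: e_def)
  have le: "lw k (n + j) \<le> lw k n - e * real j" for j
  proof (induction j)
    case (Suc j)
    show ?case
      using Suc lw_slope_antimono[OF conc \<open>N \<le> n\<close>, of "n + j"] by (simp add: e_def algebra_simps)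
  qed simp
  have "e * real j \<le> lw k n + real k * ln (real (n + j) + 1)" for j
    using le[of j] ln_ge_zero[OF ge1[of "n + j"]] unfolding lw_def by linarith
  moreover have "eventually (\<lambda>j::nat. e * real j > a + b * ln (real n + real j + 1)) sequentially"
    if "b \<ge> 0" for a b :: real
    using e that by real_asymp
  from this[of "real k" "lw k n"]
  have "eventually (\<lambda>j::nat. e * real j > lw k n + real k * ln (real (n + j) + 1)) sequentially"
    by simp
  ultimately show False
    by (auto dest!: eventually_happens simp: not_less[symmetric])
qed

text \<open>By \<open>lw_mono\<close>, \<open>\<omega> n / (n + 1) ^ k\<close> increases from some
  index on; the finitely many pairs below that index only cost a constant.\<close>

lemma quasi_mono:
  "\<exists>C\<ge>1. \<forall>m n. m \<le> n \<longrightarrow> \<omega> m * (real n + 1) ^ k \<le> C * \<omega> n * (real m + 1) ^ k"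
proof -
  obtain N where N: "\<forall>n\<ge>N. lw k (n + 2) - lw k (n + 1) \<le> lw k (n + 1) - lw k n"
    using lw_concave by blast
  define D where "D = Max ((\<lambda>(i, j). lw k i - lw k j) ` ({..N} \<times> {..N}))"
  have D: "lw k i - lw k j \<le> D" if "i \<le> N" "j \<le> N" for i j
    unfolding D_def by (rule Max_ge) (use that in force)+
  have D0: "D \<ge> 0" using D[of 0 0] by simp
  have mono: "lw k m \<le> lw k n" if "N \<le> m" "m \<le> n" for m n
    using that(2)
  proof (induction n rule: dec_induct)
    case (step n)
    then show ?case using lw_mono[OF N, of n] that(1) by simp
  qed simp
  have "lw k m \<le> lw k n + D" if "m \<le> n" for m n
  proof (cases "N \<le> m")
    case True
    then show ?thesis using mono[of m n] that D0 by simp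
  next
    case False
    show ?thesis
    proof (cases "N \<le> n")
      case True
      then show ?thesis using mono[of N n] D[of m N] False by simp
    next
      case F: False
      then show ?thesis using D[of m n] that by simp
    qed
  qed
  then have "exp (lw k m) \<le> exp (lw k n) * exp D" if "m \<le> n" for m n
    using that by (simp flip: exp_add)
  then have "\<omega> m * (real n + 1) ^ k \<le> exp D * \<omega> n * (real m + 1) ^ k" if "m \<le> n" for m n
    using that unfolding exp_lw by (simp add: field_simps)
  then show ?thesis using D0 by (intro exI[of _ "exp D"]) auto
qed

text \<open>A concave function is subadditive up to a constant, and this is applied to
  \<open>lw k\<close> instead of \<open>log \<omega>\<close>. The removed powers leave
  \<open>((i + j + 1) / ((i + 1) * (j + 1))) ^ k\<close>, and
  \<open>i + j + 1 \<le> 2 * (i + 1)\<close> turns this into a gain of \<open>(j + 1) ^ k\<close>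
  for the smaller index.\<close>

lemma submult:
  "\<exists>C\<ge>1. \<forall>i j. j \<le> i \<longrightarrow> \<omega> (i + j) * (real j + 1) ^ k \<le> C * \<omega> i * \<omega> j"
proof -
  obtain N where N: "\<forall>n\<ge>N. lw k (n + 2) - lw k (n + 1) \<le> lw k (n + 1) - lw k n"
    using lw_concave by blast
  define D where "D = Max ((\<lambda>n. lw k (n + 1) - lw k n) ` {..N})"
  have D: "lw k (n + 1) - lw k n \<le> D" for n
  proof (cases "n \<le> N")
    case True
    then show ?thesis unfolding D_def by (intro Max_ge) auto
  next
    case False
    then have "lw k (n + 1) - lw k n \<le> lw k (N + 1) - lw k N"
      by (intro lw_slope_antimono[OF N]) auto
    also have "\<dots> \<le> D" unfolding D_def by (intro Max_ge) auto
    finally show ?thesis .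
  qed
  have D': "lw k (n + l) \<le> lw k n + D * real l" for n l
  proof (induction l)
    case (Suc l)
    then show ?case using D[of "n + l"] by (simp add: algebra_simps)
  qed simp
  define E where "E = Max ((\<lambda>(i, j). lw k (i + j) - lw k i - lw k j) ` ({..N} \<times> {..N}))"
  \<comment> \<open>\<open>E\<close> serves the case that both indices are below \<open>N\<close>;
    the other entry serves \<open>N \<le> i\<close>, where the increment over \<open>j\<close> steps
    is compared with the one starting at \<open>N\<close>.\<close>
  define c where "c = max 0 (max E (D * real N - lw k N))"
  have sub: "lw k (i + j) \<le> lw k i + lw k j + c" if "j \<le> i" for i j
  proof (cases "N \<le> i")
    case True
    have "lw k (i + j) - lw k i \<le> lw k (N + j) - lw k N"
    proof (induction j)
      case (Suc j)
      then show ?case using lw_slope_antimono[OF N, of "N + j" "i + j"] True by simp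
    qed simp
    moreover have "lw k (N + j) \<le> lw k j + D * real N"
      using D'[of j N] by (simp add: add.commute)
    ultimately show ?thesis by (simp add: c_def)
  next
    case False
    have "lw k (i + j) - lw k i - lw k j \<le> E"
      unfolding E_def by (rule Max_ge) (use that False in force)+
    then show ?thesis by (simp add: c_def)
  qed
  have "\<omega> (i + j) * (real j + 1) ^ k \<le> (exp c * 2 ^ k) * \<omega> i * \<omega> j" if "j \<le> i" for i j
  proof -
    have "exp (lw k (i + j)) \<le> exp (lw k i) * exp (lw k j) * exp c"
      using sub[OF that] by (simp flip: exp_add)
    then have "\<omega> (i + j) \<le> exp c * \<omega> i * \<omega> j * ((real (i + j) + 1) ^ k / ((real i + 1) ^ k * (real j + 1) ^ k))"
      unfolding exp_lw by (simp add: field_simps)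
    also have "\<dots> \<le> exp c * \<omega> i * \<omega> j * ((2 * (real i + 1)) ^ k / ((real i + 1) ^ k * (real j + 1) ^ k))"
      using that by (intro mult_left_mono divide_right_mono power_mono) auto
    also have "\<dots> = exp c * \<omega> i * \<omega> j * (2 ^ k / (real j + 1) ^ k)"
      unfolding power_mult_distrib by simp
    finally show ?thesis by (simp add: field_simps)
  qed
  moreover have "1 \<le> exp c * 2 ^ k"
    using mult_mono[of 1 "exp c" 1 "2 ^ k :: real"] by (simp add: c_def)
  ultimately show ?thesis by (intro exI[of _ "exp c * 2 ^ k"]) auto
qed

lemma shift_bound: "\<exists>C\<ge>1. \<forall>n. \<omega> (n + i) \<le> C * \<omega> n"
proof -
  obtain C where C: "C \<ge> 1" "\<And>i j. j \<le> i \<Longrightarrow> \<omega> (i + j) \<le> C * \<omega> i * \<omega> j"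
    using submult[of 0] by auto
  have "\<omega> (n + i) \<le> (C * \<omega> i) * \<omega> n" for n
    using C(2)[of i n] C(2)[of n i] by (cases "i \<le> n") (auto simp: mult_ac add.commute)
  moreover have "1 \<le> C * \<omega> i" using mult_mono[of 1 C 1 "\<omega> i"] C(1) ge1[of i] by simp
  ultimately show ?thesis by blast
qed

lemma subexponential:
  assumes "\<rho> > 1"
  shows "\<exists>C>0. \<forall>n. \<omega> n \<le> C * \<rho> ^ n"
proof -
  have "eventually (\<lambda>n. \<omega> n powr (1 / real n) < \<rho> \<and> n > 0) sequentially"
    using order_tendstoD(2)[OF root_lim assms] eventually_gt_at_top by eventually_elim auto
  then obtain N where N: "\<And>n. n \<ge> N \<Longrightarrow> \<omega> n powr (1 / real n) < \<rho> \<and> n > 0"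
    by (auto simp: eventually_sequentially)
  define C where "C = 1 + Max (\<omega> ` {..N})"
  have C: "\<omega> n \<le> C" if "n \<le> N" for n
  proof -
    have "\<omega> n \<le> Max (\<omega> ` {..N})" using that by (intro Max_ge) auto
    then show ?thesis by (simp add: C_def)
  qed
  then have C1: "C \<ge> 1" using ge1[of 0] C[of 0] by linarith
  have "\<omega> n \<le> C * \<rho> ^ n" for n
  proof (cases "n \<le> N")
    case True
    have "C * 1 \<le> C * \<rho> ^ n" using assms C1 by (intro mult_left_mono) auto
    then show ?thesis using C[OF True] by simp
  next
    case False
    then have n: "\<omega> n powr (1 / real n) < \<rho>" "n > 0" using N[of n] by auto
    have "\<omega> n = (\<omega> n powr (1 / real n)) ^ n"
      using n(2) by (subst powr_realpow[symmetric]) (simp_all add: powr_powr)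
    also have "\<dots> \<le> \<rho> ^ n" using n by (intro power_mono) auto
    also have "\<dots> \<le> C * \<rho> ^ n" using C1 assms by simp
    finally show ?thesis .
  qed
  then show ?thesis using C1 by (intro exI[of _ C]) auto
qed

text \<open>Decay like \<open>1 / \<omega> n\<close> up to powers of \<open>n\<close>. Leaving the
  power open keeps the class stable under \<open>fps_XD\<close> and under division at zeros on the
  unit circle, both of which lose powers.\<close>

definition tempered :: "complex fps \<Rightarrow> bool" where
  "tempered h \<longleftrightarrow> (\<exists>C K. \<forall>n. cmod (fps_nth h n) * \<omega> n \<le> C * (real n + 1) ^ K)"

lemma temperedE:
  assumes "tempered h"
  obtains C K where "C > 0" "\<And>n. cmod (fps_nth h n) * \<omega> n \<le> C * (real n + 1) ^ K"
proof -
  obtain C K where CK: "\<And>n. cmod (fps_nth h n) * \<omega> n \<le> C * (real n + 1) ^ K"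
    using assms unfolding tempered_def by blast
  have "0 \<le> cmod (fps_nth h 0) * \<omega> 0" by simp
  also have "\<dots> \<le> C" using CK[of 0] by simp
  finally have "C \<ge> 0" .
  have "cmod (fps_nth h n) * \<omega> n \<le> (C + 1) * (real n + 1) ^ K" for n
    by (rule order_trans[OF CK]) (auto intro!: mult_right_mono)
  with \<open>C \<ge> 0\<close> that[of "C + 1" K] show thesis by simp
qed

text \<open>Comparison with index 0 in \<open>quasi_mono\<close>. This growth is what makes tempered
  series smooth up to the unit circle.\<close>

lemma rapid: "\<exists>C>0. \<forall>n. (real n + 1) ^ k \<le> C * \<omega> n"
proof -
  obtain C where C: "C \<ge> 1" "\<And>m n. m \<le> n \<Longrightarrow> \<omega> m * (real n + 1) ^ k \<le> C * \<omega> n * (real m + 1) ^ k"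
    using quasi_mono[of k] by blast
  have "(real n + 1) ^ k \<le> C * \<omega> n" for n
  proof -
    have "1 * (real n + 1) ^ k \<le> \<omega> 0 * (real n + 1) ^ k"
      by (intro mult_right_mono ge1) auto
    also have "\<dots> \<le> C * \<omega> n" using C(2)[of 0 n] by simp
    finally show ?thesis by simp
  qed
  then show ?thesis using C(1) by (intro exI[of _ C]) auto
qed

lemma summable_inverse_squares: "summable (\<lambda>n. 1 / (real n + 1)\<^sup>2)"
proof -
  have "summable (\<lambda>n. inverse ((real (Suc n))\<^sup>2))"
    by (subst summable_Suc_iff) (rule inverse_power_summable, simp)
  then show ?thesis by (simp add: inverse_eq_divide add.commute)
qed

lemma tempered_summable:
  assumes "tempered h"
  shows "summable (\<lambda>n. cmod (fps_nth h n) * (real n + 1) ^ k)"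
proof -
  obtain C K where C: "C > 0" "\<And>n. cmod (fps_nth h n) * \<omega> n \<le> C * (real n + 1) ^ K"
    using temperedE[OF assms] by metis
  \<comment> \<open>\<open>K\<close> powers pay for the tempered bound, and two more leave a
    summable \<open>1 / (n + 1)\<^sup>2\<close>.\<close>
  obtain D where D: "D > 0" "\<And>n. (real n + 1) ^ (k + K + 2) \<le> D * \<omega> n"
    using rapid[of "k + K + 2"] by blast
  have "cmod (fps_nth h n) * (real n + 1) ^ k \<le> C * D * (1 / (real n + 1)\<^sup>2)" for n
  proof -
    have "(cmod (fps_nth h n) * (real n + 1) ^ k) * (real n + 1) ^ (K + 2)
        = cmod (fps_nth h n) * (real n + 1) ^ (k + K + 2)"
      by (simp add: power_add mult_ac)
    also have "\<dots> \<le> cmod (fps_nth h n) * (D * \<omega> n)"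
      by (intro mult_left_mono D) auto
    also have "\<dots> \<le> D * (C * (real n + 1) ^ K)"
      using C(2)[of n] D(1) by (simp add: mult.left_commute)
    finally have "(real n + 1) ^ K * (cmod (fps_nth h n) * (real n + 1) ^ k * (real n + 1)\<^sup>2)
        \<le> (real n + 1) ^ K * (C * D)"
      by (simp add: power_add power2_eq_square mult_ac)
    then have "cmod (fps_nth h n) * (real n + 1) ^ k * (real n + 1)\<^sup>2 \<le> C * D"
      by (rule mult_left_le_imp_le) simp
    then show ?thesis by (simp add: field_simps)
  qed
  then show ?thesis
    by (intro summable_comparison_test[OF _ summable_mult[OF summable_inverse_squares, of "C * D"]])
      auto
qed

lemma tempered_eval_summable:
  assumes "tempered h" "cmod z \<le> 1"
  shows "summable (\<lambda>n. cmod (fps_nth h n * z ^ n))"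
  using tempered_summable[OF assms(1), of 0]
  by (rule summable_comparison_test[rotated])
    (use assms(2) in \<open>auto simp: norm_mult norm_power intro!: mult_left_le power_le_one exI[of _ 0]\<close>)

lemma continuous_on_eval:
  assumes "tempered h"
  shows "continuous_on (cball 0 1) (eval_fps h)"
proof -
  have "uniform_limit (cball 0 1) (\<lambda>n z. \<Sum>i<n. fps_nth h i * z ^ i) (eval_fps h) sequentially"
    unfolding eval_fps_def
  proof (rule Weierstrass_m_test)
    show "summable (\<lambda>n. cmod (fps_nth h n))"
      using tempered_summable[OF assms, of 0] by simp
  qed (auto simp: norm_mult norm_power intro!: mult_left_le power_le_one)
  then show ?thesis
    by (rule uniform_limit_theorem[rotated]) (auto intro!: continuous_intros always_eventually)
qed

lemma temperedI:
  assumes "\<And>n. cmod (fps_nth h n) * \<omega> n \<le> C * (real n + 1) ^ K"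
  shows "tempered h"
  using assms unfolding tempered_def by blast

lemma tempered_add:
  assumes "tempered g" "tempered h"
  shows "tempered (g + h)"
proof -
  obtain C K where C: "C > 0" "\<And>n. cmod (fps_nth g n) * \<omega> n \<le> C * (real n + 1) ^ K"
    using temperedE[OF assms(1)] by metis
  obtain D L where D: "D > 0" "\<And>n. cmod (fps_nth h n) * \<omega> n \<le> D * (real n + 1) ^ L"
    using temperedE[OF assms(2)] by metis
  show ?thesis
  proof (rule temperedI)
    fix n
    have "cmod (fps_nth (g + h) n) * \<omega> n \<le> (cmod (fps_nth g n) + cmod (fps_nth h n)) * \<omega> n"
      by (intro mult_right_mono) (auto simp: norm_triangle_ineq)
    also have "\<dots> \<le> C * (real n + 1) ^ K + D * (real n + 1) ^ L"
      using C(2)[of n] D(2)[of n] by (simp add: algebra_simps)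
    also have "\<dots> \<le> C * (real n + 1) ^ (K + L) + D * (real n + 1) ^ (K + L)"
      using C(1) D(1) by (intro add_mono mult_left_mono power_increasing) auto
    finally show "cmod (fps_nth (g + h) n) * \<omega> n \<le> (C + D) * (real n + 1) ^ (K + L)"
      by (simp add: algebra_simps)
  qed
qed

lemma tempered_const_mult:
  assumes "tempered h"
  shows "tempered (fps_const c * h)"
proof -
  obtain C K where C: "C > 0" "\<And>n. cmod (fps_nth h n) * \<omega> n \<le> C * (real n + 1) ^ K"
    using temperedE[OF assms(1)] by metis
  have "cmod (fps_nth (fps_const c * h) n) * \<omega> n \<le> (cmod c * C) * (real n + 1) ^ K" for n
    using mult_left_mono[OF C(2)[of n], of "cmod c"] by (simp add: norm_mult mult_ac)
  then show ?thesis by (rule temperedI)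
qed

lemma tempered_X_mult:
  assumes "tempered h"
  shows "tempered (fps_X * h)"
proof -
  obtain C K where C: "C > 0" "\<And>n. cmod (fps_nth h n) * \<omega> n \<le> C * (real n + 1) ^ K"
    using temperedE[OF assms(1)] by metis
  obtain D where D: "D \<ge> 1" "\<And>n. \<omega> (n + 1) \<le> D * \<omega> n"
    using shift_bound[of 1] by blast
  show ?thesis
  proof (rule temperedI)
    fix n
    show "cmod (fps_nth (fps_X * h) n) * \<omega> n \<le> (C * D) * (real n + 1) ^ K"
    proof (cases n)
      case 0
      then show ?thesis using C(1) D(1) by simp
    next
      case (Suc m)
      have "cmod (fps_nth h m) * \<omega> (m + 1) \<le> cmod (fps_nth h m) * (D * \<omega> m)"
        by (intro mult_left_mono D) auto
      also have "\<dots> \<le> D * (C * (real m + 1) ^ K)"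
        using C(2)[of m] D(1) by (simp add: mult.left_commute)
      also have "\<dots> \<le> D * (C * (real n + 1) ^ K)"
        using C(1) D(1) Suc by (intro mult_left_mono power_mono) auto
      finally show ?thesis by (simp add: Suc mult_ac)
    qed
  qed
qed

lemma tempered_XD:
  assumes "tempered h"
  shows "tempered (fps_XD h)"
proof -
  obtain C K where C: "C > 0" "\<And>n. cmod (fps_nth h n) * \<omega> n \<le> C * (real n + 1) ^ K"
    using temperedE[OF assms(1)] by metis
  have "cmod (fps_nth (fps_XD h) n) * \<omega> n \<le> C * (real n + 1) ^ Suc K" for n
    using mult_mono[OF _ C(2)[of n], of "real n" "real n + 1"]
    by (simp add: norm_mult mult_ac)
  then show ?thesis by (rule temperedI)
qed

section \<open>Evaluation in the closed disc and division by linear factors\<close>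

lemma eval_linear_mult:
  assumes h: "tempered h" and z: "cmod z \<le> 1"
  shows "eval_fps ((fps_X - fps_const c) * h) z = (z - c) * eval_fps h z"
proof -
  have s: "summable (\<lambda>n. fps_nth h n * z ^ n)"
    by (rule summable_norm_cancel[OF tempered_eval_summable[OF h z]])
  have sX: "summable (\<lambda>n. fps_nth (fps_X * h) n * z ^ n)"
    by (rule summable_norm_cancel[OF tempered_eval_summable[OF tempered_X_mult[OF h] z]])
  have "(\<Sum>n. fps_nth (fps_X * h) n * z ^ n) = (\<Sum>n. fps_nth (fps_X * h) (Suc n) * z ^ Suc n)"
    using suminf_split_head[OF sX] by simp
  also have "\<dots> = (\<Sum>n. z * (fps_nth h n * z ^ n))"
    by (simp add: mult_ac)
  also have "\<dots> = z * (\<Sum>n. fps_nth h n * z ^ n)"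
    by (rule suminf_mult[OF s])
  finally have X: "(\<Sum>n. fps_nth (fps_X * h) n * z ^ n) = z * eval_fps h z"
    by (simp add: eval_fps_def)
  have "fps_nth ((fps_X - fps_const c) * h) n * z ^ n
      = fps_nth (fps_X * h) n * z ^ n - c * (fps_nth h n * z ^ n)" for n
    by (simp add: algebra_simps)
  then have "eval_fps ((fps_X - fps_const c) * h) z
      = (\<Sum>n. fps_nth (fps_X * h) n * z ^ n) - (\<Sum>n. c * (fps_nth h n * z ^ n))"
    unfolding eval_fps_def by (subst suminf_diff[OF sX summable_mult[OF s]]) simp
  then show ?thesis
    unfolding X by (simp add: suminf_mult[OF s] eval_fps_def algebra_simps)
qed

lemma eval_linear_power_mult:
  assumes "tempered h" "cmod z \<le> 1"
  shows "tempered ((fps_X - fps_const c) ^ m * h)"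
    and "eval_fps ((fps_X - fps_const c) ^ m * h) z = (z - c) ^ m * eval_fps h z"
proof -
  have *: "tempered ((fps_X - fps_const c) ^ m * h) \<and>
    eval_fps ((fps_X - fps_const c) ^ m * h) z = (z - c) ^ m * eval_fps h z"
  proof (induction m)
    case (Suc m)
    have "tempered ((fps_X - fps_const c) * g)" if "tempered g" for g
      using tempered_add[OF tempered_X_mult[OF that] tempered_const_mult[OF that, of "- c"]]
      by (simp add: algebra_simps fps_const_neg[symmetric] del: fps_const_neg)
    with Suc eval_linear_mult[of "(fps_X - fps_const c) ^ m * h" z c] show ?case
      using assms by (simp add: mult.assoc)
  qed (use assms in auto)
  then show "tempered ((fps_X - fps_const c) ^ m * h)"
    "eval_fps ((fps_X - fps_const c) ^ m * h) z = (z - c) ^ m * eval_fps h z" by auto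
qed

text \<open>The coefficients of the quotient are the tails of the series at \<open>z\<close>,
  shifted down. Since \<open>z\<close> lies in the closed disc, a tail is at most the sum of the
  remaining moduli, also when \<open>z\<close> is on the circle.\<close>

lemma divide_linear:
  assumes h: "tempered h" and z: "cmod z \<le> 1" and zero: "eval_fps h z = 0"
  shows "\<exists>g. tempered g \<and> h = (fps_X - fps_const z) * g"
proof -
  obtain C K where C: "C > 0" "\<And>n. cmod (fps_nth h n) * \<omega> n \<le> C * (real n + 1) ^ K"
    using temperedE[OF h] by metis
  \<comment> \<open>Replacing \<open>\<omega> j\<close> by \<open>\<omega> m\<close> for
    \<open>m > j\<close> with exponent \<open>K + 2\<close> gains \<open>(m + 1) ^ (K + 2)\<close>:
    it absorbs the tempered growth and makes the tail summable.\<close>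
  obtain D where D: "D \<ge> 1"
    "\<And>m n. m \<le> n \<Longrightarrow> \<omega> m * (real n + 1) ^ (K + 2) \<le> D * \<omega> n * (real m + 1) ^ (K + 2)"
    using quasi_mono[of "K + 2"] by blast
  define g where "g = Abs_fps (\<lambda>j. \<Sum>n. fps_nth h (n + Suc j) * z ^ n)"
  have sh: "summable (\<lambda>n. cmod (fps_nth h (n + j)))" for j
    using tempered_summable[OF h, of 0] by (subst summable_iff_shift) simp
  have sz: "summable (\<lambda>n. cmod (fps_nth h (n + j) * z ^ n))" for j
    using sh[of j]
    by (rule summable_comparison_test[rotated])
      (use z in \<open>auto simp: norm_mult norm_power intro!: mult_left_le power_le_one exI[of _ 0]\<close>)
  have rec: "(\<Sum>n. fps_nth h (n + j) * z ^ n) = fps_nth h j + z * fps_nth g j" for j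
  proof -
    have "(\<Sum>n. fps_nth h (n + j) * z ^ n)
        = fps_nth h j + (\<Sum>n. fps_nth h (Suc n + j) * z ^ Suc n)"
      using suminf_split_head[OF summable_norm_cancel[OF sz[of j]]] by simp
    also have "(\<Sum>n. fps_nth h (Suc n + j) * z ^ Suc n) = (\<Sum>n. z * (fps_nth h (n + Suc j) * z ^ n))"
      by (simp add: mult_ac)
    also have "\<dots> = z * fps_nth g j"
      unfolding g_def fps_nth_Abs_fps by (rule suminf_mult[OF summable_norm_cancel[OF sz]])
    finally show ?thesis .
  qed
  have "h = (fps_X - fps_const z) * g"
  proof (rule fps_ext)
    fix j
    show "fps_nth h j = fps_nth ((fps_X - fps_const z) * g) j"
    proof (cases j)
      case 0
      then show ?thesis
        using rec[of 0] zero by (simp add: eval_fps_def algebra_simps add_eq_0_iff)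
    next
      case (Suc i)
      then show ?thesis
        using rec[of j] by (simp add: algebra_simps g_def)
    qed
  qed
  moreover have "tempered g"
  proof (rule temperedI)
    fix j
    let ?E = "C * D * (real j + 1) ^ (K + 2)"
    have le: "cmod (fps_nth h (n + Suc j)) * \<omega> j \<le> ?E * (1 / (real n + 1)\<^sup>2)" for n
    proof -
      define m where "m = n + Suc j"
      have "(cmod (fps_nth h m) * \<omega> j) * (real m + 1) ^ (K + 2)
          = cmod (fps_nth h m) * (\<omega> j * (real m + 1) ^ (K + 2))" by simp
      also have "\<dots> \<le> cmod (fps_nth h m) * (D * \<omega> m * (real j + 1) ^ (K + 2))"
        by (intro mult_left_mono D) (auto simp: m_def)
      also have "\<dots> = D * (real j + 1) ^ (K + 2) * (cmod (fps_nth h m) * \<omega> m)" by simp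
      also have "\<dots> \<le> D * (real j + 1) ^ (K + 2) * (C * (real m + 1) ^ K)"
        using D(1) by (intro mult_left_mono C) auto
      finally have "(real m + 1) ^ K * (cmod (fps_nth h m) * \<omega> j * (real m + 1)\<^sup>2) \<le> (real m + 1) ^ K * ?E"
        by (simp add: power_add power2_eq_square mult_ac)
      then have "cmod (fps_nth h m) * \<omega> j * (real m + 1)\<^sup>2 \<le> ?E"
        by (rule mult_left_le_imp_le) simp
      then have "cmod (fps_nth h m) * \<omega> j \<le> ?E * (1 / (real m + 1)\<^sup>2)"
        by (simp add: field_simps)
      also have "\<dots> \<le> ?E * (1 / (real n + 1)\<^sup>2)"
        using C(1) D(1) by (intro mult_left_mono divide_left_mono power_mono) (auto simp: m_def)
      finally show ?thesis by (simp add: m_def)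
    qed
    have "cmod (fps_nth g j) \<le> (\<Sum>n. cmod (fps_nth h (n + Suc j) * z ^ n))"
      unfolding g_def fps_nth_Abs_fps by (rule summable_norm[OF sz])
    also have "\<dots> \<le> (\<Sum>n. cmod (fps_nth h (n + Suc j)))"
      by (intro suminf_le sz sh)
        (use z in \<open>auto simp: norm_mult norm_power intro!: mult_left_le power_le_one\<close>)
    finally have "cmod (fps_nth g j) * \<omega> j \<le> (\<Sum>n. cmod (fps_nth h (n + Suc j))) * \<omega> j"
      by (intro mult_right_mono) auto
    also have "\<dots> = (\<Sum>n. cmod (fps_nth h (n + Suc j)) * \<omega> j)"
      by (rule suminf_mult2[OF sh])
    also have "\<dots> \<le> (\<Sum>n. ?E * (1 / (real n + 1)\<^sup>2))"
      by (intro suminf_le le summable_mult2 sh summable_mult summable_inverse_squares)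
    also have "\<dots> = ?E * (\<Sum>n. 1 / (real n + 1)\<^sup>2)"
      by (rule suminf_mult[OF summable_inverse_squares])
    finally show "cmod (fps_nth g j) * \<omega> j
        \<le> (C * D * (\<Sum>n. 1 / (real n + 1)\<^sup>2)) * (real j + 1) ^ (K + 2)"
      by (simp add: mult_ac)
  qed
  ultimately show ?thesis by blast
qed

end

section \<open>Uniqueness in a half-plane\<close>

text \<open>The decay at infinity replaces a Phragmen-Lindelof argument: on a large arc the function
  is at most \<open>B / R\<close>, so the maximum principle on half discs suffices.\<close>

lemma halfplane_maximum_modulus:
  fixes H :: "complex \<Rightarrow> complex"
  assumes holo: "H holomorphic_on {v. Re v > 0}"
    and cont: "continuous_on {v. Re v \<ge> 0} H"
    and decay: "\<And>v. Re v \<ge> 0 \<Longrightarrow> cmod (H v) * cmod v \<le> B"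
    and bound: "\<And>v. Re v = 0 \<Longrightarrow> cmod (H v) \<le> C" and "C > 0"
    and v: "Re v \<ge> 0"
  shows "cmod (H v) \<le> C"
proof -
  define R where "R = max (B / C) (cmod v + 1)"
  have R: "R \<ge> B / C" "R > cmod v" by (auto simp: R_def max_def)
  then have "R > 0" using norm_ge_zero[of v] by linarith
  note R = this R
  define S where "S = {u. Re u > 0} \<inter> ball 0 R"
  have opS: "open S" unfolding S_def by (intro open_Int open_halfspace_Re_gt) auto
  have "closure S \<subseteq> {u. Re u \<ge> 0} \<inter> cball 0 R"
    by (rule closure_minimal) (auto simp: S_def intro!: closed_Int closed_halfspace_Re_ge)
  then have clS: "Re u \<ge> 0" "cmod u \<le> R" if "u \<in> closure S" for u
    using that by auto
  show ?thesis
  proof (cases "Re v = 0")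
    case False
    show ?thesis
    proof (rule maximum_modulus_frontier[of H S])
      show "H holomorphic_on interior S"
        by (rule holomorphic_on_subset[OF holo]) (simp only: interior_open[OF opS], auto simp: S_def)
      show "continuous_on (closure S) H"
        by (rule continuous_on_subset[OF cont]) (use clS in auto)
      show "bounded S"
        unfolding S_def by (rule bounded_subset[OF bounded_ball[of 0 R]]) auto
      show "v \<in> S" using v R False by (auto simp: S_def)
      fix u assume "u \<in> frontier S"
      then have u: "Re u \<ge> 0" "cmod u \<le> R" "Re u = 0 \<or> cmod u = R"
        using clS[of u] unfolding frontier_def interior_open[OF opS] by (auto simp: S_def)
      show "cmod (H u) \<le> C"
      proof (cases "Re u = 0")
        case False
        have "cmod (H u) * R \<le> B" using decay[OF u(1)] u False by auto
        also have "B \<le> C * R" using R \<open>C > 0\<close> by (simp add: field_simps)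
        finally show ?thesis using R by simp
      qed (use bound in auto)
    qed
  qed (use bound in auto)
qed

text \<open>On the imaginary axis \<open>s v / (v + \<surd>s)\<close> has real part \<open>s y\<^sup>2 / (y\<^sup>2 + s) \<le> min y\<^sup>2 s\<close>, while at
  a fixed positive point it is comparable to \<open>\<surd>s\<close>.\<close>

lemma halfplane_uniqueness:
  fixes F :: "complex \<Rightarrow> complex" and \<mu> :: "nat \<Rightarrow> real"
  assumes holo: "F holomorphic_on {v. Re v > 0}"
    and cont: "continuous_on {v. Re v \<ge> 0} F"
    and decay: "\<And>v. Re v \<ge> 0 \<Longrightarrow> cmod (F v) * cmod v \<le> B"
    and \<mu>: "\<And>j. \<mu> j \<ge> 0"
    and bound: "\<And>y J. cmod (F (Complex 0 y)) \<le> C * exp (- (\<Sum>j=1..J. \<mu> j * min (y\<^sup>2) (real j)))"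
    and diverge: "\<And>S. \<exists>J. (\<Sum>j=1..J. \<mu> j * sqrt (real j)) > S"
    and "x > 0"
  shows "F (of_real x) = 0"
proof -
  have B: "B \<ge> 0" using decay[of 0] by simp
  \<comment> \<open>\<open>C\<close> may be 0, while the maximum principle above asks for a positive
    bound.\<close>
  define C' where "C' = max C 1"
  have C': "C' > 0" "C \<le> C'" by (auto simp: C'_def)
  have key: "cmod (F (of_real x)) * exp (x / (x + 1) * (\<Sum>j=1..J. \<mu> j * sqrt (real j))) \<le> C'" for J
  proof -
    define G where "G v = (\<Sum>j=1..J. of_real (\<mu> j * real j) * (v / (v + of_real (sqrt (real j)))))" for v :: complex
    have nz: "v + of_real (sqrt (real j)) \<noteq> 0" if "Re v \<ge> 0" "j \<ge> 1" for v j
    proof -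
      have "Re (v + of_real (sqrt (real j))) > 0" using that by (simp add: add_nonneg_pos)
      then show ?thesis by force
    qed
    have norm_le: "cmod (v / (v + of_real (sqrt (real j)))) \<le> 1" if "Re v \<ge> 0" "j \<ge> 1" for v j
    proof -
      have "cmod v \<le> cmod (v + of_real (sqrt (real j)))"
        using that by (simp add: cmod_def power_mono)
      then show ?thesis using nz[OF that] by (simp add: norm_divide)
    qed
    \<comment> \<open>This bound grows with \<open>J\<close>, but it enters only the decay constant;
      the resulting estimate by \<open>C'\<close> is uniform in \<open>J\<close>.\<close>
    define \<Gamma> where "\<Gamma> = (\<Sum>j=1..J. \<mu> j * real j)"
    have G\<Gamma>: "cmod (G v) \<le> \<Gamma>" if "Re v \<ge> 0" for v
      unfolding G_def \<Gamma>_def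
    proof (rule sum_norm_le)
      fix j assume "j \<in> {1..J}"
      then have "cmod (v / (v + of_real (sqrt (real j)))) \<le> 1" using norm_le[OF that] by auto
      then have "(\<mu> j * real j) * cmod (v / (v + of_real (sqrt (real j)))) \<le> (\<mu> j * real j) * 1"
        by (rule mult_left_mono) (use \<mu> in auto)
      then show "cmod (of_real (\<mu> j * real j) * (v / (v + of_real (sqrt (real j))))) \<le> \<mu> j * real j"
        unfolding norm_mult[of "of_real _"] norm_of_real using \<mu>[of j] by (simp add: abs_mult)
    qed
    have "G holomorphic_on {v. Re v \<ge> 0}"
      unfolding G_def by (intro holomorphic_intros) (use nz in auto)
    then have G: "G holomorphic_on {v. Re v > 0}" "continuous_on {v. Re v \<ge> 0} G"
      by (auto intro: holomorphic_on_subset holomorphic_on_imp_continuous_on)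
    have ReG: "Re (G (Complex 0 y)) \<le> (\<Sum>j=1..J. \<mu> j * min (y\<^sup>2) (real j))" for y
      unfolding G_def Re_sum
    proof (rule sum_mono)
      fix j assume "j \<in> {1..J}"
      then have j: "real j > 0" by simp
      have "Re (Complex 0 y / (Complex 0 y + of_real (sqrt (real j)))) = y\<^sup>2 / (y\<^sup>2 + real j)"
        using j by (simp add: Re_divide power2_eq_square add.commute)
      then have "Re (of_real (\<mu> j * real j) * (Complex 0 y / (Complex 0 y + of_real (sqrt (real j)))))
          = \<mu> j * (real j * y\<^sup>2 / (y\<^sup>2 + real j))"
        by (simp only: Re_complex_of_real Im_complex_of_real times_complex.simps) simp
      also have "\<dots> \<le> \<mu> j * min (y\<^sup>2) (real j)"
      proof (rule mult_left_mono[OF _ \<mu>])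
        have "real j * y\<^sup>2 / (y\<^sup>2 + real j) \<le> y\<^sup>2"
          using j by (simp add: pos_divide_le_eq add_nonneg_pos add_pos_nonneg algebra_simps)
        moreover have "real j * y\<^sup>2 / (y\<^sup>2 + real j) \<le> real j"
          using j by (simp add: pos_divide_le_eq add_nonneg_pos add_pos_nonneg algebra_simps)
        ultimately show "real j * y\<^sup>2 / (y\<^sup>2 + real j) \<le> min (y\<^sup>2) (real j)" by simp
      qed
      finally show "Re (of_real (\<mu> j * real j) * (Complex 0 y / (Complex 0 y + of_real (sqrt (real j)))))
          \<le> \<mu> j * min (y\<^sup>2) (real j)" .
    qed
    have "cmod (F (of_real x) * exp (G (of_real x))) \<le> C'"
    proof (rule halfplane_maximum_modulus[where H = "\<lambda>v. F v * exp (G v)" and B = "B * exp \<Gamma>"])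
      show "(\<lambda>v. F v * exp (G v)) holomorphic_on {v. Re v > 0}"
        by (intro holomorphic_intros holo G)
      show "continuous_on {v. Re v \<ge> 0} (\<lambda>v. F v * exp (G v))"
        by (intro continuous_intros cont G)
      show "cmod (F v * exp (G v)) * cmod v \<le> B * exp \<Gamma>" if "Re v \<ge> 0" for v
      proof -
        have "Re (G v) \<le> \<Gamma>" using G\<Gamma>[OF that] complex_Re_le_cmod[of "G v"] by linarith
        then have "(cmod (F v) * cmod v) * exp (Re (G v)) \<le> B * exp \<Gamma>"
          by (intro mult_mono decay[OF that]) (use B in auto)
        then show ?thesis by (simp add: norm_mult mult_ac)
      qed
      show "cmod (F v * exp (G v)) \<le> C'" if "Re v = 0" for v
      proof -
        define y where "y = Im v"
        have y: "v = Complex 0 y" using that by (simp add: complex_eq_iff y_def)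
        have "cmod (F v * exp (G v)) = cmod (F v) * exp (Re (G v))" by (simp add: norm_mult)
        also have "\<dots> \<le> (C * exp (- (\<Sum>j=1..J. \<mu> j * min (y\<^sup>2) (real j))))
            * exp (\<Sum>j=1..J. \<mu> j * min (y\<^sup>2) (real j))"
          unfolding y using ReG[of y] by (intro mult_mono bound order_trans[OF norm_ge_zero bound]) auto
        also have "\<dots> = C" by (simp add: exp_minus)
        finally show ?thesis using C' by linarith
      qed
    qed (use C' \<open>x > 0\<close> in auto)
    moreover have "x / (x + 1) * (\<Sum>j=1..J. \<mu> j * sqrt (real j)) \<le> Re (G (of_real x))"
      unfolding G_def Re_sum sum_distrib_left
    proof (rule sum_mono)
      fix j assume "j \<in> {1..J}"
      then have j: "real j \<ge> 1" by simp
      define s where "s = sqrt (real j)"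
      have s: "s \<ge> 1" "real j = s * s" using j by (auto simp: s_def)
      \<comment> \<open>Equivalent to \<open>x + s \<le> s * (x + 1)\<close>, true because
        \<open>s \<ge> 1\<close>.\<close>
      have "x / (x + 1) * s \<le> s * s * (x / (x + s))"
        using s(1) \<open>x > 0\<close> by (simp add: field_simps)
      then have "\<mu> j * (x / (x + 1) * s) \<le> \<mu> j * (s * s * (x / (x + s)))"
        by (rule mult_left_mono[OF _ \<mu>])
      also have "\<dots> = Re (of_real (\<mu> j * real j) * (of_real x / (of_real x + of_real (sqrt (real j)))))"
        unfolding s_def[symmetric] s(2) using s(1) by (simp flip: of_real_add of_real_divide of_real_mult)
      finally show "x / (x + 1) * (\<mu> j * sqrt (real j))
          \<le> Re (of_real (\<mu> j * real j) * (of_real x / (of_real x + of_real (sqrt (real j)))))"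
        by (simp add: s_def mult_ac)
    qed
    then have "cmod (F (of_real x)) * exp (x / (x + 1) * (\<Sum>j=1..J. \<mu> j * sqrt (real j)))
        \<le> cmod (F (of_real x)) * exp (Re (G (of_real x)))"
      by (intro mult_left_mono) auto
    ultimately show ?thesis by (simp add: norm_mult)
  qed
  show ?thesis
  proof (rule ccontr)
    assume "F (of_real x) \<noteq> 0"
    then have f: "cmod (F (of_real x)) > 0" by simp
    define q where "q = C' / cmod (F (of_real x))"
    have q: "q > 0" using f C' by (simp add: q_def)
    obtain J where "(\<Sum>j=1..J. \<mu> j * sqrt (real j)) > ln q * ((x + 1) / x)"
      using diverge by blast
    then have "ln q < x / (x + 1) * (\<Sum>j=1..J. \<mu> j * sqrt (real j))"
      using \<open>x > 0\<close> by (simp add: field_simps)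
    then have "q < exp (x / (x + 1) * (\<Sum>j=1..J. \<mu> j * sqrt (real j)))"
      using q by (metis exp_less_cancel_iff exp_ln)
    also have "\<dots> \<le> q" using key[of J] f by (simp add: q_def field_simps)
    finally show False by simp
  qed
qed

section \<open>Consequences of log-convexity and of the divergence condition\<close>

locale quasianalytic_weight = rapid_weight +
  assumes convex: "log_convex \<omega>"
    and diverges: "filterlim (\<lambda>N. \<Sum>n<N. ln (\<omega> n) / (real n powr (3 / 2) + 1)) at_top sequentially"

text \<open>A telescoping majorant for the weights of the divergent series. With
  \<open>s = sqrt n\<close> and \<open>t = sqrt (n + 1)\<close> one has
  \<open>(t + s) * (t - s) = 1\<close>, so \<open>1 / s - 1 / t = 1 / (s * t * (s + t))\<close>,
  which is comparable to \<open>1 / s ^ 3\<close>; the 4 covers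
  \<open>t \<le> 3 / 2 * s\<close>.\<close>

lemma inverse_power_three_halves_le:
  assumes "n \<ge> 1"
  shows "1 / (real n powr (3 / 2) + 1) \<le> 4 / sqrt (real n) - 4 / sqrt (real n + 1)"
proof -
  define s t where "s = sqrt (real n)" and "t = sqrt (real n + 1)"
  have s: "s \<ge> 1" "s * s = real n" and t: "t > 0" "t * t = s * s + 1"
    using assms by (auto simp: s_def t_def)
  have "real n powr (3 / 2) = s ^ 3"
  proof -
    have "real n powr (3 / 2) = (real n powr (1 / 2)) powr 3" by (simp add: powr_powr)
    then show ?thesis using s(1) assms by (simp add: powr_half_sqrt s_def)
  qed
  moreover have "1 / (s ^ 3 + 1) \<le> 4 / s - 4 / t"
  proof -
    have ts: "t \<le> 3 / 2 * s"
    proof (rule power2_le_imp_le)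
      have "1 \<le> s * s" using s(1) mult_mono[of 1 s 1 s] by simp
      then show "t\<^sup>2 \<le> (3 / 2 * s)\<^sup>2" using t(2) by (simp add: power2_eq_square)
    qed (use s in auto)
    have "s * t * (t + s) \<le> s * (3 / 2 * s) * (3 / 2 * s + s)"
      using ts s t by (intro mult_mono add_mono) auto
    also have "\<dots> \<le> 4 * (s ^ 3 + 1)" using s(1) by (simp add: power3_eq_cube)
    finally have "s * t * (t + s) * (t - s) \<le> 4 * (s ^ 3 + 1) * (t - s)"
      using s t by (intro mult_right_mono) (auto simp: s_def t_def)
    moreover have "(t + s) * (t - s) = 1" using t(2) by (simp add: algebra_simps)
    ultimately have le: "s * t \<le> 4 * (s ^ 3 + 1) * (t - s)" by (simp add: mult.assoc)
    have "s ^ 3 + 1 > 0" using s(1) by (simp add: add_pos_pos)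
    then have "s * t / (s ^ 3 + 1) \<le> 4 * (t - s)"
      using le by (simp only: pos_divide_le_eq) (simp only: mult_ac)
    then have "s * t / (s ^ 3 + 1) / (s * t) \<le> 4 * (t - s) / (s * t)"
      using s(1) t(1) by (intro divide_right_mono) auto
    moreover have "4 * (t - s) / (s * t) = 4 / s - 4 / t" using s(1) t(1) by (simp add: field_simps)
    ultimately show ?thesis using s(1) t(1) by simp
  qed
  ultimately show ?thesis by (simp add: s_def t_def)
qed

context quasianalytic_weight
begin

text \<open>\<open>\<mu>\<close> is minus the second difference of \<open>log \<omega>\<close>, so that up to a constant \<open>log \<omega>\<close> dominates a
  superposition of the functions \<open>n \<mapsto> min n j\<close>; two summations by parts turn the divergence
  of \<open>\<Sum> log \<omega>(n) / n\<^bsup>3/2\<^esup>\<close> into that of \<open>\<Sum> \<mu>\<^sub>j \<surd>j\<close>.\<close>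

lemma concave_decomposition:
  obtains \<mu> c where "\<And>j. \<mu> j \<ge> 0"
    and "\<And>J n. (\<Sum>j=1..J. \<mu> j * min (real n) (real j)) \<le> ln (\<omega> n) + c"
    and "\<And>S. \<exists>J. (\<Sum>j=1..J. \<mu> j * sqrt (real j)) > S"
proof -
  define p where "p n = ln (\<omega> n)" for n
  have p0: "p n \<ge> 0" for n using ge1[of n] by (simp add: p_def)
  have lwp: "lw 0 n = p n" for n by (simp add: lw_def p_def)
  obtain N0 where N0: "\<forall>n\<ge>N0. lw 0 (n + 2) - lw 0 (n + 1) \<le> lw 0 (n + 1) - lw 0 n"
    using lw_concave by blast
  \<comment> \<open>At least 1, so that the square roots divided by below are positive.\<close>
  define N where "N = max 1 N0"
  define d where "d n = p (n + 1) - p n" for n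
  have N: "N \<ge> 1" by (simp add: N_def)
  have d_anti: "d n \<le> d m" if "N \<le> m" "m \<le> n" for m n
    using lw_slope_antimono[OF N0, of m n] that by (simp add: d_def lwp N_def)
  have d0: "d n \<ge> 0" if "N \<le> n" for n
    using lw_mono[OF N0, of n] that by (simp add: d_def lwp N_def)
  \<comment> \<open>Second differences up to \<open>N\<close> may have the wrong sign and are
    dropped; the constant \<open>D\<close> pays for this.\<close>
  define \<mu> where "\<mu> j = (if j \<le> N then 0 else d (j - 1) - d j)" for j
  have \<mu>0: "\<mu> j \<ge> 0" for j using d_anti[of "j - 1" j] by (auto simp: \<mu>_def)
  have tel: "(\<Sum>j\<in>{m<..J}. \<mu> j) = d m - d J" if "N \<le> m" "m \<le> J" for m J
    using that(2)
  proof (induction J rule: dec_induct)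
    case (step J)
    have "{m<..Suc J} = insert (Suc J) {m<..J}" using step.hyps by auto
    then show ?case using step that by (simp add: \<mu>_def)
  qed simp
  have tail: "(\<Sum>j\<in>{m<..J}. \<mu> j) \<le> d m" if "N \<le> m" for m J
    using tel[OF that, of J] d0[of J] d0[OF that] that by (cases "m \<le> J") auto

  define D where "D = real N * d N"
  have upper: "(\<Sum>j=1..J. \<mu> j * min (real n) (real j)) \<le> p n + D" for J n
  proof -
    \<comment> \<open>The increment of \<open>g\<close> at \<open>n\<close> is the tail of \<mu>
      beyond \<open>n\<close>: at most \<open>d n\<close> for \<open>n \<ge> N\<close>, and at most
      \<open>d N\<close> before, which gives \<open>D\<close>.\<close>
    define g where "g n = (\<Sum>j=1..J. \<mu> j * min (real n) (real j))" for n
    have "g (Suc n) - g n = (\<Sum>j=1..J. if n < j then \<mu> j else 0)" for n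
      unfolding g_def sum_subtractf[symmetric] by (rule sum.cong) (auto simp: min_def algebra_simps)
    also have "\<dots> n = (\<Sum>j\<in>{n<..J}. \<mu> j)" for n
      by (rule sum.mono_neutral_cong_right) auto
    finally have gstep: "g (Suc n) - g n = (\<Sum>j\<in>{n<..J}. \<mu> j)" for n .
    have small: "g n \<le> real n * d N" if "n \<le> N" for n
      using that
    proof (induction n)
      case (Suc n)
      have "(\<Sum>j\<in>{n<..J}. \<mu> j) = (\<Sum>j\<in>{N<..J}. \<mu> j)"
        by (rule sum.mono_neutral_right) (use Suc.prems in \<open>auto simp: \<mu>_def\<close>)
      then have "g (Suc n) - g n \<le> d N" using gstep[of n] tail[of N J] by simp
      then show ?case using Suc by (simp add: algebra_simps)
    qed (simp add: g_def)
    have large: "g n \<le> D + p n - p N" if "N \<le> n" for n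
      using that
    proof (induction n rule: dec_induct)
      case base
      then show ?case using small[of N] by (simp add: D_def)
    next
      case (step n)
      then show ?case using gstep[of n] tail[of n J] by (simp add: d_def)
    qed
    have "g n \<le> p n + D"
    proof (cases "N \<le> n")
      case True
      then show ?thesis using large[of n] p0[of N] by simp
    next
      case False
      then have "g n \<le> real n * d N" using small by simp
      also have "\<dots> \<le> D" unfolding D_def using False d0[of N] by (intro mult_right_mono) auto
      finally show ?thesis using p0[of n] by simp
    qed
    then show ?thesis by (simp add: g_def)
  qed

  \<comment> \<open>Slopes above \<open>e\<close> would force growth at exponential rate
    \<open>e\<close>, against \<open>subexponential\<close> at rate \<open>e / 2\<close>.\<close>
  have small_slope: "\<exists>J\<ge>M. d J \<le> e" if "e > 0" "M \<ge> N" for e M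
  proof (rule ccontr)
    assume "\<not> ?thesis"
    then have big: "d J > e" if "J \<ge> M" for J using that by force
    have lin: "p (M + i) \<ge> e * real i" for i
    proof (induction i)
      case (Suc i)
      then show ?case using big[of "M + i"] by (simp add: d_def algebra_simps)
    qed (simp add: p0)
    obtain C where C: "C > 0" "\<And>n. \<omega> n \<le> C * exp (e / 2) ^ n"
      using subexponential[of "exp (e / 2)"] \<open>e > 0\<close> by auto
    have "e * real i \<le> ln C + e / 2 * real (M + i)" for i
    proof -
      have "p (M + i) \<le> ln (C * exp (e / 2) ^ (M + i))"
        unfolding p_def using C by (subst ln_le_cancel_iff) auto
      also have "\<dots> = ln C + e / 2 * real (M + i)"
        using C(1) by (simp add: ln_mult ln_realpow)
      finally show ?thesis using lin[of i] by linarith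
    qed
    moreover have "eventually (\<lambda>i::nat. e * real i > ln C + e / 2 * (real M + real i)) sequentially"
      using \<open>e > 0\<close> by real_asymp
    ultimately show False
      by (auto dest!: eventually_happens simp: not_less[symmetric])
  qed

  have diverge: "\<exists>J. (\<Sum>j=1..J. \<mu> j * sqrt (real j)) > S" for S
  proof (rule ccontr)
    assume "\<not> ?thesis"
    then have S: "(\<Sum>j=1..J. \<mu> j * sqrt (real j)) \<le> S" for J by (meson not_less)
    have S_sub: "(\<Sum>j\<in>{M<..J}. \<mu> j * sqrt (real j)) \<le> S" for M J
      by (rule order_trans[OF sum_mono2 S[of J]]) (auto intro!: mult_nonneg_nonneg \<mu>0)
    \<comment> \<open>Since arbitrarily small slopes occur later, \<open>d M\<close> is the whole
      tail of \<mu>, on which \<open>sqrt M \<le> sqrt j\<close>.\<close>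
    have dM: "d M * sqrt (real M) \<le> S" if MN: "M \<ge> N" for M
    proof (rule field_le_epsilon)
      fix e :: real assume "e > 0"
      obtain J where J: "J \<ge> M" "d J \<le> e / sqrt (real M)"
        using small_slope[of "e / sqrt (real M)" M] \<open>e > 0\<close> MN N by auto
      have "(d M - d J) * sqrt (real M) = (\<Sum>j\<in>{M<..J}. \<mu> j * sqrt (real M))"
        using tel[OF MN J(1)] by (simp flip: sum_distrib_right)
      also have "\<dots> \<le> (\<Sum>j\<in>{M<..J}. \<mu> j * sqrt (real j))"
        by (intro sum_mono mult_left_mono \<mu>0) auto
      also have "\<dots> \<le> S" by (rule S_sub)
      finally show "d M * sqrt (real M) \<le> S + e"
        using J(2) N MN by (simp add: field_simps)
    qed
    \<comment> \<open>Differences of \<open>A\<close> majorize the weights of the series, and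
      \<open>A\<close> is in turn majorized by differences of \<open>B\<close>: one function for
      each summation by parts.\<close>
    define A where "A n = 4 / sqrt (real n)" for n
    define B where "B n = 8 * sqrt (real n)" for n
    have cA: "1 / (real n powr (3 / 2) + 1) \<le> A n - A (Suc n)" if "n \<ge> 1" for n
      using inverse_power_three_halves_le[OF that] by (simp add: A_def add.commute)
    have AB: "A (Suc n) \<le> B (Suc n) - B n" for n
    proof -
      define s t where "s = sqrt (real n)" and "t = sqrt (real (Suc n))"
      have st: "s \<ge> 0" "t > 0" "t * t = s * s + 1" "s \<le> t" by (auto simp: s_def t_def)
      have "1 = (t - s) * (t + s)" using st by (simp add: algebra_simps)
      also have "\<dots> \<le> (t - s) * (2 * t)" using st by (intro mult_left_mono) auto
      finally show ?thesis
        unfolding A_def B_def s_def[symmetric] t_def[symmetric] using st by (simp add: field_simps)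
    qed
    let ?c = "\<lambda>n. ln (\<omega> n) / (real n powr (3 / 2) + 1)"
    \<comment> \<open>Both summations by parts run in one induction; the terms with
      \<open>A M\<close> and \<open>B M\<close> are the boundary terms.\<close>
    have abel: "(\<Sum>n=N..<M. ?c n) + p M * A M
        \<le> p N * A N + d M * B M - d N * B N + (\<Sum>j\<in>{N<..M}. \<mu> j * B j)" if "M \<ge> N" for M
      using that
    proof (induction M rule: dec_induct)
      case (step M)
      have "?c M + p M * A (Suc M) - p M * A M \<le> 0"
        using mult_left_mono[OF cA[of M] p0[of M]] step.hyps N by (simp add: p_def algebra_simps)
      then have "?c M + p (Suc M) * A (Suc M) - p M * A M \<le> d M * A (Suc M)"
        by (simp add: d_def algebra_simps)
      also have "\<dots> \<le> d M * (B (Suc M) - B M)"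
        by (intro mult_left_mono AB d0) (use step in auto)
      also have "\<dots> = d (Suc M) * B (Suc M) - d M * B M + \<mu> (Suc M) * B (Suc M)"
        using step.hyps by (simp add: \<mu>_def algebra_simps)
      finally have "?c M + p (Suc M) * A (Suc M) - p M * A M
          \<le> d (Suc M) * B (Suc M) - d M * B M + \<mu> (Suc M) * B (Suc M)" .
      moreover have "{N<..Suc M} = insert (Suc M) {N<..M}" using step.hyps by auto
      then have "(\<Sum>j\<in>{N<..Suc M}. \<mu> j * B j) = \<mu> (Suc M) * B (Suc M) + (\<Sum>j\<in>{N<..M}. \<mu> j * B j)"
        by simp
      moreover have "(\<Sum>n=N..<Suc M. ?c n) = (\<Sum>n=N..<M. ?c n) + ?c M"
        using step.hyps by simp
      ultimately show ?case using step.IH by linarith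
    qed simp
    have bounded: "(\<Sum>n<M. ?c n) \<le> (\<Sum>n<N. ?c n) + p N * A N + 16 * S" if "M \<ge> N" for M
    proof -
      have "(\<Sum>n<M. ?c n) = (\<Sum>n<N. ?c n) + (\<Sum>n=N..<M. ?c n)"
        using that by (simp add: lessThan_atLeast0 sum.atLeastLessThan_concat)
      moreover have "p M * A M \<ge> 0" using p0[of M] by (simp add: A_def)
      moreover have "d M * B M \<le> 8 * S" using dM[OF that] by (simp add: B_def)
      moreover have "(\<Sum>j\<in>{N<..M}. \<mu> j * B j) \<le> 8 * S"
      proof -
        have "(\<Sum>j\<in>{N<..M}. \<mu> j * B j) = 8 * (\<Sum>j\<in>{N<..M}. \<mu> j * sqrt (real j))"
          unfolding sum_distrib_left by (rule sum.cong) (auto simp: B_def)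
        then show ?thesis using S_sub[of N M] by simp
      qed
      moreover have "d N * B N \<ge> 0" using d0[of N] by (simp add: B_def)
      ultimately show ?thesis using abel[OF that] by linarith
    qed
    have "eventually (\<lambda>M. (\<Sum>n<M. ?c n) > (\<Sum>n<N. ?c n) + p N * A N + 16 * S \<and> M \<ge> N) sequentially"
      using filterlim_at_top_dense[THEN iffD1, OF diverges] eventually_ge_at_top
      by (intro eventually_conj) auto
    then show False using bounded by (auto dest!: eventually_happens simp: not_le[symmetric])
  qed
  show thesis
    using that[of \<mu> D] \<mu>0 upper diverge by (simp add: p_def)
qed

text \<open>The exponent is read off the chord of \<open>t \<mapsto> log \<omega>(e\<^sup>t)\<close> between \<open>log n\<close> and
  \<open>log (n + 1)\<close>: outside this interval a convex function lies above the chord's line.\<close>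

lemma power_ratio_le:
  obtains C N where "C > 0" "N \<ge> 1" and "\<And>n. n \<ge> N \<Longrightarrow> \<exists>k. \<forall>m.
    (real m / real n) ^ k * (real m + 1) ^ L * \<omega> n \<le> C * \<omega> m * (real n + 1) ^ (L + 1)"
proof -
  obtain w T where w: "\<And>n. w (real n) = \<omega> n" and T: "convex_on {T..} (\<lambda>t. ln (w (exp t)))"
    using convex unfolding log_convex_def by blast
  define f where "f t = ln (w (exp t))" for t :: real
  have f: "f (ln (real n)) = ln (\<omega> n)" if "n \<ge> 1" for n using that by (simp add: f_def w)
  define m0 where "m0 = nat \<lceil>exp T\<rceil> + 1"
  have m0: "m0 \<ge> 1" "ln (real m) \<ge> T" if "m \<ge> m0" for m
  proof -
    have "exp T \<le> real m" using that real_nat_ceiling_ge[of "exp T"] unfolding m0_def by linarith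
    then show "ln (real m) \<ge> T"
      using order_less_le_trans[OF exp_gt_zero] by (metis exp_le_cancel_iff exp_ln)
  qed (simp add: m0_def)
  \<comment> \<open>The double exponent makes the chord slope at least \<open>L\<close>, because
    \<open>log ((n + 2) / (n + 1))\<close> is at least half of
    \<open>log ((n + 1) / n)\<close>.\<close>
  obtain N1 where N1: "\<forall>n\<ge>N1. lw (2 * L) (n + 2) - lw (2 * L) (n + 1) \<le> lw (2 * L) (n + 1) - lw (2 * L) n"
    using lw_concave by blast
  define N where "N = max m0 N1"
  \<comment> \<open>\<open>2 ^ L\<close> comes from \<open>m + 1 \<le> 2 * m\<close>; the remaining
    factor serves the indices below \<open>m0\<close>.\<close>
  define C where "C = 2 ^ L * (real m0 + 1) ^ L * \<omega> m0"
  have C1: "C \<ge> 2 ^ L" "C \<ge> (real m0 + 1) ^ L * \<omega> m0" "C > 0"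
  proof -
    have a: "1 \<le> (real m0 + 1) ^ L * \<omega> m0"
      using mult_mono[of 1 "(real m0 + 1) ^ L" 1 "\<omega> m0"] ge1[of m0] by simp
    have b: "(1::real) \<le> 2 ^ L" by simp
    have C: "C = 2 ^ L * ((real m0 + 1) ^ L * \<omega> m0)" by (simp add: C_def)
    show "C \<ge> 2 ^ L" unfolding C using mult_left_mono[OF a, of "2 ^ L"] by simp
    show "C \<ge> (real m0 + 1) ^ L * \<omega> m0" unfolding C using mult_right_mono[OF b, of "(real m0 + 1) ^ L * \<omega> m0"] by simp
    then show "C > 0" using a by linarith
  qed
  have "\<exists>k. \<forall>m. (real m / real n) ^ k * (real m + 1) ^ L * \<omega> n \<le> C * \<omega> m * (real n + 1) ^ (L + 1)"
    if "n \<ge> N" for n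
  proof -
    have n: "n \<ge> m0" "n \<ge> N1" "n \<ge> 1" using that m0(1)[of m0] by (auto simp: N_def)
    define x y where "x = ln (real n)" and "y = ln (real (n + 1))"
    have xy: "x < y" "x \<ge> T" "y \<ge> T" using n m0(2)[of n] m0(2)[of "n + 1"] by (auto simp: x_def y_def)
    define \<kappa> where "\<kappa> = (f x - f y) / (x - y)"
    have \<kappa>: "real L \<le> \<kappa>"
    proof -
      have "real L * (y - x) \<le> f y - f x"
      proof -
        have "y - x \<le> 2 * (ln (real n + 2) - ln (real n + 1))"
        proof -
          \<comment> \<open>The exponential form of the comparison of the two logarithmic steps,
            with denominators cleared.\<close>
          have "real (n + 1) * (real n + 1) * (real n + 1) \<le> real n * (real n + 2) * (real n + 2)"
            using n(3) by (simp add: algebra_simps add_increasing2)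
          then have "ln (real (n + 1) * (real n + 1) * (real n + 1)) \<le> ln (real n * (real n + 2) * (real n + 2))"
            using n(3) by (subst ln_le_cancel_iff) (auto intro!: mult_pos_pos)
          then show ?thesis using n(3) by (simp add: ln_mult x_def y_def add.commute)
        qed
        then have "real L * (y - x) \<le> real (2 * L) * (ln (real n + 2) - ln (real n + 1))"
          using mult_left_mono[of "y - x" "2 * (ln (real n + 2) - ln (real n + 1))" "real L"] by (simp add: algebra_simps)
        also have "\<dots> \<le> ln (\<omega> (n + 1)) - ln (\<omega> n)"
          using lw_mono[OF N1 n(2)] by (simp add: lw_def algebra_simps)
        also have "\<dots> = f y - f x" using f[of n] f[of "n + 1"] n by (simp add: x_def y_def)
        finally show ?thesis .
      qed
      then show ?thesis using xy(1) by (simp add: \<kappa>_def field_simps)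
    qed
    have chord: "(real m / real n) powr \<kappa> * \<omega> n \<le> \<omega> m" if "m \<ge> m0" for m
    proof -
      define z where "z = ln (real m)"
      have m: "m \<ge> 1" "z \<ge> T" using that m0[of m] by (auto simp: z_def)
      have "\<kappa> * (z - x) \<le> f z - f x"
      proof (rule linorder_cases[of z x])
        assume "z < x"
        then have "(f z - f y) / (z - y) \<le> (f x - f y) / (x - y)" "(f z - f x) / (z - x) \<le> (f z - f y) / (z - y)"
          using convex_on_slope_le[OF T[folded f_def], of z y x] xy m(2) by auto
        then have "(f z - f x) / (z - x) \<le> \<kappa>" by (simp add: \<kappa>_def)
        then show ?thesis using \<open>z < x\<close> by (simp add: field_simps)
      next
        assume "x < z"
        then have "n < m" using n(3) m(1) by (simp add: x_def z_def)
        \<comment> \<open>No integer lies strictly between \<open>n\<close> and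
          \<open>n + 1\<close>, so \<open>z\<close> is never inside the interval of the
          chord.\<close>
        then have "n + 1 \<le> m" by simp
        then have "y \<le> z" unfolding y_def z_def by (subst ln_le_cancel_iff) auto
        have "\<kappa> \<le> (f x - f z) / (x - z)"
        proof (cases "y = z")
          case False
          then show ?thesis
            using convex_on_slope_le(1)[OF T[folded f_def], of x z y] xy m(2) \<open>y \<le> z\<close> by (auto simp: \<kappa>_def)
        qed (simp add: \<kappa>_def)
        then show ?thesis using \<open>x < z\<close> by (simp add: field_simps)
      qed simp
      then have "\<kappa> * (z - x) + ln (\<omega> n) \<le> ln (\<omega> m)" using f n m by (simp add: x_def z_def)
      then have "exp (\<kappa> * (z - x)) * \<omega> n \<le> \<omega> m"
        by (metis exp_add exp_le_cancel_iff exp_ln pos)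
      moreover have "(real m / real n) powr \<kappa> = exp (\<kappa> * (z - x))"
        using m n by (simp add: powr_def ln_div x_def z_def)
      ultimately show ?thesis by simp
    qed
    \<comment> \<open>The exponent will count vanishing moments, hence must be a natural number;
      \<kappa> is at least \<open>L\<close>, so nothing is truncated at 0. For \<open>m < n\<close>
      rounding costs at most \<open>n / m\<close>, whence the extra factor
      \<open>n + 1\<close>.\<close>
    define k where "k = nat \<lfloor>\<kappa> - real L\<rfloor>"
    have k: "real k + real L \<le> \<kappa>" "\<kappa> \<le> real k + real L + 1"
    proof -
      have "real k = of_int \<lfloor>\<kappa> - real L\<rfloor>" using \<kappa> by (simp add: k_def)
      then show "real k + real L \<le> \<kappa>" "\<kappa> \<le> real k + real L + 1"
        using of_int_floor_le[of "\<kappa> - real L"] real_of_int_floor_add_one_ge[of "\<kappa> - real L"] by linarith+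
    qed
    have main: "(real m / real n) ^ k * real m ^ L * \<omega> n \<le> \<omega> m * real n ^ L * (real n + 1)" if "m \<ge> m0" for m
    proof -
      have m: "m \<ge> 1" using that m0[of m] by simp
      define q where "q = real m / real n"
      have q: "q > 0" using m n by (simp add: q_def)
      have "q ^ k * q ^ L = q powr (real k + real L)" using q by (simp add: powr_add powr_realpow)
      also have "\<dots> \<le> q powr \<kappa> * (real n + 1)"
      proof (cases "q \<ge> 1")
        case True
        have "q powr (real k + real L) * 1 \<le> q powr \<kappa> * (real n + 1)"
          using True k by (intro mult_mono powr_mono) auto
        then show ?thesis by simp
      next
        case False
        have "q powr (real k + real L) = q powr (real k + real L + 1) * (1 / q)"
          using q by (simp add: powr_add)
        also have "\<dots> \<le> q powr \<kappa> * (real n + 1)"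
        proof (rule mult_mono)
          show "q powr (real k + real L + 1) \<le> q powr \<kappa>"
            using False q k by (intro powr_mono') auto
          have "real n * 1 \<le> (real n + 1) * real m" using m by (intro mult_mono) auto
          then show "1 / q \<le> real n + 1" using m n by (simp add: q_def field_simps)
        qed (use q in auto)
        finally show ?thesis .
      qed
      finally have "(q ^ k * q ^ L) * \<omega> n \<le> (q powr \<kappa> * \<omega> n) * (real n + 1)"
        using mult_right_mono[of _ _ "\<omega> n"] by (fastforce simp: mult_ac)
      also have "\<dots> \<le> \<omega> m * (real n + 1)"
        using chord[OF that] by (intro mult_right_mono) (auto simp: q_def)
      finally have "(q ^ k * q ^ L * \<omega> n) * real n ^ L \<le> (\<omega> m * (real n + 1)) * real n ^ L"
        by (intro mult_right_mono) auto
      moreover have "q ^ L * real n ^ L = real m ^ L" using n by (simp add: q_def power_divide)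
      then have "(q ^ k * q ^ L * \<omega> n) * real n ^ L = q ^ k * real m ^ L * \<omega> n" by (metis mult.assoc mult.commute)
      ultimately have "q ^ k * real m ^ L * \<omega> n \<le> (\<omega> m * (real n + 1)) * real n ^ L" by (simp only:)
      then show ?thesis by (simp only: q_def mult_ac)
    qed
    have nL: "real n ^ L * (real n + 1) \<le> (real n + 1) ^ (L + 1)"
      by (simp add: power_mono mult_left_mono)
    have "(real m / real n) ^ k * (real m + 1) ^ L * \<omega> n \<le> C * \<omega> m * (real n + 1) ^ (L + 1)" for m
    proof (cases "m \<ge> m0")
      case True
      have m: "m \<ge> 1" using True m0[of m] by simp
      have "(real m / real n) ^ k * (real m + 1) ^ L * \<omega> n \<le> (real m / real n) ^ k * (2 * real m) ^ L * \<omega> n"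
        using m by (intro mult_mono power_mono) auto
      also have "\<dots> = 2 ^ L * ((real m / real n) ^ k * real m ^ L * \<omega> n)"
        unfolding power_mult_distrib by (simp add: mult_ac)
      also have "\<dots> \<le> C * (\<omega> m * real n ^ L * (real n + 1))"
        by (rule mult_mono[OF C1(1) main[OF True]]) (use C1 in auto)
      also have "\<dots> \<le> C * (\<omega> m * (real n + 1) ^ (L + 1))"
        using C1 nL by (intro mult_left_mono) (auto simp: mult.assoc intro!: mult_left_mono)
      finally show ?thesis by (simp add: mult_ac)
    next
      case False
      \<comment> \<open>Small \<open>m\<close>, possibly 0: raise it to \<open>m0\<close>, where
        \<open>main\<close> applies, and return with \<open>1 \<le> \<omega> m\<close>.\<close>
      have "(real m / real n) ^ k * (real m + 1) ^ L * \<omega> n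
          \<le> (real m0 / real n) ^ k * ((real m0 + 1) ^ L * real m0 ^ L) * \<omega> n"
      proof (intro mult_mono power_mono divide_right_mono)
        have "(real m + 1) ^ L * 1 \<le> (real m0 + 1) ^ L * real m0 ^ L"
          using False m0(1)[of m0] by (intro mult_mono power_mono) auto
        then show "(real m + 1) ^ L \<le> (real m0 + 1) ^ L * real m0 ^ L" by simp
      qed (use False in auto)
      also have "\<dots> = (real m0 + 1) ^ L * ((real m0 / real n) ^ k * real m0 ^ L * \<omega> n)" by simp
      also have "\<dots> \<le> (real m0 + 1) ^ L * (\<omega> m0 * real n ^ L * (real n + 1))"
        by (intro mult_left_mono main) auto
      also have "\<dots> \<le> (real m0 + 1) ^ L * (\<omega> m0 * (real n + 1) ^ (L + 1))"
        using nL by (intro mult_left_mono) (auto simp: mult.assoc intro!: mult_left_mono)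
      also have "\<dots> \<le> (C * \<omega> m) * (real n + 1) ^ (L + 1)"
      proof -
        have "(real m0 + 1) ^ L * \<omega> m0 \<le> C * 1" using C1 by simp
        also have "\<dots> \<le> C * \<omega> m" using C1 ge1 by (intro mult_left_mono) auto
        finally show ?thesis unfolding mult.assoc[symmetric] by (intro mult_right_mono) auto
      qed
      finally show ?thesis .
    qed
    then show ?thesis by blast
  qed
  moreover have "N \<ge> 1" using m0(1)[of m0] by (simp add: N_def)
  ultimately show thesis using that[of C N] C1 by blast
qed

end

text \<open>The zeros of \<open>w\<^sup>2 + n\<close> lie on the imaginary axis, so each of the two
  linear factors has modulus at least \<open>Re w\<close>.\<close>

lemma cmod_square_plus_nat_ge:
  assumes "Re w \<ge> \<delta>" "\<delta> \<ge> 0"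
  shows "cmod (w\<^sup>2 + of_nat n) \<ge> \<delta>\<^sup>2"
proof -
  define s where "s = sqrt (real n)"
  have "w\<^sup>2 + of_nat n = (w + Complex 0 s) * (w - Complex 0 s)"
    by (simp add: complex_eq_iff power2_eq_square algebra_simps s_def flip: real_sqrt_mult)
  moreover have "\<delta> \<le> cmod (w + Complex 0 s)" "\<delta> \<le> cmod (w - Complex 0 s)"
    using assms complex_Re_le_cmod[of "w + Complex 0 s"] complex_Re_le_cmod[of "w - Complex 0 s"] by auto
  ultimately show ?thesis
    using assms by (simp add: norm_mult power2_eq_square mult_mono)
qed

context quasianalytic_weight
begin

text \<open>The function \<open>\<Psi>(w) = \<Sum> a\<^sub>n / (w\<^sup>2 + n)\<close> has, by the vanishing of the moments, the alternative
  representations \<open>\<Sum> a\<^sub>n (- n / w\<^sup>2)\<^sup>k / (w\<^sup>2 + n)\<close>; choosing \<open>k\<close> well shows that it decays like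
  \<open>1 / \<omega>(\<bar>w\<bar>\<^sup>2)\<close> along vertical lines.\<close>

lemma moments_zero_imp_zero:
  assumes a: "tempered a" and mom: "\<And>k. (\<Sum>n. fps_nth a n * of_nat n ^ k) = 0"
  shows "a = 0"
proof -
  define \<Psi> where "\<Psi> w = (\<Sum>n. fps_nth a n / (w\<^sup>2 + of_nat n))" for w
  have sa: "summable (\<lambda>n. cmod (fps_nth a n))"
    using tempered_summable[OF a, of 0] by simp
  have nz: "w\<^sup>2 + of_nat n \<noteq> 0" if "Re w > 0" for w n
    using cmod_square_plus_nat_ge[of "Re w" w n] that by auto
  have sk: "summable (\<lambda>n. cmod (fps_nth a n * (- of_nat n / x) ^ k))" for x :: complex and k
  proof (rule summable_comparison_test)
    show "summable (\<lambda>n. cmod (fps_nth a n) * (real n + 1) ^ k * (1 / cmod x ^ k))"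
      by (intro summable_mult2 tempered_summable a)
    show "\<exists>N. \<forall>n\<ge>N. norm (cmod (fps_nth a n * (- of_nat n / x) ^ k))
        \<le> cmod (fps_nth a n) * (real n + 1) ^ k * (1 / cmod x ^ k)"
      by (auto simp: norm_mult norm_power norm_divide power_divide
          intro!: divide_right_mono mult_left_mono power_mono)
  qed
  have le_div: "cmod (c / (w\<^sup>2 + of_nat n)) \<le> cmod c * (1 / \<delta>\<^sup>2)" if "Re w \<ge> \<delta>" "\<delta> > 0" for c w n \<delta>
    using cmod_square_plus_nat_ge[of \<delta> w n] that
    by (simp add: norm_divide frac_le)
  have skn: "summable (\<lambda>n. cmod (fps_nth a n * (- of_nat n / x) ^ k / (w\<^sup>2 + of_nat n)))"
    if "Re w > 0" for w x k
    by (rule summable_comparison_test[OF _ summable_mult2[OF sk[of x k], of "1 / (Re w)\<^sup>2"]])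
      (use le_div[of "Re w" w] that in auto)
  have iter: "\<Psi> w = (\<Sum>n. fps_nth a n * (- of_nat n / w\<^sup>2) ^ k / (w\<^sup>2 + of_nat n))" if w: "Re w > 0" for w k
  proof (induction k)
    case (Suc k)
    have w0: "w \<noteq> 0" using w by auto
    \<comment> \<open>A further factor \<open>- n / w\<^sup>2\<close> changes the sum by a multiple
      of the \<open>k\<close>-th moment, which is 0.\<close>
    have "(- of_nat n / w\<^sup>2) / (w\<^sup>2 + of_nat n) = 1 / (w\<^sup>2 + of_nat n) - 1 / w\<^sup>2" for n
      using nz[OF w, of n] w0 by (simp add: field_simps)
    then have "fps_nth a n * (- of_nat n / w\<^sup>2) ^ Suc k / (w\<^sup>2 + of_nat n)
        = fps_nth a n * (- of_nat n / w\<^sup>2) ^ k / (w\<^sup>2 + of_nat n)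
          - fps_nth a n * of_nat n ^ k * ((- 1 / w\<^sup>2) ^ k / w\<^sup>2)" for n
    proof -
      assume eq: "\<And>n. (- of_nat n / w\<^sup>2) / (w\<^sup>2 + of_nat n) = 1 / (w\<^sup>2 + of_nat n) - 1 / w\<^sup>2"
      have "(- of_nat n / w\<^sup>2) ^ k = of_nat n ^ k * (- 1 / w\<^sup>2) ^ k"
        by (simp flip: power_mult_distrib)
      moreover have "fps_nth a n * (- of_nat n / w\<^sup>2) ^ Suc k / (w\<^sup>2 + of_nat n)
        = fps_nth a n * (- of_nat n / w\<^sup>2) ^ k * ((- of_nat n / w\<^sup>2) / (w\<^sup>2 + of_nat n))"
        by simp
      ultimately show ?thesis unfolding eq by (simp add: algebra_simps)
    qed
    moreover have s1: "summable (\<lambda>n. fps_nth a n * (- of_nat n / w\<^sup>2) ^ k / (w\<^sup>2 + of_nat n))"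
      by (rule summable_norm_cancel[OF skn[OF w]])
    moreover have s2: "summable (\<lambda>n. fps_nth a n * of_nat n ^ k)"
    proof (rule summable_norm_cancel[OF summable_comparison_test[OF _ tempered_summable[OF a, of k]]])
      show "\<exists>N. \<forall>n\<ge>N. norm (norm (fps_nth a n * of_nat n ^ k)) \<le> cmod (fps_nth a n) * (real n + 1) ^ k"
        by (auto simp: norm_mult norm_power intro!: mult_left_mono power_mono)
    qed
    ultimately have "(\<Sum>n. fps_nth a n * (- of_nat n / w\<^sup>2) ^ Suc k / (w\<^sup>2 + of_nat n))
        = (\<Sum>n. fps_nth a n * (- of_nat n / w\<^sup>2) ^ k / (w\<^sup>2 + of_nat n))
          - (\<Sum>n. fps_nth a n * of_nat n ^ k * ((- 1 / w\<^sup>2) ^ k / w\<^sup>2))"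
      by (simp only: suminf_diff[OF s1 summable_mult2[OF s2]])
    also have "(\<Sum>n. fps_nth a n * of_nat n ^ k * ((- 1 / w\<^sup>2) ^ k / w\<^sup>2)) = 0"
      using suminf_mult2[OF s2, of "(- 1 / w\<^sup>2) ^ k / w\<^sup>2"] mom[of k] by simp
    finally show ?case using Suc.IH by simp
  qed (simp add: \<Psi>_def)
  have holo: "\<Psi> holomorphic_on {w. Re w > 0}"
  proof (rule holomorphic_uniform_sequence[OF open_halfspace_Re_gt])
    show "(\<lambda>w. \<Sum>n<N. fps_nth a n / (w\<^sup>2 + of_nat n)) holomorphic_on {w. Re w > 0}" for N
      by (intro holomorphic_intros) (use nz in auto)
    fix x assume x: "x \<in> {w. Re w > 0}"
    have sub: "Re y \<ge> Re x / 2" if "y \<in> cball x (Re x / 2)" for y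
      using that abs_Re_le_cmod[of "x - y"] by (auto simp: dist_norm)
    have "uniform_limit (cball x (Re x / 2)) (\<lambda>N w. \<Sum>n<N. fps_nth a n / (w\<^sup>2 + of_nat n)) \<Psi> sequentially"
      unfolding \<Psi>_def
    proof (rule Weierstrass_m_test)
      show "summable (\<lambda>n. cmod (fps_nth a n) * (1 / (Re x / 2)\<^sup>2))"
        by (rule summable_mult2[OF sa])
    qed (use le_div sub x in auto)
    moreover have "cball x (Re x / 2) \<subseteq> {w. Re w > 0}" using sub x by force
    ultimately show "\<exists>d>0. cball x d \<subseteq> {w. Re w > 0} \<and>
        uniform_limit (cball x d) (\<lambda>N w. \<Sum>n<N. fps_nth a n / (w\<^sup>2 + of_nat n)) \<Psi> sequentially"
      using x by (intro exI[of _ "Re x / 2"]) auto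
  qed
  define S0 where "S0 = (\<Sum>n. cmod (fps_nth a n))"
  have S0: "S0 \<ge> 0" unfolding S0_def by (intro suminf_nonneg sa) auto
  have bounded: "cmod (\<Psi> w) \<le> S0" if "Re w \<ge> 1" for w
  proof -
    have le: "cmod (fps_nth a n / (w\<^sup>2 + of_nat n)) \<le> cmod (fps_nth a n)" for n
      using le_div[of 1 w "fps_nth a n" n] that by simp
    have s: "summable (\<lambda>n. cmod (fps_nth a n / (w\<^sup>2 + of_nat n)))"
      by (rule summable_comparison_test[OF _ sa]) (use le in auto)
    show ?thesis
      unfolding \<Psi>_def S0_def by (rule order_trans[OF summable_norm[OF s] suminf_le[OF le s sa]])
  qed

  obtain A K where A: "A > 0" "\<And>n. cmod (fps_nth a n) * \<omega> n \<le> A * (real n + 1) ^ K"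
    using temperedE[OF a] by metis
  \<comment> \<open>\<open>K\<close> powers for the tempered bound, two for summability over
    \<open>m\<close>, and one lost in \<open>power_ratio_le\<close>.\<close>
  define M where "M = K + 3"
  obtain C N where C: "C > 0" "N \<ge> 1" and N: "\<And>n. n \<ge> N \<Longrightarrow> \<exists>k. \<forall>m.
      (real m / real n) ^ k * (real m + 1) ^ (K + 2) * \<omega> n \<le> C * \<omega> m * (real n + 1) ^ (K + 2 + 1)"
    using power_ratio_le[of "K + 2"] by metis
  define S2 where "S2 = (\<Sum>m. 1 / (real m + 1)\<^sup>2)"
  have decay: "cmod (\<Psi> w) * \<omega> n \<le> A * C * S2 * (real n + 1) ^ M"
    if w: "Re w \<ge> 1" and n: "n \<ge> N" "real n \<le> (cmod w)\<^sup>2" for w n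
  proof -
    obtain k where k: "\<And>m. (real m / real n) ^ k * (real m + 1) ^ (K + 2) * \<omega> n
        \<le> C * \<omega> m * (real n + 1) ^ (K + 2 + 1)"
      using N[OF n(1)] by blast
    have n0: "real n > 0" using n C by simp
    let ?t = "\<lambda>m. fps_nth a m * (- of_nat m / w\<^sup>2) ^ k / (w\<^sup>2 + of_nat m)"
    have le: "cmod (?t m) * \<omega> n \<le> A * C * (real n + 1) ^ M * (1 / (real m + 1)\<^sup>2)" for m
    proof -
      have "cmod (?t m) \<le> cmod (fps_nth a m * (- of_nat m / w\<^sup>2) ^ k)"
        using le_div[of 1 w "fps_nth a m * (- of_nat m / w\<^sup>2) ^ k" m] w by simp
      also have "\<dots> = cmod (fps_nth a m) * (real m / (cmod w)\<^sup>2) ^ k"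
        by (simp add: norm_mult norm_power norm_divide)
      also have "\<dots> \<le> cmod (fps_nth a m) * (real m / real n) ^ k"
      proof -
        have "(cmod w)\<^sup>2 > 0" using n n0 by linarith
        then have "real m / (cmod w)\<^sup>2 \<le> real m / real n"
          using n n0 by (intro divide_left_mono mult_pos_pos) auto
        then show ?thesis by (intro mult_left_mono power_mono) auto
      qed
      finally have t: "cmod (?t m) \<le> cmod (fps_nth a m) * (real m / real n) ^ k" .
      have "(cmod (?t m) * \<omega> n) * (real m + 1) ^ (K + 2)
          \<le> (cmod (fps_nth a m) * (real m / real n) ^ k * \<omega> n) * (real m + 1) ^ (K + 2)"
        using t by (intro mult_right_mono) auto
      also have "\<dots> = cmod (fps_nth a m) * ((real m / real n) ^ k * (real m + 1) ^ (K + 2) * \<omega> n)" by simp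
      also have "\<dots> \<le> cmod (fps_nth a m) * (C * \<omega> m * (real n + 1) ^ (K + 2 + 1))"
        by (intro mult_left_mono k) auto
      also have "\<dots> = (C * (real n + 1) ^ M) * (cmod (fps_nth a m) * \<omega> m)"
        by (simp add: M_def numeral_3_eq_3)
      also have "\<dots> \<le> (C * (real n + 1) ^ M) * (A * (real m + 1) ^ K)"
        using C by (intro mult_left_mono A) auto
      finally have "(real m + 1) ^ K * (cmod (?t m) * \<omega> n * (real m + 1)\<^sup>2)
          \<le> (real m + 1) ^ K * (A * C * (real n + 1) ^ M)"
        by (simp only: power_add) (simp only: mult_ac)
      then have "cmod (?t m) * \<omega> n * (real m + 1)\<^sup>2 \<le> A * C * (real n + 1) ^ M"
        by (rule mult_left_le_imp_le) simp
      then show ?thesis by (simp add: field_simps del: norm_divide norm_mult)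
    qed
    have s: "summable (\<lambda>m. cmod (?t m))" by (rule skn) (use w in auto)
    have "cmod (\<Psi> w) * \<omega> n \<le> (\<Sum>m. cmod (?t m)) * \<omega> n"
      using iter[of w k] w summable_norm[OF s] by (intro mult_right_mono) auto
    also have "\<dots> = (\<Sum>m. cmod (?t m) * \<omega> n)" by (rule suminf_mult2[OF s])
    also have "\<dots> \<le> (\<Sum>m. A * C * (real n + 1) ^ M * (1 / (real m + 1)\<^sup>2))"
      by (intro suminf_le le summable_mult2 s summable_mult summable_inverse_squares)
    also have "\<dots> = A * C * (real n + 1) ^ M * S2"
      unfolding S2_def by (rule suminf_mult[OF summable_inverse_squares])
    finally show ?thesis by (simp add: mult_ac)
  qed

  obtain \<mu> c where \<mu>: "\<And>j. \<mu> j \<ge> 0"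
    and upper: "\<And>J n. (\<Sum>j=1..J. \<mu> j * min (real n) (real j)) \<le> ln (\<omega> n) + c"
    and diverge: "\<And>S. \<exists>J. (\<Sum>j=1..J. \<mu> j * sqrt (real j)) > S"
    using concave_decomposition by blast
  \<comment> \<open>The shift by 1 moves the boundary away from the poles on the imaginary axis. The
    denominator absorbs the loss \<open>(n + 1) ^ M\<close> and yields the decay at infinity that
    \<open>halfplane_uniqueness\<close> requires.\<close>
  define F where "F v = \<Psi> (1 + v) / (2 + v) ^ (2 * M)" for v
  have ge2: "cmod (2 + v) \<ge> 2" "cmod (2 + v) \<ge> cmod v" if "Re v \<ge> 0" for v
  proof -
    show "cmod (2 + v) \<ge> 2" using complex_Re_le_cmod[of "2 + v"] that by simp
    show "cmod (2 + v) \<ge> cmod v" using that by (simp add: cmod_def power_mono)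
  qed
  have F_holo: "F holomorphic_on {v. Re v > -1}"
  proof -
    have "(\<lambda>v. \<Psi> (1 + v)) holomorphic_on {v. Re v > -1}"
      by (rule holomorphic_on_compose_gen[OF _ holo, unfolded o_def]) (auto intro!: holomorphic_intros)
    moreover have "2 + v \<noteq> 0" if "Re v > -1" for v using that by (auto simp: complex_eq_iff)
    ultimately show ?thesis unfolding F_def by (intro holomorphic_intros) auto
  qed
  \<comment> \<open>The second summand covers \<open>n < N\<close>, where only the trivial bound
    \<open>S0\<close> is available.\<close>
  define E where "E = A * C * S2 + S0 * (\<Sum>n<N. \<omega> n)"
  have S2: "S2 \<ge> 0" unfolding S2_def by (intro suminf_nonneg summable_inverse_squares) auto
  have F0: "F (of_real x) = 0" if "x > 0" for x
  proof (rule halfplane_uniqueness[where \<mu> = \<mu> and B = S0 and C = "E * exp c"])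
    show "F holomorphic_on {v. 0 < Re v}" by (rule holomorphic_on_subset[OF F_holo]) auto
    show "continuous_on {v. 0 \<le> Re v} F"
      by (rule continuous_on_subset[OF holomorphic_on_imp_continuous_on[OF F_holo]]) auto
    show "cmod (F v) * cmod v \<le> S0" if "0 \<le> Re v" for v
    proof -
      have "cmod v \<le> cmod (2 + v) ^ 1" using ge2[OF that] by simp
      also have "\<dots> \<le> cmod (2 + v) ^ (2 * M)"
        using ge2[OF that] by (intro power_increasing) (auto simp: M_def)
      finally have "cmod v / cmod (2 + v) ^ (2 * M) \<le> 1"
        using ge2[OF that] by (simp add: divide_le_eq)
      then have "cmod (\<Psi> (1 + v)) * (cmod v / cmod (2 + v) ^ (2 * M)) \<le> S0 * 1"
        using bounded[of "1 + v"] that S0 by (intro mult_mono) auto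
      then show ?thesis by (simp add: F_def norm_divide norm_power)
    qed
    show "cmod (F (Complex 0 y)) \<le> E * exp c * exp (- (\<Sum>j=1..J. \<mu> j * min (y\<^sup>2) (real j)))" for y J
    proof -
      \<comment> \<open>An integer between \<open>y\<^sup>2\<close>, where the concave minorant is
        evaluated, and \<open>\<bar>1 + i y\<bar>\<^sup>2\<close>, up to which \<open>decay\<close>
        applies.\<close>
      define n where "n = nat \<lfloor>1 + y\<^sup>2\<rfloor>"
      have n: "y\<^sup>2 \<le> real n" "real n \<le> 1 + y\<^sup>2" by (auto simp: n_def) linarith
      have n1: "real n + 1 \<le> (cmod (2 + Complex 0 y))\<^sup>2" "real n \<le> (cmod (1 + Complex 0 y))\<^sup>2"
        using n by (auto simp: cmod_power2)
      have c2: "cmod (2 + Complex 0 y) \<ge> 1" "cmod (2 + Complex 0 y) > 0"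
        using ge2(1)[of "Complex 0 y"] by auto
      have FE: "cmod (F (Complex 0 y)) * \<omega> n \<le> E"
      proof (cases "n \<ge> N")
        case True
        have "cmod (\<Psi> (1 + Complex 0 y)) * \<omega> n \<le> A * C * S2 * (real n + 1) ^ M"
          using True n1 by (intro decay) auto
        also have "\<dots> \<le> A * C * S2 * (cmod (2 + Complex 0 y))\<^sup>2 ^ M"
          using n1 A C S2 by (intro mult_left_mono power_mono) auto
        finally have "cmod (F (Complex 0 y)) * \<omega> n \<le> A * C * S2"
          unfolding F_def norm_divide norm_power power_mult times_divide_eq_left
          using c2 by (subst pos_divide_le_eq) auto
        also have "\<dots> \<le> E" using S0 by (auto simp: E_def intro!: mult_nonneg_nonneg sum_nonneg)
        finally show ?thesis .
      next
        case False
        have "cmod (F (Complex 0 y)) \<le> cmod (\<Psi> (1 + Complex 0 y)) / 1"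
          unfolding F_def norm_divide norm_power
          using c2 by (intro divide_left_mono one_le_power mult_pos_pos zero_less_power) auto
        also have "\<dots> \<le> S0" using bounded[of "1 + Complex 0 y"] by simp
        finally have "cmod (F (Complex 0 y)) * \<omega> n \<le> S0 * (\<Sum>n<N. \<omega> n)"
          using False S0 by (intro mult_mono member_le_sum) auto
        also have "\<dots> \<le> E" using A C S2 by (simp add: E_def)
        finally show ?thesis .
      qed
      have "(\<Sum>j=1..J. \<mu> j * min (y\<^sup>2) (real j)) \<le> (\<Sum>j=1..J. \<mu> j * min (real n) (real j))"
        using n by (intro sum_mono mult_left_mono \<mu>) auto
      also have "\<dots> \<le> ln (\<omega> n) + c" by (rule upper)
      finally have "exp (\<Sum>j=1..J. \<mu> j * min (y\<^sup>2) (real j)) \<le> exp (ln (\<omega> n) + c)" by simp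
      then have "cmod (F (Complex 0 y)) * exp (\<Sum>j=1..J. \<mu> j * min (y\<^sup>2) (real j))
          \<le> cmod (F (Complex 0 y)) * \<omega> n * exp c"
        using mult_left_mono[of _ _ "cmod (F (Complex 0 y))"] by (simp add: exp_add mult.assoc)
      also have "\<dots> \<le> E * exp c" using FE by simp
      finally show ?thesis by (simp add: exp_minus field_simps)
    qed
  qed (use \<mu> diverge that in auto)
  \<comment> \<open>So far \<Psi> vanishes on the real ray beyond 1; the identity theorem extends
    this up to the poles.\<close>
  have zero: "\<Psi> w = 0" if "Re w > 0" for w
  proof (rule analytic_continuation[OF holo, of "of_real ` {1<..}" 2])
    show "2 islimpt (complex_of_real ` {1<..})"
      unfolding islimpt_approachable
    proof (intro allI impI)
      fix e :: real assume "e > 0"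
      then show "\<exists>x'\<in>complex_of_real ` {1<..}. x' \<noteq> 2 \<and> dist x' 2 < e"
        by (intro bexI[of _ "of_real (2 + e / 2)"]) (auto simp: dist_norm complex_eq_iff)
    qed
    fix z assume "z \<in> complex_of_real ` {1<..}"
    then obtain x where x: "z = of_real x" "x > 1" by auto
    have "F (of_real (x - 1)) = 0" using F0[of "x - 1"] x by simp
    moreover have "2 + complex_of_real (x - 1) \<noteq> 0"
      using x by (auto simp: complex_eq_iff)
    ultimately show "\<Psi> z = 0" using x by (simp add: F_def)
  qed (use that in \<open>auto intro: open_halfspace_Re_gt convex_connected convex_halfspace_Re_gt\<close>)

  have "fps_nth a m = 0" for m
  proof -
    have le: "cmod (fps_nth a m) \<le> e * S0" if "e > 0" for e
    proof -
      \<comment> \<open>Approach the pole of the \<open>m\<close>-th term: there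
        \<open>w\<^sup>2 + m\<close> has modulus \<open>e\<close>, while the other terms stay
        bounded by \<open>S0\<close>. As the whole sum is 0, the \<open>m\<close>-th term is bounded
        as well, which forces its coefficient to vanish as \<open>e\<close> tends to 0.\<close>
      define z where "z = Complex (- real m) e"
      define w where "w = csqrt z"
      have w2: "w\<^sup>2 = z" by (simp add: w_def)
      have "Re w \<noteq> 0"
      proof
        assume "Re w = 0"
        then have "Im (w\<^sup>2) = 0" by (simp add: power2_eq_square)
        then show False using that by (simp add: w2 z_def)
      qed
      then have w: "Re w > 0" using csqrt_principal[of z] by (auto simp: w_def)
      define t where "t n = fps_nth a n / (w\<^sup>2 + of_nat n)" for n
      have t: "summable (\<lambda>n. cmod (t n))" using skn[OF w, of 1 0] by (simp add: t_def)
      let ?r = "\<lambda>n. t n - (if n = m then t m else 0)"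
      have sr: "?r sums (0 - t m)"
      proof (rule sums_diff)
        show "t sums 0"
          using summable_sums[OF summable_norm_cancel[OF t]] zero[OF w] by (simp add: \<Psi>_def t_def[abs_def])
        show "(\<lambda>n. if n = m then t m else 0) sums t m" by (rule sums_single)
      qed
      have rle: "cmod (?r n) \<le> cmod (fps_nth a n)" for n
      proof (cases "n = m")
        case False
        \<comment> \<open>The real part is the nonzero integer \<open>n - m\<close>.\<close>
        have "1 \<le> \<bar>Re (w\<^sup>2 + of_nat n)\<bar>" using False by (auto simp: w2 z_def)
        also have "\<dots> \<le> cmod (w\<^sup>2 + of_nat n)" by (rule abs_Re_le_cmod)
        finally have "cmod (fps_nth a n) / cmod (w\<^sup>2 + of_nat n) \<le> cmod (fps_nth a n) / 1"
          by (intro divide_left_mono) auto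
        then show ?thesis using False by (simp add: t_def norm_divide)
      qed simp
      have s: "summable (\<lambda>n. cmod (?r n))"
        by (rule summable_comparison_test[OF _ sa]) (use rle in auto)
      have "cmod (t m) = cmod (0 - t m)" by simp
      also have "\<dots> = cmod (\<Sum>n. ?r n)" by (simp only: sums_unique[OF sr])
      also have "\<dots> \<le> S0"
        unfolding S0_def by (rule order_trans[OF summable_norm[OF s] suminf_le[OF rle s sa]])
      finally have tS: "cmod (t m) \<le> S0" .
      have "w\<^sup>2 + of_nat m = Complex 0 e" by (simp add: w2 z_def complex_eq_iff)
      moreover have "cmod (Complex 0 e) = e" using that by (simp add: cmod_def)
      ultimately have "cmod (t m) = cmod (fps_nth a m) / e"
        by (simp add: t_def norm_divide)
      then show ?thesis using mult_left_mono[OF tS, of e] that by (simp add: field_simps)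
    qed
    have "cmod (fps_nth a m) \<le> 0"
    proof (rule field_le_epsilon)
      fix d :: real assume "d > 0"
      then have "cmod (fps_nth a m) \<le> (d / (S0 + 1)) * S0" using S0 by (intro le) auto
      also have "\<dots> \<le> d" using S0 \<open>d > 0\<close> by (simp add: field_simps)
      finally show "cmod (fps_nth a m) \<le> 0 + d" by simp
    qed
    then show ?thesis by simp
  qed
  then show ?thesis by (simp add: fps_eq_iff)
qed

end

section \<open>Zeros and factorization\<close>

context rapid_weight
begin

lemma tempered_linear_power_mult:
  assumes "tempered h"
  shows "tempered ((fps_X - fps_const c) ^ m * h)"
  by (rule eval_linear_power_mult(1)[OF assms, of 0]) simp

text \<open>Product rule: the Euler derivative lowers the order of vanishing at \<open>c\<close> by
  at most one.\<close>

lemma XD_linear_power_mult: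
  assumes "tempered g"
  shows "\<exists>g'. tempered g' \<and> fps_XD ((fps_X - fps_const c) ^ Suc j * g) = (fps_X - fps_const c) ^ j * g'"
proof -
  define g' where "g' = fps_const (of_nat (Suc j)) * (fps_X * g) + (fps_X - fps_const c) ^ 1 * fps_XD g"
  have "tempered g'"
    unfolding g'_def
    by (intro tempered_add tempered_const_mult tempered_X_mult tempered_linear_power_mult tempered_XD assms)
  moreover have "fps_XD ((fps_X - fps_const c) ^ Suc j * g) = (fps_X - fps_const c) ^ j * g'"
    unfolding g'_def fps_XD_def o_def fps_deriv_mult fps_deriv_power
    by (simp add: algebra_simps fps_of_nat)
  ultimately show ?thesis by blast
qed

text \<open>As \<open>m\<close> is arbitrary, the order lost in a derivative is recovered by
  starting from \<open>Suc m\<close>.\<close>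

lemma XD_power_flat:
  assumes "\<And>m. \<exists>g. tempered g \<and> f = (fps_X - fps_const c) ^ m * g"
  shows "\<exists>g. tempered g \<and> (fps_XD ^^ k) f = (fps_X - fps_const c) ^ m * g"
proof (induction k arbitrary: m)
  case (Suc k)
  then show ?case using XD_linear_power_mult by (metis funpow.simps(2) o_apply)
qed (use assms in auto)

lemma fps_nth_XD_power: "fps_nth ((fps_XD ^^ k) f) n = of_nat n ^ k * fps_nth f n"
  by (induction k) (auto simp: mult_ac)

end

context quasianalytic_weight
begin

text \<open>The \<open>k\<close>-th Euler derivative of \<open>f\<close> at \<open>z\<close> is the
  \<open>k\<close>-th moment of the sequence \<open>f_n z^n\<close>, and flatness makes it
  vanish.\<close>

lemma not_flat:
  assumes f: "tempered f" "f \<noteq> 0" and z: "cmod z \<le> 1"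
    and flat: "\<And>m. \<exists>g. tempered g \<and> f = (fps_X - fps_const z) ^ m * g"
  shows False
proof (cases "z = 0")
  \<comment> \<open>At the origin \<open>f_n z^n\<close> retains only the constant term, but
    divisibility by all powers of \<open>fps_X\<close> kills every coefficient directly.\<close>
  case True
  have "fps_nth f n = 0" for n
  proof -
    obtain g where "f = (fps_X - fps_const z) ^ Suc n * g" using flat by blast
    then have "f = fps_X ^ Suc n * g" using True by simp
    then show ?thesis by (simp add: fps_X_power_mult_nth del: power_Suc)
  qed
  then show False using f(2) by (simp add: fps_eq_iff)
next
  case False
  define a where "a = Abs_fps (\<lambda>n. fps_nth f n * z ^ n)"
  have "a = 0"
  proof (rule moments_zero_imp_zero)
    obtain C K where C: "C > 0" "\<And>n. cmod (fps_nth f n) * \<omega> n \<le> C * (real n + 1) ^ K"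
      using temperedE[OF f(1)] by metis
    show "tempered a"
    proof (rule temperedI)
      fix n
      have "cmod (fps_nth a n) * \<omega> n \<le> cmod (fps_nth f n) * \<omega> n"
        using z by (intro mult_right_mono)
          (auto simp: a_def norm_mult norm_power intro!: mult_left_le power_le_one)
      also have "\<dots> \<le> C * (real n + 1) ^ K" by (rule C)
      finally show "cmod (fps_nth a n) * \<omega> n \<le> C * (real n + 1) ^ K" .
    qed
    fix k
    obtain g where g: "tempered g" "(fps_XD ^^ k) f = (fps_X - fps_const z) ^ 1 * g"
      using XD_power_flat[OF flat] by blast
    have "eval_fps ((fps_XD ^^ k) f) z = 0"
      unfolding g(2) using eval_linear_power_mult(2)[OF g(1) z, of z 1] by simp
    then show "(\<Sum>n. fps_nth a n * of_nat n ^ k) = 0"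
      by (simp add: eval_fps_def fps_nth_XD_power a_def mult_ac)
  qed
  then have "fps_nth f n * z ^ n = 0" for n
    by (metis a_def fps_nth_Abs_fps fps_zero_nth)
  then show False using f(2) False by (auto simp: fps_eq_iff)
qed

text \<open>Divide by the linear factor while the quotient vanishes at \<open>z\<close>; a division
  that never stops would contradict \<open>not_flat\<close>.\<close>

lemma finite_multiplicity:
  assumes f: "tempered f" "f \<noteq> 0" and z: "cmod z \<le> 1"
  shows "\<exists>m g. tempered g \<and> f = (fps_X - fps_const z) ^ m * g \<and> eval_fps g z \<noteq> 0"
proof (rule ccontr)
  assume neg: "\<not> ?thesis"
  have "\<exists>g. tempered g \<and> f = (fps_X - fps_const z) ^ m * g" for m
  proof (induction m)
    case 0
    then show ?case using f by auto
  next
    case (Suc m)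
    then obtain g where g: "tempered g" "f = (fps_X - fps_const z) ^ m * g" by blast
    then have "eval_fps g z = 0" using neg by blast
    then obtain h where "tempered h" "g = (fps_X - fps_const z) * h"
      using divide_linear[OF g(1) z] by blast
    then show ?case using g(2) by (intro exI[of _ h]) (simp add: mult_ac)
  qed
  then show False using not_flat[OF f z] by blast
qed

text \<open>An accumulation point may lie on the circle, where the identity theorem gives nothing.
  Dividing out its finite multiplicity leaves a quotient that is continuous and nonzero there, so no
  other zeros are near.\<close>

lemma finite_zeros:
  assumes f: "tempered f" "f \<noteq> 0"
  shows "finite {z \<in> cball 0 1. eval_fps f z = 0}"
proof (rule ccontr)
  let ?Z = "{z \<in> cball 0 1. eval_fps f z = 0}"
  assume "infinite ?Z"
  then obtain z where z: "z \<in> cball 0 1" "z islimpt ?Z"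
    using compact_cball[of 0 1] unfolding compact_eq_Bolzano_Weierstrass by blast
  then have z1: "cmod z \<le> 1" by simp
  obtain m g where g: "tempered g" "f = (fps_X - fps_const z) ^ m * g" "eval_fps g z \<noteq> 0"
    using finite_multiplicity[OF f z1] by blast
  obtain e where e: "e > 0" "\<And>y. y \<in> cball 0 1 \<Longrightarrow> dist z y < e \<Longrightarrow> eval_fps g y \<noteq> 0"
    using continuous_on_avoid[OF continuous_on_eval[OF g(1)] z(1) g(3)] by blast
  obtain y where y: "y \<in> ?Z" "y \<noteq> z" "dist y z < e"
    using z(2) e(1) unfolding islimpt_approachable by blast
  then have "eval_fps g y \<noteq> 0" using e(2)[of y] by (simp add: dist_commute)
  moreover have "eval_fps f y = (y - z) ^ m * eval_fps g y"
    unfolding g(2) using y(1) by (intro eval_linear_power_mult g) auto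
  ultimately show False using y by simp
qed

text \<open>Induction on the number of distinct zeros: each step removes one zero with its full
  multiplicity and creates none.\<close>

lemma factorization:
  assumes "tempered f" "f \<noteq> 0"
  shows "\<exists>p g. p \<noteq> 0 \<and> tempered g \<and> f = fps_of_poly p * g \<and> (\<forall>z\<in>cball 0 1. eval_fps g z \<noteq> 0)"
  using assms
proof (induction "card {z \<in> cball 0 1. eval_fps f z = 0}" arbitrary: f rule: less_induct)
  case less
  let ?Z = "\<lambda>f. {z \<in> cball 0 1. eval_fps f z = 0}"
  show ?case
  proof (cases "?Z f = {}")
    case True
    then show ?thesis using less.prems by (intro exI[of _ 1] exI[of _ f]) auto
  next
    case False
    then obtain z where z: "cmod z \<le> 1" "eval_fps f z = 0" by auto
    obtain m g where g: "tempered g" "f = (fps_X - fps_const z) ^ m * g" "eval_fps g z \<noteq> 0"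
      using finite_multiplicity[OF less.prems z(1)] by blast
    have "?Z g \<subset> ?Z f"
      using g eval_linear_power_mult(2)[OF g(1), of _ z m] z by auto
    then have "card (?Z g) < card (?Z f)"
      by (intro psubset_card_mono finite_zeros less.prems)
    moreover have "g \<noteq> 0" using g(2) less.prems by auto
    ultimately obtain p h where p: "p \<noteq> 0" "tempered h" "g = fps_of_poly p * h"
        "\<forall>z\<in>cball 0 1. eval_fps h z \<noteq> 0"
      using less.hyps[OF _ g(1)] by blast
    have "f = fps_of_poly ([:- z, 1:] ^ m * p) * h"
      unfolding g(2) p(3) fps_of_poly_mult fps_of_poly_power
      by (simp add: fps_of_poly_pCons mult_ac)
    moreover have "[:- z, 1:] ^ m * p \<noteq> 0" using p(1) by simp
    ultimately show ?thesis using p by blast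
  qed
qed

end

section \<open>Weighted norms of products\<close>

lemma sum_delayed:
  fixes \<phi> :: "nat \<Rightarrow> real"
  shows "(\<Sum>n<N. if j \<le> n then \<phi> (n - j) else 0) = (\<Sum>i<N - j. \<phi> i)"
proof (induction N)
  case (Suc N)
  then show ?case by (cases "j \<le> N") (auto simp: Suc_diff_le)
qed simp

lemma sum_delayed_le:
  fixes \<phi> :: "nat \<Rightarrow> real"
  assumes "\<And>n. \<phi> n \<ge> 0"
  shows "(\<Sum>n<N. if j \<le> n then \<phi> (n - j) else 0) \<le> (\<Sum>n<N. \<phi> n)"
  unfolding sum_delayed by (rule sum_mono2) (use assms in auto)

lemma convolution_eq:
  fixes \<alpha> \<beta> :: "nat \<Rightarrow> real"
  assumes "n < N"
  shows "(\<Sum>j\<le>n. \<alpha> j * \<beta> (n - j)) = (\<Sum>j<N. \<alpha> j * (if j \<le> n then \<beta> (n - j) else 0))"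
  by (rule sum.mono_neutral_cong_left) (use assms in auto)

text \<open>Exchange the two sums. Only partial sums occur, so no summability has to be carried
  along.\<close>

lemma convolution_l1_le:
  fixes \<alpha> \<beta> :: "nat \<Rightarrow> real"
  assumes \<alpha>: "\<And>n. \<alpha> n \<ge> 0" "(\<Sum>n<N. \<alpha> n) \<le> a" and \<beta>: "\<And>n. \<beta> n \<ge> 0" "(\<Sum>n<N. \<beta> n) \<le> b"
  shows "(\<Sum>n<N. \<Sum>j\<le>n. \<alpha> j * \<beta> (n - j)) \<le> a * b"
proof -
  have b: "b \<ge> 0" using sum_nonneg[of "{..<N}" \<beta>] \<beta> by auto
  have "(\<Sum>n<N. \<Sum>j\<le>n. \<alpha> j * \<beta> (n - j)) = (\<Sum>n<N. \<Sum>j<N. \<alpha> j * (if j \<le> n then \<beta> (n - j) else 0))"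
    by (intro sum.cong convolution_eq) auto
  also have "\<dots> = (\<Sum>j<N. \<alpha> j * (\<Sum>n<N. if j \<le> n then \<beta> (n - j) else 0))"
    unfolding sum_distrib_left by (rule sum.swap)
  also have "\<dots> \<le> (\<Sum>j<N. \<alpha> j * b)"
    by (intro sum_mono mult_left_mono order_trans[OF sum_delayed_le \<beta>(2)] \<alpha> \<beta>)
  also have "\<dots> = (\<Sum>j<N. \<alpha> j) * b" by (simp add: sum_distrib_right)
  also have "\<dots> \<le> a * b" using \<alpha>(2) b by (rule mult_right_mono)
  finally show ?thesis .
qed

lemma L2_set_sum_le: "finite A \<Longrightarrow> L2_set (\<lambda>n. \<Sum>j\<in>A. f j n) S \<le> (\<Sum>j\<in>A. L2_set (f j) S)"
proof (induction A rule: finite_induct)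
  case (insert j A)
  have "L2_set (\<lambda>n. \<Sum>j\<in>insert j A. f j n) S = L2_set (\<lambda>n. f j n + (\<Sum>j\<in>A. f j n)) S"
    using insert.hyps by simp
  also have "\<dots> \<le> L2_set (f j) S + L2_set (\<lambda>n. \<Sum>j\<in>A. f j n) S" by (rule L2_set_triangle_ineq)
  finally show ?case using insert by simp
qed (simp add: L2_set_def)

text \<open>The convolution is a superposition of delayed copies of \<beta> with weights \<alpha>; a
  delay does not increase the truncated norm, and Minkowski's inequality adds the copies up.\<close>

lemma convolution_l2_le:
  fixes \<alpha> \<beta> :: "nat \<Rightarrow> real"
  assumes \<alpha>: "\<And>n. \<alpha> n \<ge> 0" "(\<Sum>n<N. \<alpha> n) \<le> a" and \<beta>: "\<And>n. \<beta> n \<ge> 0" "L2_set \<beta> {..<N} \<le> b"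
  shows "L2_set (\<lambda>n. \<Sum>j\<le>n. \<alpha> j * \<beta> (n - j)) {..<N} \<le> a * b"
proof -
  have b: "b \<ge> 0" using L2_set_nonneg \<beta>(2) by (rule order_trans)
  have delayed: "L2_set (\<lambda>n. if j \<le> n then \<beta> (n - j) else 0) {..<N} \<le> b" for j
  proof -
    have "(\<Sum>n<N. (if j \<le> n then \<beta> (n - j) else 0)\<^sup>2) = (\<Sum>n<N. if j \<le> n then (\<beta> (n - j))\<^sup>2 else 0)"
      by (rule sum.cong) auto
    also have "\<dots> \<le> (\<Sum>n<N. (\<beta> n)\<^sup>2)" by (rule sum_delayed_le) simp
    finally have "L2_set (\<lambda>n. if j \<le> n then \<beta> (n - j) else 0) {..<N} \<le> L2_set \<beta> {..<N}"
      unfolding L2_set_def by (rule real_sqrt_le_mono)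
    with \<beta>(2) show ?thesis by linarith
  qed
  have "L2_set (\<lambda>n. \<Sum>j\<le>n. \<alpha> j * \<beta> (n - j)) {..<N}
      = L2_set (\<lambda>n. \<Sum>j<N. \<alpha> j * (if j \<le> n then \<beta> (n - j) else 0)) {..<N}"
    by (intro L2_set_cong convolution_eq) auto
  also have "\<dots> \<le> (\<Sum>j<N. L2_set (\<lambda>n. \<alpha> j * (if j \<le> n then \<beta> (n - j) else 0)) {..<N})"
    by (rule L2_set_sum_le) simp
  also have "\<dots> = (\<Sum>j<N. \<alpha> j * L2_set (\<lambda>n. if j \<le> n then \<beta> (n - j) else 0) {..<N})"
    by (simp add: L2_set_right_distrib \<alpha>)
  also have "\<dots> \<le> (\<Sum>j<N. \<alpha> j * b)"
    by (intro sum_mono mult_left_mono delayed \<alpha>)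
  also have "\<dots> = (\<Sum>j<N. \<alpha> j) * b" by (simp add: sum_distrib_right)
  also have "\<dots> \<le> a * b" using \<alpha>(2) b by (rule mult_right_mono)
  finally show ?thesis .
qed

lemma cmod_fps_mult_le:
  "cmod (fps_nth (f * g) n) \<le> (\<Sum>j\<le>n. cmod (fps_nth f j) * cmod (fps_nth g (n - j)))"
  unfolding fps_mult_nth atLeast0AtMost
  by (rule order_trans[OF norm_sum]) (simp add: norm_mult)

context rapid_weight
begin

text \<open>A bound on all partial sums expresses finiteness and size of the norm at once. It also
  passes to a limit as soon as initial coefficients agree, which ends the proof of
  \<open>wiener_inverse\<close>.\<close>

definition low_le :: "nat \<Rightarrow> complex fps \<Rightarrow> real \<Rightarrow> bool" where
  "low_le k h a \<longleftrightarrow> (\<forall>N. (\<Sum>n<N. cmod (fps_nth h n) * \<omega> n / (real n + 1) ^ k) \<le> a)"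

definition l2_le :: "complex fps \<Rightarrow> real \<Rightarrow> bool" where
  "l2_le h b \<longleftrightarrow> (\<forall>N. L2_set (\<lambda>n. cmod (fps_nth h n) * \<omega> n) {..<N} \<le> b)"

lemma low_le_nonneg: "low_le k h a \<Longrightarrow> a \<ge> 0"
  unfolding low_le_def by (drule spec[of _ 0]) simp

lemma l2_le_nonneg: "l2_le h b \<Longrightarrow> b \<ge> 0"
  unfolding l2_le_def by (drule spec[of _ 0]) simp

lemma l2_le_add:
  assumes "l2_le g a" "l2_le h b"
  shows "l2_le (g + h) (a + b)"
  unfolding l2_le_def
proof
  fix N
  have "L2_set (\<lambda>n. cmod (fps_nth (g + h) n) * \<omega> n) {..<N}
      \<le> L2_set (\<lambda>n. cmod (fps_nth g n) * \<omega> n + cmod (fps_nth h n) * \<omega> n) {..<N}"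
    by (rule L2_set_mono) (auto simp: norm_triangle_ineq simp flip: distrib_right intro!: mult_right_mono)
  also have "\<dots> \<le> a + b"
    by (rule order_trans[OF L2_set_triangle_ineq add_mono]) (use assms in \<open>auto simp: l2_le_def\<close>)
  finally show "L2_set (\<lambda>n. cmod (fps_nth (g + h) n) * \<omega> n) {..<N} \<le> a + b" .
qed

lemma l2_le_sum:
  fixes n :: nat
  shows "(\<And>i. i < n \<Longrightarrow> l2_le (h i) (b i)) \<Longrightarrow> l2_le (\<Sum>i<n. h i) (\<Sum>i<n. b i)"
proof (induction n)
  case (Suc n)
  then show ?case by (auto intro: l2_le_add)
qed (simp add: l2_le_def L2_set_def)

text \<open>The gain \<open>(j + 1) ^ k\<close> in \<open>submult\<close> is exactly what makes
  \<open>\<omega> n / (n + 1) ^ k\<close> submultiplicative up to a constant.\<close>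

lemma low_product:
  "\<exists>K\<ge>1. \<forall>h1 h2 a1 a2. low_le k h1 a1 \<longrightarrow> low_le k h2 a2 \<longrightarrow> low_le k (h1 * h2) (K * (a1 * a2))"
proof -
  obtain C where C: "C \<ge> 1" "\<And>i j. j \<le> i \<Longrightarrow> \<omega> (i + j) * (real j + 1) ^ k \<le> C * \<omega> i * \<omega> j"
    using submult[of k] by blast
  have C': "\<omega> (i + j) / (real (i + j) + 1) ^ k \<le> C * (\<omega> i / (real i + 1) ^ k * (\<omega> j / (real j + 1) ^ k))"
    if "j \<le> i" for i j
  proof -
    have "\<omega> (i + j) / (real (i + j) + 1) ^ k \<le> \<omega> (i + j) / (real i + 1) ^ k"
      by (intro divide_left_mono power_mono) auto
    also have "\<dots> \<le> (C * \<omega> i * \<omega> j / (real j + 1) ^ k) / (real i + 1) ^ k"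
      using C(2)[OF that] by (intro divide_right_mono) (auto simp: field_simps)
    finally show ?thesis by (simp add: mult_ac)
  qed
  have C'': "\<omega> (i + j) / (real (i + j) + 1) ^ k \<le> C * (\<omega> i / (real i + 1) ^ k * (\<omega> j / (real j + 1) ^ k))" for i j
    using C'[of j i] C'[of i j] by (cases "j \<le> i") (simp_all add: add.commute mult.commute)
  have "low_le k (h1 * h2) (C * (a1 * a2))" if h: "low_le k h1 a1" "low_le k h2 a2" for h1 h2 a1 a2
    unfolding low_le_def
  proof
    fix N
    define \<alpha> where "\<alpha> j = cmod (fps_nth h1 j) * \<omega> j / (real j + 1) ^ k" for j
    define \<beta> where "\<beta> j = cmod (fps_nth h2 j) * \<omega> j / (real j + 1) ^ k" for j
    have "cmod (fps_nth (h1 * h2) n) * \<omega> n / (real n + 1) ^ k \<le> C * (\<Sum>j\<le>n. \<alpha> j * \<beta> (n - j))" for n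
    proof -
      have "cmod (fps_nth (h1 * h2) n) * (\<omega> n / (real n + 1) ^ k)
          \<le> (\<Sum>j\<le>n. cmod (fps_nth h1 j) * cmod (fps_nth h2 (n - j))) * (\<omega> n / (real n + 1) ^ k)"
        by (intro mult_right_mono cmod_fps_mult_le) auto
      also have "\<dots> = (\<Sum>j\<le>n. cmod (fps_nth h1 j) * cmod (fps_nth h2 (n - j)) * (\<omega> n / (real n + 1) ^ k))"
        by (rule sum_distrib_right)
      also have "\<dots> \<le> (\<Sum>j\<le>n. C * (\<alpha> j * \<beta> (n - j)))"
      proof (rule sum_mono)
        fix j assume "j \<in> {..n}"
        then have "\<omega> n / (real n + 1) ^ k
            \<le> C * (\<omega> j / (real j + 1) ^ k * (\<omega> (n - j) / (real (n - j) + 1) ^ k))"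
          using C''[of j "n - j"] by simp
        then have "cmod (fps_nth h1 j) * cmod (fps_nth h2 (n - j)) * (\<omega> n / (real n + 1) ^ k)
            \<le> cmod (fps_nth h1 j) * cmod (fps_nth h2 (n - j)) *
              (C * (\<omega> j / (real j + 1) ^ k * (\<omega> (n - j) / (real (n - j) + 1) ^ k)))"
          by (intro mult_left_mono) auto
        then show "cmod (fps_nth h1 j) * cmod (fps_nth h2 (n - j)) * (\<omega> n / (real n + 1) ^ k)
            \<le> C * (\<alpha> j * \<beta> (n - j))"
          by (simp add: \<alpha>_def \<beta>_def mult_ac)
      qed
      finally show ?thesis by (simp add: sum_distrib_left)
    qed
    then have "(\<Sum>n<N. cmod (fps_nth (h1 * h2) n) * \<omega> n / (real n + 1) ^ k)
        \<le> (\<Sum>n<N. C * (\<Sum>j\<le>n. \<alpha> j * \<beta> (n - j)))"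
      by (intro sum_mono)
    also have "\<dots> = C * (\<Sum>n<N. \<Sum>j\<le>n. \<alpha> j * \<beta> (n - j))" by (simp add: sum_distrib_left)
    also have "\<dots> \<le> C * (a1 * a2)"
      using C(1) h by (intro mult_left_mono convolution_l1_le) (auto simp: \<alpha>_def \<beta>_def low_le_def)
    finally show "(\<Sum>n<N. cmod (fps_nth (h1 * h2) n) * \<omega> n / (real n + 1) ^ k) \<le> C * (a1 * a2)" .
  qed
  then show ?thesis using C(1) by blast
qed

definition lower_half :: "nat \<Rightarrow> complex fps \<Rightarrow> complex fps" where
  "lower_half n h = Abs_fps (\<lambda>j. if 2 * j \<le> n then fps_nth h j else 0)"

definition strict_lower_half :: "nat \<Rightarrow> complex fps \<Rightarrow> complex fps" where
  "strict_lower_half n h = Abs_fps (\<lambda>j. if 2 * j < n then fps_nth h j else 0)"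

text \<open>Inclusion and exclusion of the low frequencies of the two factors. The remaining product
  of the high parts has no coefficient up to degree \<open>n\<close>, since two indices above
  \<open>n / 2\<close> have a sum above \<open>n\<close>.\<close>

lemma product_split:
  "fps_nth (p * (h1 * h2)) n =
     fps_nth (lower_half n h1 * (p * h2)) n + fps_nth (strict_lower_half n h2 * (p * h1)) n
     - fps_nth (p * (lower_half n h1 * strict_lower_half n h2)) n"
proof -
  define a c where "a = lower_half n h1" and "c = strict_lower_half n h2"
  have small: "fps_nth ((h1 - a) * (h2 - c)) m = 0" if "m \<le> n" for m
    unfolding fps_mult_nth
  proof (rule sum.neutral, safe)
    fix i assume "i \<in> {0..m}"
    then show "fps_nth (h1 - a) i * fps_nth (h2 - c) (m - i) = 0"
      using that by (cases "2 * i \<le> n") (auto simp: a_def c_def lower_half_def strict_lower_half_def)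
  qed
  have "p * (h1 * h2) = a * (p * h2) + c * (p * h1) - p * (a * c) + p * ((h1 - a) * (h2 - c))"
    by (simp add: algebra_simps)
  moreover have "fps_nth (p * ((h1 - a) * (h2 - c))) n = 0"
    unfolding fps_mult_nth[of p] by (rule sum.neutral) (auto simp: small)
  ultimately show ?thesis by (simp add: a_def c_def)
qed

text \<open>\<open>low_le\<close> bounds a weaker norm than \<open>l2_le\<close>; multiplication by \<open>p\<close> may restore the strong norm
  of a product, because in each coefficient of \<open>h\<^sub>1 h\<^sub>2\<close> the factor of \<open>p\<close> can be moved to the factor
  of higher frequency, up to terms where both frequencies are comparable.\<close>

lemma tame_product:
  assumes p: "\<And>i. i > d \<Longrightarrow> fps_nth p i = 0"
  shows "\<exists>K\<ge>1. \<forall>h1 h2 a1 a2 b1 b2. low_le k h1 a1 \<longrightarrow> low_le k h2 a2 \<longrightarrow> l2_le (p * h1) b1 \<longrightarrow>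
    l2_le (p * h2) b2 \<longrightarrow> l2_le (p * (h1 * h2)) (K * (a1 * b2 + a2 * b1 + a1 * a2))"
proof -
  obtain C where C: "C \<ge> 1" "\<And>i j. j \<le> i \<Longrightarrow> \<omega> (i + j) * (real j + 1) ^ k \<le> C * \<omega> i * \<omega> j"
    using submult[of k] by blast
  obtain C0 where C0: "C0 \<ge> 1" "\<And>i j. j \<le> i \<Longrightarrow> \<omega> (i + j) \<le> C0 * \<omega> i * \<omega> j"
    using submult[of 0] by auto
  \<comment> \<open>When both frequencies are comparable to \<open>n\<close>, \<open>2 * k\<close>
    powers make up for two weak norms, and the last one leaves the square-summable
    \<open>1 / (n + 1)\<close>.\<close>
  obtain C3 where C3: "C3 \<ge> 1"
    "\<And>i j. j \<le> i \<Longrightarrow> \<omega> (i + j) * (real j + 1) ^ (2 * k + 1) \<le> C3 * \<omega> i * \<omega> j"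
    using submult[of "2 * k + 1"] by blast
  \<comment> \<open>The price of moving an index by at most \<open>d\<close>, as multiplication by
    \<open>p\<close> does.\<close>
  define W where "W = C0 * (\<Sum>i\<le>d. \<omega> i)"
  have W: "\<omega> (m + i) \<le> W * \<omega> m" if "i \<le> d" for m i
  proof -
    have "\<omega> (m + i) \<le> C0 * \<omega> i * \<omega> m"
      using C0(2)[of i m] C0(2)[of m i] by (cases "i \<le> m") (auto simp: mult_ac add.commute)
    also have "\<dots> \<le> C0 * (\<Sum>i\<le>d. \<omega> i) * \<omega> m"
      using C0(1) that by (intro mult_right_mono mult_left_mono member_le_sum) auto
    finally show ?thesis by (simp add: W_def)
  qed
  have W0: "W \<ge> 0" using C0 by (auto simp: W_def intro!: mult_nonneg_nonneg sum_nonneg)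
  define D where "D = W * (real (2 * d + 2)) ^ (2 * k + 1) * C3"
  have D0: "D \<ge> 0" using W0 C3 by (auto simp: D_def)
  define P where "P = (\<Sum>i\<le>d. cmod (fps_nth p i))"
  have P0: "P \<ge> 0" by (auto simp: P_def intro!: sum_nonneg)
  define s where "s = sqrt (\<Sum>n. 1 / (real n + 1)\<^sup>2)"
  have s0: "s \<ge> 0" by (auto simp: s_def intro!: suminf_nonneg summable_inverse_squares)
  have s: "L2_set (\<lambda>n. 1 / (real n + 1)) {..<N} \<le> s" for N
    unfolding s_def L2_set_def power_divide power_one
    by (intro real_sqrt_le_mono sum_le_suminf summable_inverse_squares) auto

  \<comment> \<open>The index of \<open>u\<close> is the smaller one, so the gain in
    \<open>submult\<close> makes its weak norm sufficient. \<open>Q\<close> lets the statement cover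
    both kinds of cut-off.\<close>
  have half: "cmod (fps_nth (u * v) n) * \<omega> n
      \<le> C * (\<Sum>j\<le>n. cmod (fps_nth h j) * \<omega> j / (real j + 1) ^ k * (cmod (fps_nth v (n - j)) * \<omega> (n - j)))"
    if u: "\<And>j. fps_nth u j = (if 2 * j \<le> n \<and> Q j then fps_nth h j else 0)" for u v h n Q
  proof -
    have "cmod (fps_nth (u * v) n) * \<omega> n
        \<le> (\<Sum>j\<le>n. cmod (fps_nth u j) * cmod (fps_nth v (n - j))) * \<omega> n"
      by (intro mult_right_mono cmod_fps_mult_le) auto
    also have "\<dots> = (\<Sum>j\<le>n. cmod (fps_nth u j) * cmod (fps_nth v (n - j)) * \<omega> n)"
      by (rule sum_distrib_right)
    also have "\<dots> \<le> (\<Sum>j\<le>n. C * (cmod (fps_nth h j) * \<omega> j / (real j + 1) ^ k * (cmod (fps_nth v (n - j)) * \<omega> (n - j))))"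
    proof (rule sum_mono)
      fix j assume j: "j \<in> {..n}"
      show "cmod (fps_nth u j) * cmod (fps_nth v (n - j)) * \<omega> n
          \<le> C * (cmod (fps_nth h j) * \<omega> j / (real j + 1) ^ k * (cmod (fps_nth v (n - j)) * \<omega> (n - j)))"
      proof (cases "2 * j \<le> n \<and> Q j")
        case True
        then have "j \<le> n - j" "n - j + j = n" by auto
        then have "\<omega> n * (real j + 1) ^ k \<le> C * \<omega> (n - j) * \<omega> j" using C(2)[of j "n - j"] by simp
        then have "\<omega> n \<le> C * \<omega> (n - j) * \<omega> j / (real j + 1) ^ k" by (simp add: field_simps)
        then have "cmod (fps_nth h j) * cmod (fps_nth v (n - j)) * \<omega> n
            \<le> cmod (fps_nth h j) * cmod (fps_nth v (n - j)) * (C * \<omega> (n - j) * \<omega> j / (real j + 1) ^ k)"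
          by (intro mult_left_mono) auto
        then show ?thesis using True u[of j] by (simp add: mult_ac)
      next
        case False
        then have "fps_nth u j = 0" by (subst u) auto
        then show ?thesis using C(1) by simp
      qed
    qed
    finally show ?thesis by (simp add: sum_distrib_left)
  qed

  have middle: "cmod (fps_nth (p * (lower_half n h1 * strict_lower_half n h2)) n) * \<omega> n
      \<le> D * P * (a1 * a2) * (1 / (real n + 1))"
    if h: "low_le k h1 a1" "low_le k h2 a2" for h1 h2 a1 a2 n
  proof -
    define a c where "a = lower_half n h1" and "c = strict_lower_half n h2"
    define \<alpha> where "\<alpha> j = cmod (fps_nth h1 j) * \<omega> j / (real j + 1) ^ k" for j
    define \<beta> where "\<beta> j = cmod (fps_nth h2 j) * \<omega> j / (real j + 1) ^ k" for j
    \<comment> \<open>Only degrees within \<open>d\<close> of \<open>n\<close> are moved to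
      \<open>n\<close> by \<open>p\<close>.\<close>
    have ac: "cmod (fps_nth (a * c) m) * \<omega> n \<le> D * (a1 * a2) * (1 / (real n + 1))" if m: "m \<le> n" "n \<le> m + d" for m
    proof -
      have trm: "cmod (fps_nth a j) * cmod (fps_nth c l) * \<omega> n \<le> D * (1 / (real n + 1)) * (\<alpha> j * \<beta> l)"
        if jl: "j + l = m" for j l
      proof (cases "2 * j \<le> n \<and> 2 * l < n")
        case False
        then have "fps_nth a j = 0 \<or> fps_nth c l = 0" by (auto simp: a_def c_def lower_half_def strict_lower_half_def)
        moreover have "0 \<le> D * (1 / (real n + 1)) * (\<alpha> j * \<beta> l)" using D0 by (simp add: \<alpha>_def \<beta>_def)
        ultimately show ?thesis by auto
      next
        case True
        define q where "q = min j l"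
        \<comment> \<open>Both indices are at most \<open>n / 2\<close> and their sum is at least
          \<open>n - d\<close>, so each is at least \<open>n / 2 - d\<close>.\<close>
        have q: "n + 1 \<le> (2 * d + 2) * (q + 1)"
        proof -
          have "n \<le> 2 * d + 2 * q" using True jl m by (auto simp: q_def)
          then show ?thesis by (simp add: algebra_simps)
        qed
        have sub: "\<omega> m * (real q + 1) ^ (2 * k + 1) \<le> C3 * (\<omega> j * \<omega> l)"
          using C3(2)[of l j] C3(2)[of j l] jl
          by (cases "l \<le> j") (auto simp: q_def min_def add.commute mult_ac)
        have "\<omega> n * (real n + 1) ^ (2 * k + 1) \<le> (W * \<omega> m) * (real (2 * d + 2) * (real q + 1)) ^ (2 * k + 1)"
        proof (intro mult_mono power_mono)
          show "\<omega> n \<le> W * \<omega> m" using W[of "n - m" m] m by simp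
          have "real (n + 1) \<le> real ((2 * d + 2) * (q + 1))" using q by (rule of_nat_mono)
          then show "real n + 1 \<le> real (2 * d + 2) * (real q + 1)" by (simp add: algebra_simps)
        qed (use W0 in auto)
        also have "\<dots> = W * real (2 * d + 2) ^ (2 * k + 1) * (\<omega> m * (real q + 1) ^ (2 * k + 1))"
          unfolding power_mult_distrib by (simp only: mult_ac)
        also have "\<dots> \<le> W * real (2 * d + 2) ^ (2 * k + 1) * (C3 * (\<omega> j * \<omega> l))"
          using W0 by (intro mult_left_mono sub) auto
        finally have main: "\<omega> n * (real n + 1) ^ (2 * k + 1) \<le> D * (\<omega> j * \<omega> l)" by (simp add: D_def mult_ac)
        have "(\<omega> n * (real n + 1)) * ((real j + 1) ^ k * (real l + 1) ^ k)
            \<le> (\<omega> n * (real n + 1)) * ((real n + 1) ^ k * (real n + 1) ^ k)"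
          using jl m by (intro mult_left_mono mult_mono power_mono) auto
        also have "\<dots> = \<omega> n * (real n + 1) ^ (2 * k + 1)"
          unfolding mult_2 power_add by (simp only: power_one_right mult_ac)
        finally have "\<omega> n * (real n + 1) * ((real j + 1) ^ k * (real l + 1) ^ k) \<le> D * (\<omega> j * \<omega> l)"
          using main by linarith
        then have "\<omega> n \<le> D * (\<omega> j * \<omega> l) / ((real n + 1) * ((real j + 1) ^ k * (real l + 1) ^ k))"
          by (subst pos_le_divide_eq) (auto simp: mult_ac)
        then have "cmod (fps_nth h1 j) * cmod (fps_nth h2 l) * \<omega> n
            \<le> cmod (fps_nth h1 j) * cmod (fps_nth h2 l) * (D * (\<omega> j * \<omega> l) / ((real n + 1) * ((real j + 1) ^ k * (real l + 1) ^ k)))"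
          by (intro mult_left_mono) auto
        also have "\<dots> = D * (1 / (real n + 1)) * (\<alpha> j * \<beta> l)"
          by (simp add: \<alpha>_def \<beta>_def mult_ac)
        finally show ?thesis using True by (simp add: a_def c_def lower_half_def strict_lower_half_def)
      qed
      have "cmod (fps_nth (a * c) m) * \<omega> n \<le> (\<Sum>j\<le>m. cmod (fps_nth a j) * cmod (fps_nth c (m - j))) * \<omega> n"
        by (intro mult_right_mono cmod_fps_mult_le) auto
      also have "\<dots> = (\<Sum>j\<le>m. cmod (fps_nth a j) * cmod (fps_nth c (m - j)) * \<omega> n)" by (rule sum_distrib_right)
      also have "\<dots> \<le> (\<Sum>j\<le>m. D * (1 / (real n + 1)) * (\<alpha> j * \<beta> (m - j)))"
        by (intro sum_mono trm) auto
      also have "\<dots> = D * (1 / (real n + 1)) * (\<Sum>j\<le>m. \<alpha> j * \<beta> (m - j))" by (simp add: sum_distrib_left)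
      also have "\<dots> \<le> D * (1 / (real n + 1)) * (a1 * a2)"
      proof (rule mult_left_mono)
        have "(\<Sum>j\<le>m. \<alpha> j * \<beta> (m - j)) \<le> (\<Sum>n<Suc m. \<Sum>j\<le>n. \<alpha> j * \<beta> (n - j))"
          by (rule member_le_sum) (auto simp: \<alpha>_def \<beta>_def intro!: sum_nonneg)
        also have "\<dots> \<le> a1 * a2"
          using h by (intro convolution_l1_le) (auto simp: \<alpha>_def \<beta>_def low_le_def simp del: sum.lessThan_Suc)
        finally show "(\<Sum>j\<le>m. \<alpha> j * \<beta> (m - j)) \<le> a1 * a2" .
      qed (use D0 in auto)
      finally show ?thesis by (simp add: mult_ac)
    qed
    have nn: "0 \<le> D * (a1 * a2) * (1 / (real n + 1))"
      using D0 low_le_nonneg[OF h(1)] low_le_nonneg[OF h(2)] by simp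
    have "cmod (fps_nth (p * (a * c)) n) * \<omega> n \<le> (\<Sum>i\<le>n. cmod (fps_nth p i) * cmod (fps_nth (a * c) (n - i))) * \<omega> n"
      by (intro mult_right_mono cmod_fps_mult_le) auto
    also have "\<dots> = (\<Sum>i\<le>n. cmod (fps_nth p i) * (cmod (fps_nth (a * c) (n - i)) * \<omega> n))"
      by (simp add: sum_distrib_right mult.assoc)
    also have "\<dots> \<le> (\<Sum>i\<le>n. cmod (fps_nth p i) * (D * (a1 * a2) * (1 / (real n + 1))))"
    proof (rule sum_mono)
      fix i assume "i \<in> {..n}"
      then have "n - i \<le> n" "i \<le> d \<Longrightarrow> n \<le> n - i + d" by auto
      then show "cmod (fps_nth p i) * (cmod (fps_nth (a * c) (n - i)) * \<omega> n)
          \<le> cmod (fps_nth p i) * (D * (a1 * a2) * (1 / (real n + 1)))"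
        using ac[of "n - i"] p[of i] by (cases "i \<le> d") (auto simp del: times_divide_eq_right intro!: mult_left_mono)
    qed
    also have "\<dots> = (\<Sum>i\<le>n. cmod (fps_nth p i)) * (D * (a1 * a2) * (1 / (real n + 1)))"
      by (rule sum_distrib_right[symmetric])
    also have "\<dots> \<le> P * (D * (a1 * a2) * (1 / (real n + 1)))"
    proof (rule mult_right_mono[OF _ nn])
      have "(\<Sum>i\<le>n. cmod (fps_nth p i)) = (\<Sum>i\<in>{..n} \<inter> {..d}. cmod (fps_nth p i))"
        by (rule sum.mono_neutral_right) (use p in force)+
      also have "\<dots> \<le> P" unfolding P_def by (rule sum_mono2) auto
      finally show "(\<Sum>i\<le>n. cmod (fps_nth p i)) \<le> P" .
    qed
    finally show ?thesis by (simp add: a_def c_def mult_ac)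
  qed

  define K where "K = C + D * P * s"
  have "l2_le (p * (h1 * h2)) (K * (a1 * b2 + a2 * b1 + a1 * a2))"
    if h: "low_le k h1 a1" "low_le k h2 a2" "l2_le (p * h1) b1" "l2_le (p * h2) b2" for h1 h2 a1 a2 b1 b2
    unfolding l2_le_def
  proof
    fix N
    note nn = low_le_nonneg[OF h(1)] low_le_nonneg[OF h(2)] l2_le_nonneg[OF h(3)] l2_le_nonneg[OF h(4)]
    let ?A = "\<lambda>h n. cmod (fps_nth h n) * \<omega> n / (real n + 1) ^ k"
    let ?B = "\<lambda>h n. cmod (fps_nth h n) * \<omega> n"
    define X where "X n = (\<Sum>j\<le>n. ?A h1 j * ?B (p * h2) (n - j))" for n
    define Y where "Y n = (\<Sum>j\<le>n. ?A h2 j * ?B (p * h1) (n - j))" for n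
    define Z where "Z n = D * P * (a1 * a2) * (1 / (real n + 1))" for n
    have pw: "?B (p * (h1 * h2)) n \<le> C * X n + C * Y n + Z n" for n
    proof -
      have "cmod (fps_nth (p * (h1 * h2)) n) \<le> cmod (fps_nth (lower_half n h1 * (p * h2)) n)
          + cmod (fps_nth (strict_lower_half n h2 * (p * h1)) n)
          + cmod (fps_nth (p * (lower_half n h1 * strict_lower_half n h2)) n)"
        unfolding product_split[of p h1 h2 n]
        by (rule order_trans[OF norm_triangle_ineq4 add_right_mono[OF norm_triangle_ineq]])
      then have "?B (p * (h1 * h2)) n \<le> ?B (lower_half n h1 * (p * h2)) n
          + ?B (strict_lower_half n h2 * (p * h1)) n
          + ?B (p * (lower_half n h1 * strict_lower_half n h2)) n"
        using mult_right_mono[of _ _ "\<omega> n"] by (fastforce simp: distrib_right)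
      also have "\<dots> \<le> C * X n + C * Y n + Z n"
      proof (intro add_mono)
        show "?B (lower_half n h1 * (p * h2)) n \<le> C * X n"
          unfolding X_def by (rule half[where Q = "\<lambda>_. True"]) (simp add: lower_half_def)
        show "?B (strict_lower_half n h2 * (p * h1)) n \<le> C * Y n"
          unfolding Y_def by (rule half[where Q = "\<lambda>j. 2 * j < n"]) (simp add: strict_lower_half_def)
        show "?B (p * (lower_half n h1 * strict_lower_half n h2)) n \<le> Z n"
          unfolding Z_def by (rule middle[OF h(1,2)])
      qed
      finally show ?thesis .
    qed
    have "L2_set (?B (p * (h1 * h2))) {..<N} \<le> L2_set (\<lambda>n. (C * X n + C * Y n) + Z n) {..<N}"
      by (rule L2_set_mono) (use pw in auto)
    also have "\<dots> \<le> (L2_set (\<lambda>n. C * X n) {..<N} + L2_set (\<lambda>n. C * Y n) {..<N}) + L2_set Z {..<N}"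
      by (intro order_trans[OF L2_set_triangle_ineq] add_right_mono L2_set_triangle_ineq)
    also have "\<dots> \<le> (C * (a1 * b2) + C * (a2 * b1)) + D * P * (a1 * a2) * s"
    proof (intro add_mono)
      show "L2_set (\<lambda>n. C * X n) {..<N} \<le> C * (a1 * b2)"
      proof -
        have "L2_set X {..<N} \<le> a1 * b2"
          unfolding X_def by (rule convolution_l2_le) (use h in \<open>auto simp: low_le_def l2_le_def\<close>)
        then show ?thesis using C(1) by (subst L2_set_right_distrib[symmetric]) (auto intro!: mult_left_mono)
      qed
      show "L2_set (\<lambda>n. C * Y n) {..<N} \<le> C * (a2 * b1)"
      proof -
        have "L2_set Y {..<N} \<le> a2 * b1"
          unfolding Y_def by (rule convolution_l2_le) (use h in \<open>auto simp: low_le_def l2_le_def\<close>)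
        then show ?thesis using C(1) by (subst L2_set_right_distrib[symmetric]) (auto intro!: mult_left_mono)
      qed
      show "L2_set Z {..<N} \<le> D * P * (a1 * a2) * s"
        unfolding Z_def using D0 P0 nn
        by (subst L2_set_right_distrib[symmetric]) (auto intro!: mult_left_mono s)
    qed
    also have "\<dots> \<le> K * (a1 * b2 + a2 * b1 + a1 * a2)"
    proof -
      have "C * (a1 * b2) \<le> K * (a1 * b2)" "C * (a2 * b1) \<le> K * (a2 * b1)"
          "D * P * s * (a1 * a2) \<le> K * (a1 * a2)"
        using nn D0 P0 s0 C(1) by (auto simp: K_def intro!: mult_right_mono)
      then show ?thesis by (simp add: algebra_simps)
    qed
    finally show "L2_set (?B (p * (h1 * h2))) {..<N} \<le> K * (a1 * b2 + a2 * b1 + a1 * a2)" .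
  qed
  moreover have "K \<ge> 1" using C(1) D0 P0 s0 by (simp add: K_def add_increasing2)
  ultimately show ?thesis by blast
qed

end

section \<open>Wiener's lemma\<close>

text \<open>Cauchy's inequality on the circle of radius \<open>R\<close>. Raising the inverse to the
  power \<open>m\<close> does not worsen the rate \<open>R\<close>; only the constant grows, like
  \<open>\<beta> ^ m\<close>.\<close>

lemma inverse_poly_power_coeff_le:
  fixes P :: "complex poly"
  assumes "R > 0" "\<beta> > 0" and ge: "\<And>z. cmod z \<le> R \<Longrightarrow> cmod (poly P z) \<ge> 1 / \<beta>"
  shows "cmod (fps_nth (inverse (fps_of_poly P) ^ m) j) \<le> \<beta> ^ m / R ^ j"
proof -
  have nz: "poly P z \<noteq> 0" if "cmod z \<le> R" for z
    using ge[OF that] \<open>\<beta> > 0\<close> by auto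
  have "eval_fps (fps_of_poly P) has_fps_expansion fps_of_poly P"
    by (rule eval_fps_has_fps_expansion) simp
  moreover have "eval_fps (fps_of_poly P) = poly P" by (rule ext) simp
  ultimately have "poly P has_fps_expansion fps_of_poly P" by simp
  then have exp: "(\<lambda>z. inverse (poly P z) ^ m) has_fps_expansion inverse (fps_of_poly P) ^ m"
    using nz[of 0] \<open>R > 0\<close>
    by (intro has_fps_expansion_power has_fps_expansion_inverse) (auto simp: poly_0_coeff_0)
  have holo: "(\<lambda>z. inverse (poly P z) ^ m) holomorphic_on cball 0 R"
    by (intro holomorphic_intros) (use nz in auto)
  have "cmod ((deriv ^^ j) (\<lambda>z. inverse (poly P z) ^ m) 0) \<le> fact j * \<beta> ^ m / R ^ j"
  proof (rule Cauchy_inequality)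
    show "(\<lambda>z. inverse (poly P z) ^ m) holomorphic_on ball 0 R"
      by (rule holomorphic_on_subset[OF holo]) auto
    show "continuous_on (cball 0 R) (\<lambda>z. inverse (poly P z) ^ m)"
      by (rule holomorphic_on_imp_continuous_on[OF holo])
    fix z :: complex assume "cmod (0 - z) = R"
    then have "1 / cmod (poly P z) \<le> \<beta>"
      using ge[of z] nz[of z] \<open>\<beta> > 0\<close> by (simp add: field_simps)
    then show "cmod (inverse (poly P z) ^ m) \<le> \<beta> ^ m"
      unfolding norm_power by (intro power_mono) (auto simp: norm_inverse divide_inverse)
  qed (use \<open>R > 0\<close> in auto)
  then show ?thesis
    unfolding fps_nth_fps_expansion[OF exp] by (simp add: norm_divide field_simps)
qed

context rapid_weight
begin

text \<open>\<omega> grows more slowly than any exponential, so geometric decay with rate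
  \<open>R > 1\<close> beats it; multiplication by the polynomial \<open>p\<close> preserves the
  rate.\<close>

lemma geometric_bounds:
  assumes "R > 1" and p: "\<And>i. i > d \<Longrightarrow> fps_nth p i = 0"
  shows "\<exists>c>0. \<forall>h B. (\<forall>j. cmod (fps_nth h j) \<le> B / R ^ j) \<longrightarrow> low_le k h (B * c) \<and> l2_le (p * h) (B * c)"
proof -
  define \<rho> where "\<rho> = (1 + R) / 2"
  have \<rho>: "\<rho> > 1" "\<rho> < R" using assms(1) by (auto simp: \<rho>_def)
  obtain C where C: "C > 0" "\<And>n. \<omega> n \<le> C * \<rho> ^ n" using subexponential[OF \<rho>(1)] by blast
  define q where "q = \<rho> / R"
  have q: "0 < q" "q < 1" using \<rho> by (auto simp: q_def)
  define S where "S = C * (1 / (1 - q))"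
  have S0: "S > 0" using C q by (simp add: S_def)
  have sum: "(\<Sum>n<N. cmod (fps_nth h n) * \<omega> n) \<le> B * S"
    if h: "\<And>j. cmod (fps_nth h j) \<le> B / R ^ j" for h B N
  proof -
    have B: "B \<ge> 0" using order_trans[OF norm_ge_zero h[of 0]] by simp
    have "(\<Sum>n<N. cmod (fps_nth h n) * \<omega> n) \<le> (\<Sum>n<N. (B / R ^ n) * (C * \<rho> ^ n))"
      using B \<rho> by (intro sum_mono mult_mono h C) auto
    also have "\<dots> = B * (C * (\<Sum>n<N. q ^ n))"
      by (simp add: sum_distrib_left q_def power_divide mult_ac)
    also have "\<dots> \<le> B * (C * (1 / (1 - q)))"
    proof (intro mult_left_mono)
      have "(\<Sum>n<N. q ^ n) \<le> (\<Sum>n. q ^ n)" using q by (intro sum_le_suminf) auto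
      then show "(\<Sum>n<N. q ^ n) \<le> 1 / (1 - q)" using q by (simp add: suminf_geometric)
    qed (use B C in auto)
    finally show ?thesis by (simp add: S_def)
  qed
  define P where "P = (\<Sum>i\<le>d. cmod (fps_nth p i) * R ^ i)"
  have P0: "P \<ge> 0" using assms(1) by (auto simp: P_def intro!: sum_nonneg)
  have "low_le k h (B * (S * (P + 1))) \<and> l2_le (p * h) (B * (S * (P + 1)))"
    if h: "\<And>j. cmod (fps_nth h j) \<le> B / R ^ j" for h B
  proof
    have B: "B \<ge> 0" using order_trans[OF norm_ge_zero h[of 0]] by simp
    have le: "B * S \<le> B * (S * (P + 1))" "B * P * S \<le> B * (S * (P + 1))"
      using B S0 P0 by (auto simp: algebra_simps)
    show "low_le k h (B * (S * (P + 1)))"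
      unfolding low_le_def
    proof
      fix N
      have "(\<Sum>n<N. cmod (fps_nth h n) * \<omega> n / (real n + 1) ^ k) \<le> (\<Sum>n<N. cmod (fps_nth h n) * \<omega> n / 1)"
        by (intro sum_mono divide_left_mono) auto
      also have "\<dots> \<le> B * S" using sum[OF h, of N] by simp
      finally show "(\<Sum>n<N. cmod (fps_nth h n) * \<omega> n / (real n + 1) ^ k) \<le> B * (S * (P + 1))"
        using le by linarith
    qed
    have ph: "cmod (fps_nth (p * h) j) \<le> B * P / R ^ j" for j
    proof -
      have "cmod (fps_nth (p * h) j) \<le> (\<Sum>i\<le>j. cmod (fps_nth p i) * cmod (fps_nth h (j - i)))"
        by (rule cmod_fps_mult_le)
      also have "\<dots> \<le> (\<Sum>i\<le>j. cmod (fps_nth p i) * R ^ i * (B / R ^ j))"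
      proof (rule sum_mono)
        fix i assume "i \<in> {..j}"
        then have "R ^ j = R ^ i * R ^ (j - i)" by (simp flip: power_add)
        then have "B / R ^ (j - i) = R ^ i * (B / R ^ j)" using assms(1) by simp
        then show "cmod (fps_nth p i) * cmod (fps_nth h (j - i)) \<le> cmod (fps_nth p i) * R ^ i * (B / R ^ j)"
          using h[of "j - i"] unfolding mult.assoc by (intro mult_left_mono) auto
      qed
      also have "\<dots> = (\<Sum>i\<le>j. cmod (fps_nth p i) * R ^ i) * (B / R ^ j)"
        by (rule sum_distrib_right[symmetric])
      also have "\<dots> \<le> P * (B / R ^ j)"
      proof (rule mult_right_mono)
        have "(\<Sum>i\<le>j. cmod (fps_nth p i) * R ^ i) = (\<Sum>i\<in>{..j} \<inter> {..d}. cmod (fps_nth p i) * R ^ i)"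
          by (rule sum.mono_neutral_right) (use p in force)+
        also have "\<dots> \<le> P" unfolding P_def using assms(1) by (intro sum_mono2) auto
        finally show "(\<Sum>i\<le>j. cmod (fps_nth p i) * R ^ i) \<le> P" .
      qed (use B assms(1) in auto)
      finally show ?thesis by (simp add: mult_ac)
    qed
    show "l2_le (p * h) (B * (S * (P + 1)))"
      unfolding l2_le_def
    proof
      fix N
      have "L2_set (\<lambda>n. cmod (fps_nth (p * h) n) * \<omega> n) {..<N} \<le> (\<Sum>n<N. cmod (fps_nth (p * h) n) * \<omega> n)"
        by (rule L2_set_le_sum) auto
      also have "\<dots> \<le> B * P * S" by (rule sum[OF ph])
      finally show "L2_set (\<lambda>n. cmod (fps_nth (p * h) n) * \<omega> n) {..<N} \<le> B * (S * (P + 1))"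
        using le by linarith
    qed
  qed
  moreover have "S * (P + 1) > 0" using S0 P0 by simp
  ultimately show ?thesis by (intro exI[of _ "S * (P + 1)"]) blast
qed

text \<open>By \<open>rapid\<close>, even the weak norm dominates the sum of the moduli of the
  coefficients.\<close>

lemma low_le_eval:
  "\<exists>D>0. \<forall>h a z. low_le k h a \<longrightarrow> cmod z \<le> 1 \<longrightarrow>
    summable (\<lambda>n. fps_nth h n * z ^ n) \<and> cmod (eval_fps h z) \<le> D * a"
proof -
  obtain D where D: "D > 0" "\<And>n. (real n + 1) ^ k \<le> D * \<omega> n" using rapid[of k] by blast
  have "summable (\<lambda>n. fps_nth h n * z ^ n) \<and> cmod (eval_fps h z) \<le> D * a" if h: "low_le k h a" and z: "cmod z \<le> 1" for h a z
  proof -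
    let ?f = "\<lambda>n. cmod (fps_nth h n) * \<omega> n / (real n + 1) ^ k"
    have s: "summable ?f"
      by (rule summableI_nonneg_bounded[of _ a]) (use h in \<open>auto simp: low_le_def\<close>)
    have le: "cmod (fps_nth h n * z ^ n) \<le> D * ?f n" for n
    proof -
      have "cmod (fps_nth h n * z ^ n) \<le> cmod (fps_nth h n) * 1"
        unfolding norm_mult norm_power using z by (intro mult_left_mono power_le_one) auto
      also have "\<dots> \<le> cmod (fps_nth h n) * (D * \<omega> n / (real n + 1) ^ k)"
        using D(2)[of n] by (intro mult_left_mono) auto
      finally show ?thesis by (simp add: mult_ac)
    qed
    have sz: "summable (\<lambda>n. cmod (fps_nth h n * z ^ n))"
      by (rule summable_comparison_test[OF _ summable_mult[OF s, of D]]) (use le in auto)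
    have "cmod (eval_fps h z) \<le> (\<Sum>n. D * ?f n)"
      unfolding eval_fps_def
      by (rule order_trans[OF summable_norm[OF sz] suminf_le[OF le sz summable_mult[OF s]]])
    also have "\<dots> = D * (\<Sum>n. ?f n)" by (rule suminf_mult[OF s])
    also have "\<dots> \<le> D * a"
      using D(1) h by (intro mult_left_mono suminf_le_const s) (auto simp: low_le_def)
    finally show ?thesis using summable_norm_cancel[OF sz] by blast
  qed
  then show ?thesis using D(1) by blast
qed

text \<open>Newman's proof of Wiener's lemma: with a polynomial truncation \<open>P\<close> of \<open>g\<close> close to \<open>g\<close> in the
  weak norm, \<open>1 / g = \<Sum> (P - g)\<^sup>n / P\<^bsup>n + 1\<^esup>\<close>. Only the weak norm of \<open>P - g\<close> has to be small,
  since the strong norm of \<open>p (P - g)\<^sup>n\<close> grows at the rate of the weak one.\<close>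

theorem wiener_inverse:
  assumes p: "\<And>i. i > d \<Longrightarrow> fps_nth p i = 0"
    and low: "low_le k g a" and l2: "l2_le (p * g) b"
    and cont: "continuous_on (cball 0 1) (eval_fps g)"
    and nz: "\<And>z. cmod z \<le> 1 \<Longrightarrow> eval_fps g z \<noteq> 0"
  shows "\<exists>c. l2_le (p * inverse g) c"
proof -
  have "\<exists>x\<in>cball 0 1. \<forall>y\<in>cball 0 1. cmod (eval_fps g x) \<le> cmod (eval_fps g y)"
    by (rule continuous_attains_inf) (auto intro!: continuous_intros cont)
  then obtain x where x: "cmod x \<le> 1" "\<And>y. cmod y \<le> 1 \<Longrightarrow> cmod (eval_fps g x) \<le> cmod (eval_fps g y)"
    by auto
  define c0 where "c0 = cmod (eval_fps g x)"
  have c0: "c0 > 0" using nz[OF x(1)] by (simp add: c0_def)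
  \<comment> \<open>The truncation stays above \<open>c0 / 2\<close> on the disc, hence above
    \<open>c0 / 4\<close> on a slightly larger one; \<beta> is the resulting bound for its
    inverse.\<close>
  define \<beta> where "\<beta> = 4 / c0"
  have \<beta>: "\<beta> > 0" using c0 by (simp add: \<beta>_def)
  obtain K1 where K1: "K1 \<ge> 1" "\<And>h1 h2 a1 a2. low_le k h1 a1 \<Longrightarrow> low_le k h2 a2 \<Longrightarrow> low_le k (h1 * h2) (K1 * (a1 * a2))"
    using low_product[of k] by metis
  obtain K2 where K2: "K2 \<ge> 1" "\<And>h1 h2 a1 a2 b1 b2. low_le k h1 a1 \<Longrightarrow> low_le k h2 a2 \<Longrightarrow>
      l2_le (p * h1) b1 \<Longrightarrow> l2_le (p * h2) b2 \<Longrightarrow> l2_le (p * (h1 * h2)) (K2 * (a1 * b2 + a2 * b1 + a1 * a2))"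
    using tame_product[of d p k, OF p] by metis
  obtain D where D: "D > 0" "\<And>h a z. low_le k h a \<Longrightarrow> cmod z \<le> 1 \<Longrightarrow> cmod (eval_fps h z) \<le> D * a"
    and eval_summable: "\<And>h a z. low_le k h a \<Longrightarrow> cmod z \<le> 1 \<Longrightarrow> summable (\<lambda>n. fps_nth h n * z ^ n)"
    using low_le_eval[of k] by metis
  define K where "K = max K1 K2"
  have K: "K \<ge> 1" "K1 \<le> K" "K2 \<le> K" using K1(1) by (auto simp: K_def)
  \<comment> \<open>The first entry makes the ratio \<open>K * \<epsilon> * \<beta>\<close> of the
    series at most 1/4, the second keeps the truncation away from 0 on the disc.\<close>
  define \<epsilon> where "\<epsilon> = min (1 / (4 * K * \<beta>)) (c0 / (2 * D))"
  have \<epsilon>: "\<epsilon> > 0" "D * \<epsilon> \<le> c0 / 2" "K * \<epsilon> * \<beta> \<le> 1 / 4"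
  proof -
    show "\<epsilon> > 0" using K \<beta> c0 D(1) by (simp add: \<epsilon>_def)
    have "D * \<epsilon> \<le> D * (c0 / (2 * D))" using D(1) by (intro mult_left_mono) (auto simp: \<epsilon>_def)
    then show "D * \<epsilon> \<le> c0 / 2" using D(1) by simp
    have "(K * \<beta>) * \<epsilon> \<le> (K * \<beta>) * (1 / (4 * K * \<beta>))"
      using K \<beta> by (intro mult_left_mono) (auto simp: \<epsilon>_def)
    also have "\<dots> = 1 / 4" using K \<beta> by simp
    finally show "K * \<epsilon> * \<beta> \<le> 1 / 4" by (simp add: mult_ac)
  qed
  let ?f = "\<lambda>n. cmod (fps_nth g n) * \<omega> n / (real n + 1) ^ k"
  have "summable ?f"
    by (rule summableI_nonneg_bounded[of _ a]) (use low in \<open>auto simp: low_le_def\<close>)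
  then obtain N1 where N1: "\<And>m n. m \<ge> N1 \<Longrightarrow> norm (sum ?f {m..<n}) < \<epsilon>"
    using \<epsilon>(1) unfolding summable_Cauchy by blast
  \<comment> \<open>At least 1, so that \<open>r\<close> has no constant term and
    \<open>(r * Q) ^ N\<close> starts in degree \<open>N\<close>.\<close>
  define N0 where "N0 = Suc N1"
  define P where "P = (\<Sum>i<N0. monom (fps_nth g i) i)"
  have coeff_P: "coeff P n = (if n < N0 then fps_nth g n else 0)" for n
    unfolding P_def coeff_sum coeff_monom by (auto simp: sum.delta)
  define r where "r = fps_of_poly P - g"
  have r_nth: "fps_nth r n = (if n < N0 then 0 else - fps_nth g n)" for n
    by (simp add: r_def coeff_P)
  have r_low: "low_le k r \<epsilon>"
    unfolding low_le_def
  proof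
    fix N
    have "(\<Sum>n<N. cmod (fps_nth r n) * \<omega> n / (real n + 1) ^ k) = sum ?f {N0..<N}"
      by (rule sum.mono_neutral_cong_right) (auto simp: r_nth)
    also have "\<dots> \<le> \<epsilon>" using N1[of N0 N] by (simp add: N0_def)
    finally show "(\<Sum>n<N. cmod (fps_nth r n) * \<omega> n / (real n + 1) ^ k) \<le> \<epsilon>" .
  qed
  have P_ge: "cmod (poly P z) \<ge> c0 / 2" if "cmod z \<le> 1" for z
  proof -
    have "summable (\<lambda>n. fps_nth r n * z ^ n)" "summable (\<lambda>n. fps_nth g n * z ^ n)"
      using eval_summable[OF r_low that] eval_summable[OF low that] by auto
    then have "eval_fps (r + g) z = eval_fps r z + eval_fps g z"
      unfolding eval_fps_def by (simp add: suminf_add distrib_right)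
    then have "poly P z = eval_fps r z + eval_fps g z" by (simp add: r_def)
    moreover have "cmod (eval_fps r z) \<le> c0 / 2" using D(2)[OF r_low that] \<epsilon>(2) by linarith
    moreover have "cmod (eval_fps g z) \<ge> c0" using x(2)[OF that] by (simp add: c0_def)
    ultimately show ?thesis
      using norm_diff_ineq[of "eval_fps g z" "eval_fps r z"] by (simp add: add.commute)
  qed
  obtain R where R: "R > 1" "\<And>z. cmod z \<le> R \<Longrightarrow> cmod (poly P z) \<ge> 1 / \<beta>"
  proof -
    have "open {z. cmod (poly P z) > c0 / 4}"
      by (intro open_Collect_less continuous_intros)
    moreover have "cball 0 1 \<subseteq> {z. cmod (poly P z) > c0 / 4}"
    proof
      fix z :: complex assume "z \<in> cball 0 1"
      then have "cmod (poly P z) \<ge> c0 / 2" by (intro P_ge) simp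
      then show "z \<in> {z. cmod (poly P z) > c0 / 4}" using c0 by simp
    qed
    ultimately obtain e where e: "e > 0" "(\<Union>x\<in>cball 0 1. cball x e) \<subseteq> {z. cmod (poly P z) > c0 / 4}"
      using compact_subset_open_imp_cball_epsilon_subset[OF compact_cball] by metis
    show thesis
    proof (rule that[of "1 + e"])
      fix z :: complex assume z: "cmod z \<le> 1 + e"
      have "z \<in> (\<Union>x\<in>cball 0 1. cball x e)"
      proof (cases "cmod z \<le> 1")
        case True
        then show ?thesis using e(1) by (intro UN_I[of z]) auto
      next
        case False
        define y where "y = sgn z"
        have "z \<noteq> 0" using False by auto
        then have "z - y = of_real (cmod z - 1) * y" by (simp add: y_def sgn_eq field_simps)
        then have "cmod (z - y) = \<bar>cmod z - 1\<bar> * cmod y" by (simp only: norm_mult norm_of_real)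
        moreover have "cmod y = 1" using False by (auto simp: y_def norm_sgn)
        ultimately have "y \<in> cball 0 1" "z \<in> cball y e"
          using z False by (auto simp: dist_norm norm_minus_commute)
        then show ?thesis by blast
      qed
      then have "z \<in> {z. cmod (poly P z) > c0 / 4}" using e(2) by blast
      then show "cmod (poly P z) \<ge> 1 / \<beta>" by (simp add: \<beta>_def)
    qed (use e in auto)
  qed
  define Q where "Q = inverse (fps_of_poly P)"
  have P0: "fps_nth (fps_of_poly P) 0 \<noteq> 0"
    using P_ge[of 0] c0 by (auto simp: poly_0_coeff_0)
  have PQ: "fps_of_poly P * Q = 1" unfolding Q_def by (rule inverse_mult_eq_1'[OF P0])
  obtain c where c: "c > 0" "\<And>h B. (\<And>j. cmod (fps_nth h j) \<le> B / R ^ j) \<Longrightarrow> low_le k h (B * c) \<and> l2_le (p * h) (B * c)"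
    using geometric_bounds[OF R(1) p, where k = k] by metis
  have Q: "low_le k (Q ^ m) (\<beta> ^ m * c)" "l2_le (p * Q ^ m) (\<beta> ^ m * c)" for m
    using c(2)[of "Q ^ m" "\<beta> ^ m"] inverse_poly_power_coeff_le[of R \<beta> P] R \<beta> by (auto simp: Q_def)
  have one: "low_le k 1 c" "l2_le (p * 1) c" using Q[of 0] by auto
  obtain b' where b': "l2_le (p * r) b'"
  proof -
    define B where "B = (\<Sum>i<N0. cmod (fps_nth g i) * R ^ i)"
    have B0: "B \<ge> 0" using R by (auto simp: B_def intro!: sum_nonneg)
    have "cmod (fps_nth (fps_of_poly P) j) \<le> B / R ^ j" for j
    proof (cases "j < N0")
      case True
      have "cmod (fps_nth g j) * R ^ j \<le> B"
        unfolding B_def using True R by (intro member_le_sum) auto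
      then show ?thesis using True R by (simp add: coeff_P field_simps)
    qed (use B0 R in \<open>simp add: coeff_P\<close>)
    then have "l2_le (p * fps_of_poly P) (B * c)" using c(2) by blast
    moreover have "l2_le (p * (- g)) b" using l2 by (simp add: l2_le_def)
    ultimately have "l2_le (p * fps_of_poly P + p * (- g)) (B * c + b)" by (rule l2_le_add)
    then show thesis by (intro that) (simp add: r_def algebra_simps)
  qed
  have b'0: "b' \<ge> 0" by (rule l2_le_nonneg[OF b'])
  define \<gamma> where "\<gamma> = K * \<epsilon>"
  have \<gamma>: "\<gamma> > 0" using K \<epsilon> by (simp add: \<gamma>_def)
  have low_mono: "low_le k h u \<Longrightarrow> u \<le> v \<Longrightarrow> low_le k h v" for h u v
    unfolding low_le_def by (meson order_trans)
  have l2_mono: "l2_le h u \<Longrightarrow> u \<le> v \<Longrightarrow> l2_le h v" for h u v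
    unfolding l2_le_def by (meson order_trans)
  have r_pow_low: "low_le k (r ^ n) (c * \<gamma> ^ n)" for n
  proof (induction n)
    case (Suc n)
    have "low_le k (r * r ^ n) (K1 * (\<epsilon> * (c * \<gamma> ^ n)))" by (rule K1(2)[OF r_low Suc])
    moreover have "K1 * (\<epsilon> * (c * \<gamma> ^ n)) \<le> K * (\<epsilon> * (c * \<gamma> ^ n))"
      using K \<epsilon> c \<gamma> by (intro mult_right_mono) auto
    ultimately show ?case by (auto intro: low_mono simp: \<gamma>_def mult_ac)
  qed (use one in simp)
  \<comment> \<open>Chosen so that the inhomogeneous part of the recursion below equals
    \<open>B0 * \<epsilon> * \<gamma> ^ n\<close>, which raises \<open>n + 1\<close> to
    \<open>n + 2\<close> exactly.\<close>
  define B0 where "B0 = c + c * b' / \<epsilon>"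
  have B0: "B0 \<ge> c" "c * b' + c * \<epsilon> = B0 * \<epsilon>" using c \<epsilon> b'0 by (auto simp: B0_def field_simps)
  \<comment> \<open>Each new factor multiplies the strong norm of the power by the weak norm
    \<epsilon> of \<open>r\<close>, up to \<open>K\<close>; the strong norm \<open>b'\<close>, which
    need not be small, meets only the weak norm of the power. Hence the linear prefactor.\<close>
  have r_pow_l2: "l2_le (p * r ^ n) (B0 * (real n + 1) * \<gamma> ^ n)" for n
  proof (induction n)
    case 0
    show ?case using one B0 by (auto intro: l2_mono)
  next
    case (Suc n)
    let ?E = "\<epsilon> * (B0 * (real n + 1) * \<gamma> ^ n) + c * \<gamma> ^ n * b' + \<epsilon> * (c * \<gamma> ^ n)"
    have "l2_le (p * (r * r ^ n)) (K2 * ?E)" by (rule K2(2)[OF r_low r_pow_low b' Suc])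
    moreover have "K2 * ?E \<le> K * ?E"
      using K \<epsilon> c \<gamma> b'0 B0 by (intro mult_right_mono) auto
    moreover have "K * ?E = B0 * (real (Suc n) + 1) * \<gamma> ^ Suc n"
    proof -
      have "?E = \<gamma> ^ n * (\<epsilon> * B0 * (real n + 1) + (c * b' + c * \<epsilon>))" by (simp add: algebra_simps)
      also have "\<dots> = \<gamma> ^ n * \<epsilon> * B0 * (real (Suc n) + 1)" unfolding B0(2) by (simp add: algebra_simps)
      finally show ?thesis by (simp add: \<gamma>_def mult_ac)
    qed
    ultimately show ?case by (auto intro: l2_mono)
  qed
  define G where "G = K * c * \<beta> * (2 * c + B0)"
  have G0: "G \<ge> 0" using K c \<beta> B0 by (simp add: G_def)
  have T: "l2_le (p * (r ^ n * Q ^ Suc n)) (G * (1 / 2) ^ n)" for n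
  proof -
    let ?E = "c * \<gamma> ^ n * (\<beta> ^ Suc n * c) + \<beta> ^ Suc n * c * (B0 * (real n + 1) * \<gamma> ^ n) + c * \<gamma> ^ n * (\<beta> ^ Suc n * c)"
    \<comment> \<open>Spends half of the ratio 1/4 on the linear prefactor, leaving 1/2.\<close>
    have n2: "real n + 1 \<le> 2 ^ n" using less_exp[of n] by (metis Suc_leI add.commute of_nat_Suc of_nat_le_iff of_nat_numeral of_nat_power)
    have "l2_le (p * (r ^ n * Q ^ Suc n)) (K2 * ?E)"
      by (rule K2(2)[OF r_pow_low Q(1) r_pow_l2 Q(2)])
    moreover have "K2 * ?E \<le> G * (1 / 2) ^ n"
    proof -
      have "?E = (\<gamma> * \<beta>) ^ n * (c * \<beta> * (2 * c + B0 * (real n + 1)))"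
        by (simp add: algebra_simps power_mult_distrib)
      also have "\<dots> \<le> (1 / 4) ^ n * (c * \<beta> * ((2 * c + B0) * 2 ^ n))"
      proof (intro mult_mono power_mono mult_left_mono)
        show "\<gamma> * \<beta> \<le> 1 / 4" using \<epsilon>(3) by (simp add: \<gamma>_def)
        have "2 * c * 1 \<le> 2 * c * 2 ^ n" using c by (intro mult_left_mono) auto
        moreover have "B0 * (real n + 1) \<le> B0 * 2 ^ n" using B0 c n2 by (intro mult_left_mono) auto
        ultimately show "2 * c + B0 * (real n + 1) \<le> (2 * c + B0) * 2 ^ n" by (simp add: algebra_simps)
      qed (use c \<beta> B0 \<gamma> in auto)
      also have "\<dots> = c * \<beta> * (2 * c + B0) * (1 / 2) ^ n"
      proof -
        have "(4 :: real) ^ n = 2 ^ n * 2 ^ n" by (simp flip: power_mult_distrib)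
        then show ?thesis by (simp add: power_divide)
      qed
      finally have "K2 * ?E \<le> K * (c * \<beta> * (2 * c + B0) * (1 / 2) ^ n)"
        using K K2(1) c \<gamma> \<beta> B0 by (intro mult_mono) auto
      then show ?thesis by (simp add: G_def mult_ac)
    qed
    ultimately show ?thesis by (rule l2_mono)
  qed
  define S where "S N = (\<Sum>n<N. r ^ n * Q ^ Suc n)" for N
  have S: "l2_le (p * S N) (2 * G)" for N
  proof -
    have "l2_le (\<Sum>n<N. p * (r ^ n * Q ^ Suc n)) (\<Sum>n<N. G * (1 / 2) ^ n)"
      by (rule l2_le_sum) (rule T)
    moreover have "(\<Sum>n<N. G * (1 / 2) ^ n) \<le> 2 * G"
    proof -
      have "(\<Sum>n<N. (1 / 2 :: real) ^ n) \<le> (\<Sum>n. (1 / 2) ^ n)" by (intro sum_le_suminf) auto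
      then have "(\<Sum>n<N. (1 / 2 :: real) ^ n) \<le> 2" by (simp add: suminf_geometric)
      then show ?thesis using mult_left_mono[OF _ G0] by (fastforce simp flip: sum_distrib_left)
    qed
    ultimately show ?thesis unfolding S_def sum_distrib_left by (rule l2_mono)
  qed
  \<comment> \<open>From \<open>g = P - r\<close> one gets \<open>Q * g = 1 - r * Q\<close>, so the
    sum is a geometric one.\<close>
  have telescope: "S N * g = 1 - (r * Q) ^ N" for N
  proof (induction N)
    case (Suc N)
    have "Q * g = 1 - r * Q" using PQ by (simp add: r_def algebra_simps)
    moreover have "r ^ N * Q ^ Suc N * g = (r * Q) ^ N * (Q * g)"
      by (simp add: power_mult_distrib mult_ac)
    moreover have "S (Suc N) * g = S N * g + r ^ N * Q ^ Suc N * g"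
      by (simp add: S_def distrib_right)
    ultimately have "S (Suc N) * g = 1 - (r * Q) ^ N + (r * Q) ^ N * (1 - r * Q)"
      by (simp only: Suc.IH)
    also have "\<dots> = 1 - (r * Q) ^ Suc N"
      by (simp only: right_diff_distrib mult_1_right power_Suc2) simp
    finally show ?case .
  qed (simp add: S_def)
  have g0: "fps_nth g 0 \<noteq> 0" using nz[of 0] by (simp add: eval_fps_at_0)
  \<comment> \<open>Convergence of the series is purely formal: its partial sums already have the
    correct first \<open>N\<close> coefficients.\<close>
  have S_nth: "fps_nth (S N) n = fps_nth (inverse g) n" if "n < N" for n N
  proof -
    have "S N = S N * g * inverse g" using inverse_mult_eq_1'[OF g0] by (simp add: mult.assoc)
    also have "\<dots> = inverse g - inverse g * (r * Q) ^ N" unfolding telescope by (simp add: algebra_simps)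
    finally have "fps_nth (S N) n = fps_nth (inverse g) n - fps_nth (inverse g * (r * Q) ^ N) n" by simp
    moreover have "fps_nth (inverse g * (r * Q) ^ N) n = 0"
    proof -
      have "fps_nth (r * Q) 0 = 0" by (simp add: r_nth N0_def)
      then have "\<forall>m<N. fps_nth ((r * Q) ^ N) m = 0" by (rule startsby_zero_power_prefix)
      then show ?thesis unfolding fps_mult_nth using that by (intro sum.neutral) auto
    qed
    ultimately show ?thesis by simp
  qed
  have "l2_le (p * inverse g) (2 * G)"
    unfolding l2_le_def
  proof
    fix N
    have "fps_nth (p * inverse g) n = fps_nth (p * S N) n" if "n < N" for n
      unfolding fps_mult_nth using that S_nth[of _ N] by (intro sum.cong) auto
    then have "L2_set (\<lambda>n. cmod (fps_nth (p * inverse g) n) * \<omega> n) {..<N}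
        = L2_set (\<lambda>n. cmod (fps_nth (p * S N) n) * \<omega> n) {..<N}"
      by (intro L2_set_cong) auto
    also have "\<dots> \<le> 2 * G" using S[of N] by (simp add: l2_le_def)
    finally show "L2_set (\<lambda>n. cmod (fps_nth (p * inverse g) n) * \<omega> n) {..<N} \<le> 2 * G" .
  qed
  then show ?thesis by blast
qed

end

section \<open>Invariant subspaces\<close>

lemma norm_cscale: "norm (cscale c x) = cmod c * norm x"
  by (simp add: norm_ell2_def cscale.rep_eq norm_mult power_mult_distrib
      suminf_mult[OF summable_coord] real_sqrt_mult)

lemma coord_add [simp]: "coord (x + y) n = coord x n + coord y n"
  by (simp add: plus_ell2.rep_eq)

lemma coord_uminus [simp]: "coord (- x) n = - coord x n"
  by (simp add: uminus_ell2.rep_eq)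

lemma coord_diff [simp]: "coord (x - y) n = coord x n - coord y n"
  by (subst minus_ell2_def) (simp del: add_uminus_conv_diff)

lemma coord_zero [simp]: "coord 0 n = 0"
  by (simp add: zero_ell2.rep_eq)

lemma coord_cscale [simp]: "coord (cscale c x) n = c * coord x n"
  by (simp add: cscale.rep_eq)

lemma coord_basis_vec [simp]: "coord (basis_vec n) m = (if m = n then 1 else 0)"
  by (simp add: basis_vec.rep_eq)

lemma coord_sum: "coord (sum f A) n = (\<Sum>i\<in>A. coord (f i) n)"
  by (induction A rule: infinite_finite_induct) auto

lemma tendsto_cscale:
  assumes "k \<longlonglongrightarrow> l"
  shows "(\<lambda>n. cscale (k n) v) \<longlonglongrightarrow> cscale l v"
proof -
  have "(\<lambda>n. cmod (k n - l) * norm v) \<longlonglongrightarrow> 0"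
    using tendsto_mult_left_zero[OF tendsto_norm_zero[OF LIM_zero[OF assms]]] by simp
  moreover have "cmod (k n - l) * norm v = norm (cscale (k n) v - cscale l v)" for n
    by (simp add: ell2.scale_left_diff_distrib flip: norm_cscale)
  ultimately show ?thesis
    using LIM_zero_cancel tendsto_norm_zero_cancel by fastforce
qed

text \<open>For \<open>v\<close> outside \<open>S\<close>, its positive distance to \<open>S\<close>
  bounds the coefficient along \<open>v\<close> by the norm of the vector. Coefficients of a
  convergent sequence are therefore bounded, and a convergent subsequence of them identifies the
  limit.\<close>

lemma closed_add_line:
  assumes cl: "closed S" and sub: "ell2.subspace S"
  shows "closed {x. \<exists>k. x - cscale k v \<in> S}"
proof (cases "v \<in> S")
  case True
  have "{x. \<exists>k. x - cscale k v \<in> S} = S"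
  proof safe
    fix x k assume "x - cscale k v \<in> S"
    then have "(x - cscale k v) + cscale k v \<in> S"
      using True sub by (intro ell2.subspace_add ell2.subspace_scale) auto
    then show "x \<in> S" by simp
  qed (auto intro!: exI[of _ 0])
  then show ?thesis using cl by simp
next
  case False
  have S: "S \<noteq> {}" using ell2.subspace_0[OF sub] by auto
  define d where "d = infdist v S"
  have d: "d > 0" unfolding d_def by (rule infdist_pos_not_in_closed[OF cl S False])
  have le: "cmod k * d \<le> norm x" if "x - cscale k v \<in> S" for x k
  proof (cases "k = 0")
    case False
    have "cscale (- (1 / k)) (x - cscale k v) \<in> S" by (rule ell2.subspace_scale[OF sub that])
    moreover have "cscale (- (1 / k)) (x - cscale k v) = v - cscale (1 / k) x"
      by (rule ell2_eqI) (use False in \<open>simp add: field_simps\<close>)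
    ultimately have "d \<le> dist v (v - cscale (1 / k) x)" unfolding d_def by (metis infdist_le)
    also have "\<dots> = norm x / cmod k" by (simp add: dist_norm norm_cscale norm_divide)
    finally show ?thesis using False by (simp add: field_simps)
  qed simp
  show ?thesis
    unfolding closed_sequential_limits
  proof (intro allI impI)
    fix x l assume "(\<forall>n. x n \<in> {x. \<exists>k. x - cscale k v \<in> S}) \<and> x \<longlonglongrightarrow> l"
    then have x: "\<And>n. \<exists>k. x n - cscale k v \<in> S" "x \<longlonglongrightarrow> l" by auto
    then obtain k where k: "\<And>n. x n - cscale (k n) v \<in> S" by metis
    obtain B where B: "\<And>n. norm (x n) \<le> B"
      using convergent_imp_bounded[OF x(2)] unfolding bounded_iff by auto
    have "k n \<in> cball 0 (B / d)" for n
      using order_trans[OF le[OF k] B] d by (simp add: field_simps)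
    then obtain c r where r: "strict_mono (r :: nat \<Rightarrow> nat)" "(k \<circ> r) \<longlonglongrightarrow> c"
      using compact_cball[of "0::complex" "B / d"] unfolding compact_def by blast
    have "(\<lambda>n. x (r n) - cscale (k (r n)) v) \<longlonglongrightarrow> l - cscale c v"
      using LIMSEQ_subseq_LIMSEQ[OF x(2) r(1)] tendsto_cscale[OF r(2)]
      by (intro tendsto_diff) (auto simp: o_def)
    then have "l - cscale c v \<in> S"
      by (rule closed_sequentially[OF cl, rotated]) (rule k)
    then show "l \<in> {x. \<exists>k. x - cscale k v \<in> S}" by auto
  qed
qed

lemma closed_span_Un_finite:
  assumes "finite B" "closed M" "ell2.subspace M"
  shows "closed (ell2.span (M \<union> B))"
  using assms(1)
proof (induction B rule: finite_induct)
  case empty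
  then show ?case using assms by (simp add: ell2.span_eq_iff[THEN iffD2])
next
  case (insert v B)
  then show ?case
    using closed_add_line[OF insert.IH, of v] by (simp add: ell2.span_insert)
qed

lemma truncation_tendsto: "(\<lambda>N. \<Sum>i<N. cscale (coord x i) (basis_vec i)) \<longlonglongrightarrow> x"
proof (rule LIM_zero_cancel, rule tendsto_norm_zero_cancel)
  let ?f = "\<lambda>n. (cmod (coord x n))\<^sup>2"
  have "norm ((\<Sum>i<N. cscale (coord x i) (basis_vec i)) - x) = sqrt ((\<Sum>n. ?f n) - (\<Sum>n<N. ?f n))" for N
  proof -
    have "(cmod (coord ((\<Sum>i<N. cscale (coord x i) (basis_vec i)) - x) n))\<^sup>2 = ?f n - (if n < N then ?f n else 0)" for n
      by (auto simp: coord_sum if_distrib sum.delta cong: if_cong)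
    moreover have "(\<lambda>n. if n < N then ?f n else 0) sums (\<Sum>n<N. ?f n)"
      using sums_If_finite_set[of "{..<N}" ?f] by simp
    ultimately have "(\<lambda>n. (cmod (coord ((\<Sum>i<N. cscale (coord x i) (basis_vec i)) - x) n))\<^sup>2)
        sums ((\<Sum>n. ?f n) - (\<Sum>n<N. ?f n))"
      using sums_diff[OF summable_sums[OF summable_coord[of x]]] by simp
    then show ?thesis unfolding norm_ell2_def by (simp add: sums_iff)
  qed
  moreover have "(\<lambda>N. sqrt ((\<Sum>n. ?f n) - (\<Sum>n<N. ?f n))) \<longlonglongrightarrow> sqrt ((\<Sum>n. ?f n) - (\<Sum>n. ?f n))"
    by (intro tendsto_intros summable_LIMSEQ summable_coord)
  ultimately show "(\<lambda>N. norm ((\<Sum>i<N. cscale (coord x i) (basis_vec i)) - x)) \<longlonglongrightarrow> 0" by simp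
qed

section \<open>The correspondence between vectors and power series\<close>

context rapid_weight
begin

definition represents :: "complex fps \<Rightarrow> ell2 \<Rightarrow> bool" where
  "represents h x \<longleftrightarrow> (\<forall>n. coord x n = fps_nth h n * of_real (\<omega> n))"

lemma ratio_bound: obtains C where "\<And>n. \<bar>\<omega> (Suc n) / \<omega> n\<bar> \<le> C"
  using shift_bound[of 1] by (auto simp: field_simps)

lemma represents_add: "represents g x \<Longrightarrow> represents h y \<Longrightarrow> represents (g + h) (x + y)"
  by (simp add: represents_def algebra_simps)

lemma represents_diff: "represents g x \<Longrightarrow> represents h y \<Longrightarrow> represents (g - h) (x - y)"
  by (simp add: represents_def algebra_simps)

lemma represents_cscale: "represents h x \<Longrightarrow> represents (fps_const c * h) (cscale c x)"
  by (simp add: represents_def)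

lemma represents_shift:
  assumes "represents h x"
  shows "represents (fps_X * h) (weighted_shift \<omega> x)"
proof -
  obtain C where C: "\<And>n. \<bar>\<omega> (Suc n) / \<omega> n\<bar> \<le> C" using ratio_bound by blast
  show ?thesis
    using assms unfolding represents_def
    by (auto simp: coord_weighted_shift[of \<omega> C, OF C] shift_coord_def split: nat.split)
qed

lemma represents_l2_le:
  assumes "represents h x"
  shows "l2_le h (norm x)"
proof -
  have "cmod (fps_nth h n) * \<omega> n = cmod (coord x n)" for n
    using assms by (simp add: represents_def norm_mult)
  then show ?thesis
    unfolding l2_le_def L2_set_def norm_ell2_def
    by (auto intro!: sum_le_suminf summable_coord)
qed

lemma l2_le_represents:
  assumes "l2_le h b"
  shows "\<exists>x. represents h x \<and> norm x \<le> b"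
proof -
  let ?f = "\<lambda>n. fps_nth h n * of_real (\<omega> n)"
  have sum: "(\<Sum>n<N. (cmod (?f n))\<^sup>2) \<le> b\<^sup>2" for N
    using assms unfolding l2_le_def L2_set_def by (auto simp: norm_mult intro: sqrt_le_D)
  have s: "summable (\<lambda>n. (cmod (?f n))\<^sup>2)"
    by (rule summableI_nonneg_bounded[OF _ sum]) simp
  have c: "coord (Abs_ell2 ?f) = ?f" using s by (simp add: Abs_ell2_inverse)
  have "norm (Abs_ell2 ?f) \<le> b"
    unfolding norm_ell2_def c
    using suminf_le_const[OF s sum] l2_le_nonneg[OF assms] by (intro real_le_lsqrt) auto
  then show ?thesis using c by (auto simp: represents_def intro!: exI[of _ "Abs_ell2 ?f"])
qed

text \<open>Cauchy-Schwarz against the square-summable \<open>1 / (n + 1)\<close>.\<close>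

lemma l2_le_low_le: "\<exists>s\<ge>0. \<forall>h b. l2_le h b \<longrightarrow> low_le 1 h (s * b)"
proof -
  define s where "s = sqrt (\<Sum>n. 1 / (real n + 1)\<^sup>2)"
  have s0: "s \<ge> 0" by (auto simp: s_def intro!: suminf_nonneg summable_inverse_squares)
  have s: "L2_set (\<lambda>n. 1 / (real n + 1)) {..<N} \<le> s" for N
    unfolding s_def L2_set_def power_divide power_one
    by (intro real_sqrt_le_mono sum_le_suminf summable_inverse_squares) auto
  have "low_le 1 h (s * b)" if h: "l2_le h b" for h b
    unfolding low_le_def
  proof
    fix N
    have "(\<Sum>n<N. \<bar>1 / (real n + 1)\<bar> * \<bar>cmod (fps_nth h n) * \<omega> n\<bar>)
        \<le> L2_set (\<lambda>n. 1 / (real n + 1)) {..<N} * L2_set (\<lambda>n. cmod (fps_nth h n) * \<omega> n) {..<N}"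
      by (rule L2_set_mult_ineq)
    also have "\<dots> \<le> s * b"
      using h s s0 by (intro mult_mono) (auto simp: l2_le_def)
    finally show "(\<Sum>n<N. cmod (fps_nth h n) * \<omega> n / (real n + 1) ^ 1) \<le> s * b"
      by (simp add: abs_mult)
  qed
  then show ?thesis using s0 by blast
qed

text \<open>The algebra property of the strong norm: \<open>tame_product\<close> with the polynomial
  1 and \<open>k = 1\<close>, where the weak norm is controlled by the strong one.\<close>

lemma l2_le_mult:
  "\<exists>K\<ge>0. \<forall>g h a b. l2_le g a \<longrightarrow> l2_le h b \<longrightarrow> l2_le (g * h) (K * a * b)"
proof -
  obtain s where s: "s \<ge> 0" "\<And>h b. l2_le h b \<Longrightarrow> low_le 1 h (s * b)"
    using l2_le_low_le by blast
  have one: "fps_nth (1 :: complex fps) i = 0" if "i > 0" for i using that by simp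
  obtain K where K: "K \<ge> 1" "\<And>h1 h2 a1 a2 b1 b2. low_le 1 h1 a1 \<Longrightarrow> low_le 1 h2 a2 \<Longrightarrow> l2_le h1 b1 \<Longrightarrow>
      l2_le h2 b2 \<Longrightarrow> l2_le (h1 * h2) (K * (a1 * b2 + a2 * b1 + a1 * a2))"
    using tame_product[of 0 1 1, OF one] unfolding mult_1_left by metis
  have "l2_le (g * h) (K * (2 * s + s * s) * a * b)" if "l2_le g a" "l2_le h b" for g h a b
    using K(2)[OF s(2)[OF that(1)] s(2)[OF that(2)] that] by (simp add: algebra_simps)
  moreover have "K * (2 * s + s * s) \<ge> 0" using K(1) s(1) by simp
  ultimately show ?thesis by blast
qed

end

section \<open>Polynomials in invariant subspaces and finite codimension\<close>

context quasianalytic_weight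
begin

lemma invariant_contains_poly:
  assumes sub: "ell2.subspace M" and cl: "closed M" and inv: "weighted_shift \<omega> ` M \<subseteq> M" and ne: "M \<noteq> {0}"
  obtains q x where "q \<noteq> 0" "x \<in> M" "represents (fps_of_poly q) x"
proof -
  obtain x where x: "x \<in> M" "x \<noteq> 0" using ne ell2.subspace_0[OF sub] by auto
  define F where "F = Abs_fps (\<lambda>n. coord x n / of_real (\<omega> n))"
  have rF: "represents F x" by (simp add: represents_def F_def)
  have lF: "l2_le F (norm x)" by (rule represents_l2_le[OF rF])
  have "F \<noteq> 0" using x(2) rF by (auto simp: represents_def intro: ell2_eqI)
  moreover have "tempered F"
  proof (rule temperedI[of _ _ 0])
    fix n
    have "cmod (fps_nth F n) * \<omega> n \<le> L2_set (\<lambda>n. cmod (fps_nth F n) * \<omega> n) {..<Suc n}"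
      by (rule member_le_L2_set) auto
    also have "\<dots> \<le> norm x" using lF unfolding l2_le_def by blast
    finally show "cmod (fps_nth F n) * \<omega> n \<le> norm x * (real n + 1) ^ 0" by simp
  qed
  ultimately obtain p g where p: "p \<noteq> 0" and g: "tempered g" "F = fps_of_poly p * g"
    and nz: "\<And>z. cmod z \<le> 1 \<Longrightarrow> eval_fps g z \<noteq> 0"
    using factorization[of F] by auto
  obtain C K where C: "C > 0" "\<And>n. cmod (fps_nth g n) * \<omega> n \<le> C * (real n + 1) ^ K"
    using temperedE[OF g(1)] by metis
  \<comment> \<open>Two powers beyond the tempered exponent turn the pointwise bound into a summable
    one.\<close>
  have low: "low_le (K + 2) g (\<Sum>n. C * (1 / (real n + 1)\<^sup>2))"
    unfolding low_le_def
  proof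
    fix N
    have "cmod (fps_nth g n) * \<omega> n / (real n + 1) ^ (K + 2) \<le> C * (1 / (real n + 1)\<^sup>2)" for n
    proof -
      have "cmod (fps_nth g n) * \<omega> n / (real n + 1) ^ (K + 2) \<le> C * (real n + 1) ^ K / (real n + 1) ^ (K + 2)"
        by (intro divide_right_mono C) auto
      also have "\<dots> = C * (1 / (real n + 1)\<^sup>2)" by (simp add: power_add power2_eq_square)
      finally show ?thesis .
    qed
    then have "(\<Sum>n<N. cmod (fps_nth g n) * \<omega> n / (real n + 1) ^ (K + 2)) \<le> (\<Sum>n<N. C * (1 / (real n + 1)\<^sup>2))"
      by (intro sum_mono)
    also have "\<dots> \<le> (\<Sum>n. C * (1 / (real n + 1)\<^sup>2))"
      using C(1) by (intro sum_le_suminf summable_mult summable_inverse_squares) auto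
    finally show "(\<Sum>n<N. cmod (fps_nth g n) * \<omega> n / (real n + 1) ^ (K + 2)) \<le> (\<Sum>n. C * (1 / (real n + 1)\<^sup>2))" .
  qed
  define H where "H = fps_of_poly p * inverse g"
  obtain c where c: "l2_le H c"
    using wiener_inverse[of "degree p" "fps_of_poly p", OF _ low lF[unfolded g(2)] continuous_on_eval[OF g(1)] nz]
    unfolding H_def by (auto simp: coeff_eq_0)
  have "fps_nth g 0 \<noteq> 0" using nz[of 0] by (simp add: eval_fps_at_0)
  then have FH: "F * H = fps_of_poly (p * p)"
    unfolding g(2) H_def fps_of_poly_mult
    by (metis (no_types, lifting) inverse_mult_eq_1' mult.assoc mult.left_commute mult_1_right)
  obtain L where L: "L \<ge> 0" "\<And>g h a b. l2_le g a \<Longrightarrow> l2_le h b \<Longrightarrow> l2_le (g * h) (L * a * b)"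
    using l2_le_mult by metis
  obtain z where z: "represents (F * H) z"
    using l2_le_represents[OF L(2)[OF lF c]] by blast
  \<comment> \<open>\<open>F * H' N\<close> represents a polynomial in the shift applied to
    \<open>x\<close>, hence lies in \<open>M\<close>. The tails of \<open>H\<close> are small in the
    strong norm, so by \<open>l2_le_mult\<close> these products converge to \<open>F * H\<close>,
    and closedness applies.\<close>
  define H' where "H' N = Abs_fps (\<lambda>n. if n < N then fps_nth H n else 0)" for N
  have inM: "\<exists>y\<in>M. represents (F * H' N) y" for N
  proof (induction N)
    case 0
    have "H' 0 = 0" by (rule fps_ext) (simp add: H'_def)
    then show ?case using ell2.subspace_0[OF sub] by (intro bexI[of _ 0]) (auto simp: represents_def)
  next
    case (Suc N)
    then obtain y where y: "y \<in> M" "represents (F * H' N) y" by blast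
    have "\<exists>u\<in>M. represents (fps_X ^ n * F) u" for n
    proof (induction n)
      case (Suc n)
      then show ?case using represents_shift inv by (fastforce simp: mult.assoc)
    qed (use x rF in auto)
    then obtain u where u: "u \<in> M" "represents (fps_X ^ N * F) u" by blast
    have "H' (Suc N) = H' N + fps_const (fps_nth H N) * fps_X ^ N"
      by (rule fps_ext) (auto simp: H'_def fps_X_power_nth less_Suc_eq)
    then have "F * H' (Suc N) = F * H' N + fps_const (fps_nth H N) * (fps_X ^ N * F)"
      by (simp add: algebra_simps)
    then show ?case
      using represents_add[OF y(2) represents_cscale[OF u(2)]] y u sub
      by (auto intro!: bexI ell2.subspace_add ell2.subspace_scale)
  qed
  have "z \<in> M"
    unfolding closed_approachable[OF cl, symmetric]
  proof (intro allI impI)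
    fix e :: real assume "e > 0"
    \<comment> \<open>Adding 1 keeps the denominator positive when \<open>L\<close> is 0.\<close>
    define \<delta> where "\<delta> = e / (2 * (L * norm x + 1))"
    have Lx: "L * norm x \<ge> 0" using L(1) by simp
    have \<delta>: "\<delta> > 0" using \<open>e > 0\<close> Lx by (auto simp: \<delta>_def intro!: divide_pos_pos)
    let ?f = "\<lambda>n. (cmod (fps_nth H n) * \<omega> n)\<^sup>2"
    have "(\<Sum>n<N. ?f n) \<le> c\<^sup>2" for N
      using c unfolding l2_le_def L2_set_def by (auto intro: sqrt_le_D)
    then have "summable ?f" by (intro summableI_nonneg_bounded) auto
    then obtain N where N: "\<And>m n. m \<ge> N \<Longrightarrow> norm (sum ?f {m..<n}) < \<delta>\<^sup>2"
      using \<delta> unfolding summable_Cauchy by (meson zero_less_power)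
    have "l2_le (H - H' N) \<delta>"
      unfolding l2_le_def
    proof
      fix m
      have "(\<Sum>n<m. (cmod (fps_nth (H - H' N) n) * \<omega> n)\<^sup>2) = sum ?f {N..<m}"
        by (rule sum.mono_neutral_cong_right) (auto simp: H'_def)
      also have "\<dots> \<le> \<delta>\<^sup>2" using N[of N m] by simp
      finally show "L2_set (\<lambda>n. cmod (fps_nth (H - H' N) n) * \<omega> n) {..<m} \<le> \<delta>"
        unfolding L2_set_def using \<delta> by (intro real_le_lsqrt) auto
    qed
    then obtain v where v: "represents (F * (H - H' N)) v" "norm v \<le> L * norm x * \<delta>"
      using l2_le_represents[OF L(2)[OF lF]] by blast
    obtain y where y: "y \<in> M" "represents (F * H' N) y" using inM by blast
    have "represents (F * (H - H' N)) (z - y)"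
      using represents_diff[OF z y(2)] by (simp only: right_diff_distrib)
    then have "z - y = v"
      using v(1) unfolding represents_def by (intro ell2_eqI) simp
    moreover have "L * norm x * \<delta> < e"
    proof -
      have "L * norm x * \<delta> \<le> (L * norm x + 1) * \<delta>" using \<delta> by simp
      also have "\<dots> = e / 2" using Lx by (simp add: \<delta>_def field_simps)
      finally show ?thesis using \<open>e > 0\<close> by simp
    qed
    ultimately have "dist y z < e" using v(2) norm_minus_commute[of y z] by (simp add: dist_norm)
    then show "\<exists>y\<in>M. dist y z < e" using y(1) by blast
  qed
  then show thesis using that[of "p * p" z] p z FH by simp
qed

text \<open>Division with remainder by \<open>q\<close>: its shifts eliminate all basis vectors of
  index at least the degree. This reaches finitely supported vectors; closedness of \<open>V\<close>
  gives the rest.\<close>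

lemma finite_codim_if_contains_poly:
  assumes sub: "ell2.subspace M" and cl: "closed M" and inv: "weighted_shift \<omega> ` M \<subseteq> M"
    and q: "q \<noteq> 0" "x \<in> M" "represents (fps_of_poly q) x"
  shows "finite_codim M"
proof -
  define d where "d = degree q"
  define B where "B = basis_vec ` {..<d}"
  define V where "V = ell2.span (M \<union> B)"
  have subV: "ell2.subspace V" by (simp add: V_def)
  have MV: "M \<subseteq> V" "B \<subseteq> V" unfolding V_def using ell2.span_superset[of "M \<union> B"] by auto
  have shifted: "\<exists>u\<in>M. represents (fps_X ^ n * fps_of_poly q) u" for n
  proof (induction n)
    case (Suc n)
    then show ?case using represents_shift inv by (fastforce simp: mult.assoc)
  qed (use q in auto)
  have basis: "basis_vec n \<in> V" for n
  proof (induction n rule: less_induct)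
    case (less n)
    show ?case
    proof (cases "n < d")
      case True
      then show ?thesis using MV by (auto simp: B_def)
    next
      case False
      obtain u where u: "u \<in> M" "represents (fps_X ^ (n - d) * fps_of_poly q) u" using shifted by blast
      have c: "coord u i = (if i < n - d then 0 else coeff q (i - (n - d)) * of_real (\<omega> i))" for i
        using u(2) by (simp add: represents_def fps_X_power_mult_nth)
      \<comment> \<open>Shifting by \<open>n - d\<close> puts the leading coefficient of
        \<open>q\<close> at index \<open>n\<close>, so \<open>basis_vec n\<close> is expressed by
        \<open>u\<close> and earlier basis vectors.\<close>
      have top: "coord u n \<noteq> 0" using False q(1) by (simp add: c d_def)
      have high: "coord u i = 0" if "i > n" for i
        using that False by (simp add: c d_def coeff_eq_0)
      have "u = (\<Sum>i<n. cscale (coord u i) (basis_vec i)) + cscale (coord u n) (basis_vec n)"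
        by (rule ell2_eqI) (use high in \<open>auto simp: coord_sum if_distrib sum.delta not_less_iff_gr_or_eq cong: if_cong\<close>)
      then have "cscale (coord u n) (basis_vec n) = u - (\<Sum>i<n. cscale (coord u i) (basis_vec i))"
        by (simp add: algebra_simps)
      also have "\<dots> \<in> V"
        using u MV less by (intro ell2.subspace_diff ell2.subspace_sum ell2.subspace_scale subV) auto
      finally have "cscale (1 / coord u n) (cscale (coord u n) (basis_vec n)) \<in> V"
        by (rule ell2.subspace_scale[OF subV])
      then show ?thesis using top by simp
    qed
  qed
  have "y \<in> V" for y
  proof (rule closed_sequentially[OF _ _ truncation_tendsto])
    show "closed V" unfolding V_def B_def by (intro closed_span_Un_finite cl sub) auto
    show "(\<Sum>i<N. cscale (coord y i) (basis_vec i)) \<in> V" for N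
      by (intro ell2.subspace_sum ell2.subspace_scale subV basis)
  qed
  then have "ell2.span (M \<union> B) = UNIV" by (auto simp: V_def)
  moreover have "finite B" by (simp add: B_def)
  ultimately show ?thesis unfolding finite_codim_def by blast
qed

end

theorem theorem18:
  fixes \<omega> :: "nat \<Rightarrow> real"
  assumes ge1: "\<And>n. \<omega> n \<ge> 1"
    and root_lim: "(\<lambda>n. \<omega> n powr (1 / real n)) \<longlonglongrightarrow> 1"
    and concave: "\<And>k :: nat. eventually_concave_seq (\<lambda>n. ln (\<omega> n * (real n + 1) powr (- real k)))"
    and convex: "log_convex \<omega>"
    and diverges: "filterlim (\<lambda>N. \<Sum>n<N. ln (\<omega> n) / (real n powr (3 / 2) + 1)) at_top sequentially"
  shows "\<forall>M. ell2.subspace M \<and> closed M \<and> weighted_shift \<omega> ` M \<subseteq> M \<and> M \<noteq> {0} \<longrightarrow> finite_codim M"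
proof -
  interpret quasianalytic_weight \<omega>
    by unfold_locales (fact assms)+
  show ?thesis
    by (metis invariant_contains_poly finite_codim_if_contains_poly)
qed

end
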